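(* Let $\mathcal{Q}$ be a finite forest poset. Then the operad $\mathsf{As}(\mathcal{Q})$ is Koszul, and the set $\mathcal{N}(\mathcal{Q})$ of syntax trees forms a Poincaré–Birkhoff–Witt basis of $\mathsf{As}(\mathcal{Q})$.
   Context: Operads are nonsymmetric over a field $\mathbb{K}$ of characteristic zero; Koszulity is in the sense of Ginzburg–Kapranov (acyclicity of the Koszul complex). For a finite poset $(\mathcal{Q},\preccurlyeq_\mathcal{Q})$ and comparable $a,b$, $a\uparrow_\mathcal{Q} b:=\min(a,b)$. $\mathsf{As}(\mathcal{Q})$ is the operad generated by binary generators $\star_a$, $a\in\mathcal{Q}$, subject to the relations $\star_a\circ_1\star_b=\star_{a\uparrow_\mathcal{Q} b}\circ_2\star_{a\uparrow_\mathcal{Q} b}$ and $\star_{a\uparrow_\mathcal{Q} b}\circ_1\star_{a\uparrow_\mathcal{Q} b}=\star_a\circ_2\star_b$ for all comparable $a,b\in\mathcal{Q}$ (including $a=b$). A forest poset is a poset with no three elements $a,b,c$ such that $a,b$ are incomparable and $a\prec c$, $b\prec c$ (equivalently its Hasse diagram, drawn with minimal elements as roots, is a forest of rooted trees). $\mathcal{N}(\mathcal{Q})$ is the set of binary syntax trees with internal nodes labeled by the $\star_a$ such that for every internal node labeled $\star_a$: if its left child is an internal node labeled $\star_b$ then $a,b$ are incomparable, and if its right child is an internal node labeled $\star_b$ then $a=b$ or $a,b$ are incomparable. A Poincaré–Birkhoff–Witt basis is meant in the sense of Hoffbeck (a basis of normal forms with respect to a convergent orientation of the quadratic relations); in particular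 the images of the trees of $\mathcal{N}(\mathcal{Q})$ form a basis of $\mathsf{As}(\mathcal{Q})$. *)

theory Defs
  imports Complex_Main "HOL-Library.Tree" "HOL-Library.Poly_Mapping" "HOL-Library.Confluence"
begin

section \<open>Finitely supported linear combinations\<close>

definition scale :: "'k::field \<Rightarrow> ('b \<Rightarrow>\<^sub>0 'k) \<Rightarrow> ('b \<Rightarrow>\<^sub>0 'k)" where
  "scale c x = Poly_Mapping.map ((*) c) x"

lemma lookup_scale [simp]: "Poly_Mapping.lookup (scale c x) b = c * Poly_Mapping.lookup x b"
  by (simp add: scale_def Poly_Mapping.map.rep_eq when_def)

interpretation pm: vector_space "scale :: 'k::field \<Rightarrow> ('b \<Rightarrow>\<^sub>0 'k) \<Rightarrow> ('b \<Rightarrow>\<^sub>0 'k)"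
  by unfold_locales (simp_all add: poly_mapping_eq_iff fun_eq_iff lookup_add algebra_simps)

definition linear_extend :: "('b \<Rightarrow> ('c \<Rightarrow>\<^sub>0 'k)) \<Rightarrow> ('b \<Rightarrow>\<^sub>0 'k::field) \<Rightarrow> ('c \<Rightarrow>\<^sub>0 'k)" where
  "linear_extend f x =
     (\<Sum>b\<in>Poly_Mapping.keys x. scale (Poly_Mapping.lookup x b) (f b))"

definition bilinear_extend ::
    "('b \<Rightarrow> 'c \<Rightarrow> 'd) \<Rightarrow> ('b \<Rightarrow>\<^sub>0 'k::field) \<Rightarrow> ('c \<Rightarrow>\<^sub>0 'k) \<Rightarrow> ('d \<Rightarrow>\<^sub>0 'k)" where
  "bilinear_extend f x y =
     (\<Sum>b\<in>Poly_Mapping.keys x. \<Sum>c\<in>Poly_Mapping.keys y.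
        Poly_Mapping.single (f b c) (Poly_Mapping.lookup x b * Poly_Mapping.lookup y c))"


section \<open>Syntax trees and the free nonsymmetric operad on binary generators\<close>

text \<open>A tree with internal nodes labeled by generators has arity \<^const>\<open>size1\<close> (its number of
  leaves). Leaves are numbered from 1, from left to right.\<close>

definition syntax_trees :: "'a set \<Rightarrow> nat \<Rightarrow> 'a tree set" where
  "syntax_trees G n = {t. set_tree t \<subseteq> G \<and> size1 t = n}"

definition corolla :: "'a \<Rightarrow> 'a tree" where
  "corolla a = \<langle>\<langle>\<rangle>, a, \<langle>\<rangle>\<rangle>"

text \<open>\<open>graft t i s\<close> is the partial composition of \<open>s\<close> at the \<open>i\<close>-th leaf of \<open>t\<close>; it is only
  meaningful for \<open>1 \<le> i \<le> size1 t\<close>.\<close>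

fun graft :: "'a tree \<Rightarrow> nat \<Rightarrow> 'a tree \<Rightarrow> 'a tree" where
  "graft \<langle>\<rangle> i s = s"
| "graft \<langle>l, a, r\<rangle> i s =
     (if i \<le> size1 l then \<langle>graft l i s, a, r\<rangle> else \<langle>l, a, graft r (i - size1 l) s\<rangle>)"

text \<open>\<open>graft_all t ss\<close> is the full composition of \<open>t\<close> with the list \<open>ss\<close> of \<open>size1 t\<close> trees.\<close>

fun graft_all :: "'a tree \<Rightarrow> 'a tree list \<Rightarrow> 'a tree" where
  "graft_all \<langle>\<rangle> ss = hd ss"
| "graft_all \<langle>l, a, r\<rangle> ss =
     \<langle>graft_all l (take (size1 l) ss), a, graft_all r (drop (size1 l) ss)\<rangle>"

definition free_operad :: "'a set \<Rightarrow> nat \<Rightarrow> ('a tree \<Rightarrow>\<^sub>0 'k::field) set" where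
  "free_operad G n = {x. Poly_Mapping.keys x \<subseteq> syntax_trees G n}"

definition operad_comp ::
    "('a tree \<Rightarrow>\<^sub>0 'k::field) \<Rightarrow> nat \<Rightarrow> ('a tree \<Rightarrow>\<^sub>0 'k) \<Rightarrow> ('a tree \<Rightarrow>\<^sub>0 'k)" where
  "operad_comp x i y = bilinear_extend (\<lambda>t s. graft t i s) x y"

definition generator :: "'a \<Rightarrow> ('a tree \<Rightarrow>\<^sub>0 'k::field)" where
  "generator a = Poly_Mapping.single (corolla a) 1"


section \<open>Binary quadratic operads\<close>

text \<open>An operad is given by a binary quadratic presentation \<open>P\<close>: the generators have arity 2,
  and the relators are elements of arity 3 of the free operad. Its space of arity \<open>n\<close> is the
  quotient of \<open>free_operad (gens P) n\<close> by \<open>operad_ideal P n\<close>. Quotients by the ideal are handled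
  below by means of representatives.\<close>

record (overloaded) ('a, 'k) presentation =
  gens :: "'a set"
  rels :: "('a tree \<Rightarrow>\<^sub>0 'k::field) set"

inductive_set operad_ideal_graded ::
    "('a, 'k::field) presentation \<Rightarrow> (nat \<times> ('a tree \<Rightarrow>\<^sub>0 'k)) set"
  for P :: "('a, 'k) presentation" where
  rel: "x \<in> rels P \<Longrightarrow> (3, x) \<in> operad_ideal_graded P"
| zero: "(n, 0) \<in> operad_ideal_graded P"
| add: "(n, x) \<in> operad_ideal_graded P \<Longrightarrow> (n, y) \<in> operad_ideal_graded P
    \<Longrightarrow> (n, x + y) \<in> operad_ideal_graded P"
| scale: "(n, x) \<in> operad_ideal_graded P \<Longrightarrow> (n, scale c x) \<in> operad_ideal_graded P"
| comp_left: "(m, x) \<in> operad_ideal_graded P \<Longrightarrow> y \<in> free_operad (gens P) n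
    \<Longrightarrow> 1 \<le> i \<Longrightarrow> i \<le> m \<Longrightarrow> (m + n - 1, operad_comp x i y) \<in> operad_ideal_graded P"
| comp_right: "x \<in> free_operad (gens P) m \<Longrightarrow> (n, y) \<in> operad_ideal_graded P
    \<Longrightarrow> 1 \<le> i \<Longrightarrow> i \<le> m \<Longrightarrow> (m + n - 1, operad_comp x i y) \<in> operad_ideal_graded P"

definition operad_ideal ::
    "('a, 'k::field) presentation \<Rightarrow> nat \<Rightarrow> ('a tree \<Rightarrow>\<^sub>0 'k) set" where
  "operad_ideal P n = {x. (n, x) \<in> operad_ideal_graded P}"

text \<open>The images of the trees of \<open>N\<close> form a basis of the operad presented by \<open>P\<close>: every class
  has exactly one representative supported on \<open>N\<close>.\<close>

definition induces_basis :: "('a, 'k::field) presentation \<Rightarrow> 'a tree set \<Rightarrow> bool" where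
  "induces_basis P N \<longleftrightarrow>
     (\<forall>t\<in>N. set_tree t \<subseteq> gens P) \<and>
     (\<forall>n. \<forall>x\<in>free_operad (gens P) n. \<exists>!y. y \<in> free_operad (gens P) n \<and>
        Poly_Mapping.keys y \<subseteq> N \<and> x - y \<in> operad_ideal P n)"


section \<open>The Koszul complex\<close>

text \<open>
  The Koszul dual cooperad of \<open>P\<close> is the quadratic cooperad cogenerated by the suspension of the
  generators with corelators the double suspension of the relators: it consists of those elements
  of the cofree cooperad all of whose components on a pair of adjacent internal nodes, the
  rest \<open>U\<close>, \<open>ts\<close> of the tree being fixed, are (suspended) linear combinations of relators.

  The suspended generators have degree 1, so that a tree of arity \<open>n\<close> has degree \<open>n - 1\<close> and is
  identified with the tensor product of its node labels only after the nodes have been ordered. We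
  use the infix order. Consider a pair of adjacent nodes (parent \<open>p\<close>, child \<open>q\<close>) in the tree,
  with the three trees \<open>A\<close>, \<open>B\<close>, \<open>C\<close> grafted on it. A relator has its factors in the order
  \<open>p q\<close>. Passing from \<open>p q A B C\<close> to the infix order \<open>A q B p C\<close> (\<open>q\<close> a left child)
  contributes the Koszul sign \<open>(-1)^(1 + |B|)\<close>, and passing to \<open>A p B q C\<close> (\<open>q\<close> a right child)
  contributes \<open>(-1)^|B|\<close>. Since all other signs agree, in the infix convention the suspension
  amounts to reversing the sign of the trees whose child is on the right.\<close>

definition suspension_sign :: "'a tree \<Rightarrow> 'k::field" where
  "suspension_sign t = (if right t = \<langle>\<rangle> then 1 else - 1)"

definition koszul_dual_cooperad ::
    "('a, 'k::field) presentation \<Rightarrow> nat \<Rightarrow> ('a tree \<Rightarrow>\<^sub>0 'k) set" where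
  "koszul_dual_cooperad P n = {x \<in> free_operad (gens P) n.
     \<forall>U i ts. 1 \<le> i \<and> i \<le> size1 U \<and> length ts = 3 \<longrightarrow>
       (\<exists>r\<in>pm.span (rels P). \<forall>t. size1 t = 3 \<longrightarrow>
          Poly_Mapping.lookup x (graft U i (graft_all t ts)) =
            suspension_sign t * Poly_Mapping.lookup r t)}"

fun tensor_list :: "('b \<Rightarrow>\<^sub>0 'k::field) list \<Rightarrow> ('b list \<Rightarrow>\<^sub>0 'k)" where
  "tensor_list [] = Poly_Mapping.single [] 1"
| "tensor_list (f # fs) = bilinear_extend (#) f (tensor_list fs)"

definition tensor ::
    "('b \<Rightarrow>\<^sub>0 'k::field) \<Rightarrow> ('c \<Rightarrow>\<^sub>0 'k) list \<Rightarrow> ('b \<times> 'c list \<Rightarrow>\<^sub>0 'k)" where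
  "tensor q fs = bilinear_extend Pair q (tensor_list fs)"

text \<open>
  In arity \<open>n\<close> and homological degree \<open>k - 1\<close>, the Koszul complex (the composite product of the
  Koszul dual cooperad with the operad \<open>P\<close>) is the direct sum over \<open>ns\<close>, a composition of \<open>n\<close> in
  \<open>k\<close> parts, of the tensor products of \<open>koszul_dual_cooperad P k\<close> with the spaces of \<open>P\<close> of
  arities \<open>ns ! 0, ..., ns ! (k - 1)\<close>. As these spaces are quotients by the ideal, this is the
  quotient of \<open>koszul_chains P n k\<close> by \<open>koszul_null_chains P n k\<close>.\<close>

definition koszul_chains ::
    "('a, 'k::field) presentation \<Rightarrow> nat \<Rightarrow> nat \<Rightarrow> ('a tree \<times> 'a tree list \<Rightarrow>\<^sub>0 'k) set" where
  "koszul_chains P n k = pm.span {tensor q fs | q fs ns.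
     q \<in> koszul_dual_cooperad P k \<and> length ns = k \<and> sum_list ns = n \<and>
     list_all2 (\<lambda>i f. f \<in> free_operad (gens P) i) ns fs}"

definition koszul_null_chains ::
    "('a, 'k::field) presentation \<Rightarrow> nat \<Rightarrow> nat \<Rightarrow> ('a tree \<times> 'a tree list \<Rightarrow>\<^sub>0 'k) set" where
  "koszul_null_chains P n k = pm.span {tensor q fs | q fs ns.
     q \<in> koszul_dual_cooperad P k \<and> length ns = k \<and> sum_list ns = n \<and>
     list_all2 (\<lambda>i f. f \<in> free_operad (gens P) i) ns fs \<and>
     (\<exists>j<k. fs ! j \<in> operad_ideal P (ns ! j))}"

text \<open>The infinitesimal decompositions of a tree whose second factor is a single cogenerator.\<close>

definition top_decompositions :: "'a tree \<Rightarrow> ('a tree \<times> nat \<times> 'a) set" where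
  "top_decompositions t =
     {(t', i, g). 1 \<le> i \<and> i \<le> size1 t' \<and> t = graft t' i (corolla g)}"

lemma size1_graft:
  "1 \<le> i \<Longrightarrow> i \<le> size1 t \<Longrightarrow> size1 (graft t i s) + 1 = size1 t + size1 s"
proof (induction t arbitrary: i)
  case (Node l a r)
  show ?case
  proof (cases "i \<le> size1 l")
    case True
    with Node.IH(1)[of i] Node.prems show ?thesis by simp
  next
    case False
    with Node.IH(2)[of "i - size1 l"] Node.prems show ?thesis by simp
  qed
qed simp

lemma set_tree_graft:
  "1 \<le> i \<Longrightarrow> i \<le> size1 t \<Longrightarrow> set_tree (graft t i s) = set_tree t \<union> set_tree s"
  by (induction t arbitrary: i) auto

lemma finite_bounded_trees: "finite A \<Longrightarrow> finite {t. set_tree t \<subseteq> A \<and> size1 t \<le> n}"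
proof (induction n)
  case 0
  then show ?case by (simp add: size1_size)
next
  case (Suc n)
  let ?S = "{t. set_tree t \<subseteq> A \<and> size1 t \<le> n}"
  have "{t. set_tree t \<subseteq> A \<and> size1 t \<le> Suc n}
      \<subseteq> insert \<langle>\<rangle> ((\<lambda>(l, a, r). \<langle>l, a, r\<rangle>) ` (?S \<times> A \<times> ?S))"
  proof
    fix t :: "'a tree"
    assume t: "t \<in> {t. set_tree t \<subseteq> A \<and> size1 t \<le> Suc n}"
    show "t \<in> insert \<langle>\<rangle> ((\<lambda>(l, a, r). \<langle>l, a, r\<rangle>) ` (?S \<times> A \<times> ?S))"
    proof (cases t)
      case (Node l a r)
      with t have "l \<in> ?S \<and> a \<in> A \<and> r \<in> ?S"
        using size1_ge0[of l] size1_ge0[of r] by (auto simp del: size1_ge0)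
      with Node show ?thesis by (auto simp: image_iff)
    qed simp
  qed
  moreover have "finite \<dots>" using Suc by simp
  ultimately show ?case by (rule finite_subset)
qed

lemma finite_top_decompositions: "finite (top_decompositions t)"
proof (rule finite_subset)
  show "top_decompositions t \<subseteq>
      {s. set_tree s \<subseteq> set_tree t \<and> size1 s \<le> size1 t} \<times> {..size1 t} \<times> set_tree t"
  proof
    fix d assume "d \<in> top_decompositions t"
    then obtain t' i g where d: "d = (t', i, g)" "1 \<le> i" "i \<le> size1 t'"
      and t: "t = graft t' i (corolla g)"
      by (auto simp: top_decompositions_def)
    have "size1 t + 1 = size1 t' + 2"
      using size1_graft[OF d(2,3), of "corolla g"] t by (simp add: corolla_def)
    moreover have "set_tree t = insert g (set_tree t')"
      using set_tree_graft[OF d(2,3), of "corolla g"] t by (simp add: corolla_def)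
    ultimately show "d \<in> {s. set_tree s \<subseteq> set_tree t \<and> size1 s \<le> size1 t}
        \<times> {..size1 t} \<times> set_tree t"
      using d by auto
  qed
  show "finite ({s. set_tree s \<subseteq> set_tree t \<and> size1 s \<le> size1 t} \<times> {..size1 t} \<times> set_tree t)"
    by (intro finite_cartesian_product finite_bounded_trees) auto
qed

text \<open>
  The Koszul differential splits off a top node \<open>g\<close> of the cooperad factor and composes it with the
  two elements of \<open>P\<close> grafted on it. In the infix order, the node between the leaves \<open>i\<close> and
  \<open>i + 1\<close> of a tree with \<open>k - 1\<close> nodes moves past \<open>k - 1 - i\<close> nodes to reach the last position,
  and then the twisting morphism, of degree \<open>-1\<close>, passes the \<open>k - 2\<close> remaining nodes; the
  resulting Koszul sign is \<open>(-1)^(i + 1)\<close>.\<close>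

definition koszul_differential ::
    "('a tree \<times> 'a tree list \<Rightarrow>\<^sub>0 'k::field) \<Rightarrow> ('a tree \<times> 'a tree list \<Rightarrow>\<^sub>0 'k)" where
  "koszul_differential = linear_extend (\<lambda>(t, ss).
     \<Sum>(t', i, g)\<in>top_decompositions t.
       Poly_Mapping.single
         (t', take (i - 1) ss @ [\<langle>ss ! (i - 1), g, ss ! i\<rangle>] @ drop (i + 1) ss)
         ((- 1) ^ (i + 1)))"

text \<open>
  Acyclicity of the Koszul complex: its homology is the identity operad. In arity 1 the complex is
  the ground field in degree 0 for every \<open>P\<close>, so the condition is exactness in all arities
  \<open>n \<ge> 2\<close>.\<close>

definition koszul :: "('a, 'k::field) presentation \<Rightarrow> bool" where
  "koszul P \<longleftrightarrow>
     (\<forall>n\<ge>2. \<forall>k. \<forall>z\<in>koszul_chains P n k.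
        koszul_differential z \<in> koszul_null_chains P n (k - 1) \<longrightarrow>
        (\<exists>w\<in>koszul_chains P n (k + 1). z - koszul_differential w \<in> koszul_null_chains P n k))"


section \<open>Poincare-Birkhoff-Witt bases\<close>

text \<open>An orientation is a set of rewrite rules between trees with two internal nodes whose
  differences span the space of relations. A PBW basis is the set of normal forms of an orientation
  that is convergent once closed under contexts.\<close>

definition orientation ::
    "('a, 'k::field) presentation \<Rightarrow> ('a tree \<times> 'a tree) set \<Rightarrow> bool" where
  "orientation P rl \<longleftrightarrow>
     rl \<subseteq> syntax_trees (gens P) 3 \<times> syntax_trees (gens P) 3 \<and>
     pm.span {Poly_Mapping.single s 1 - Poly_Mapping.single t 1 | s t. (s, t) \<in> rl} =
       pm.span (rels P)"

inductive rewrite_step :: "'a set \<Rightarrow> ('a tree \<times> 'a tree) set \<Rightarrow> 'a tree \<Rightarrow> 'a tree \<Rightarrow> bool"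
  for G :: "'a set" and rl :: "('a tree \<times> 'a tree) set" where
  "(s, t) \<in> rl \<Longrightarrow> set_tree U \<subseteq> G \<Longrightarrow> 1 \<le> i \<Longrightarrow> i \<le> size1 U \<Longrightarrow>
   length ts = 3 \<Longrightarrow> (\<forall>u\<in>set ts. set_tree u \<subseteq> G) \<Longrightarrow>
   rewrite_step G rl (graft U i (graft_all s ts)) (graft U i (graft_all t ts))"

definition rewriting_normal_forms :: "'a set \<Rightarrow> ('a tree \<times> 'a tree) set \<Rightarrow> 'a tree set" where
  "rewriting_normal_forms G rl = {t. set_tree t \<subseteq> G \<and> \<not> (\<exists>t'. rewrite_step G rl t t')}"

definition pbw_basis :: "('a, 'k::field) presentation \<Rightarrow> 'a tree set \<Rightarrow> bool" where
  "pbw_basis P N \<longleftrightarrow>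
     (\<exists>rl. orientation P rl \<and>
        wfp (rewrite_step (gens P) rl)\<inverse>\<inverse> \<and> confluentp (rewrite_step (gens P) rl) \<and>
        N = rewriting_normal_forms (gens P) rl) \<and>
     induces_basis P N"


section \<open>The operad of a poset\<close>

text \<open>A poset is a carrier \<open>Q\<close> with its reflexive order relation \<open>le\<close>.\<close>

definition comparable :: "('a \<times> 'a) set \<Rightarrow> 'a \<Rightarrow> 'a \<Rightarrow> bool" where
  "comparable le a b \<longleftrightarrow> (a, b) \<in> le \<or> (b, a) \<in> le"

definition forest_poset :: "'a set \<Rightarrow> ('a \<times> 'a) set \<Rightarrow> bool" where
  "forest_poset Q le \<longleftrightarrow> partial_order_on Q le \<and>
     \<not> (\<exists>a\<in>Q. \<exists>b\<in>Q. \<exists>c\<in>Q. \<not> comparable le a b \<and>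
          (a, c) \<in> le \<and> a \<noteq> c \<and> (b, c) \<in> le \<and> b \<noteq> c)"

definition poset_min :: "('a \<times> 'a) set \<Rightarrow> 'a \<Rightarrow> 'a \<Rightarrow> 'a" where
  "poset_min le a b = (if (a, b) \<in> le then a else b)"

definition As :: "'a set \<Rightarrow> ('a \<times> 'a) set \<Rightarrow> ('a, 'k::field) presentation" where
  "As Q le = \<lparr>gens = Q, rels =
     {operad_comp (generator a) 1 (generator b) - operad_comp (generator m) 2 (generator m) | a b m.
        a \<in> Q \<and> b \<in> Q \<and> comparable le a b \<and> m = poset_min le a b} \<union>
     {operad_comp (generator m) 1 (generator m) - operad_comp (generator a) 2 (generator b) | a b m.
        a \<in> Q \<and> b \<in> Q \<and> comparable le a b \<and> m = poset_min le a b}\<rparr>"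

definition normal_trees :: "'a set \<Rightarrow> ('a \<times> 'a) set \<Rightarrow> 'a tree set" where
  "normal_trees Q le = {t. set_tree t \<subseteq> Q \<and> (\<forall>l a r. \<langle>l, a, r\<rangle> \<in> subtrees t \<longrightarrow>
     (\<forall>l' b r'. l = \<langle>l', b, r'\<rangle> \<longrightarrow> \<not> comparable le a b) \<and>
     (\<forall>l' b r'. r = \<langle>l', b, r'\<rangle> \<longrightarrow> a = b \<or> \<not> comparable le a b))}"

end

theory Submission
  imports Defs
begin

text \<open>
  In a forest poset, put \<open>y a = \<star>a - \<star>p\<close>, where \<open>p\<close> is the lower cover of \<open>a\<close> (\<open>y a = \<star>a\<close> if \<open>a\<close> is
  minimal), so that \<open>\<star>a\<close> is the sum of the \<open>y b\<close> with \<open>b \<preceq> a\<close>. In these generators the relations become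
  \<open>y a \<circ>\<^sub>1 y a = y a \<circ>\<^sub>2 y a\<close> and \<open>y a \<circ>\<^sub>i y b = 0\<close> for distinct comparable \<open>a\<close>, \<open>b\<close>. They only involve the
  comparability graph, and both the operad and its Koszul dual cooperad get explicit bases: Schroeder
  trees whose adjacent labels are not comparable, respectively distinct and comparable. The
  Koszul complex is contracted by a homotopy that moves a node from the operad part to the cooperad
  part near the leftmost leaf. Linear independence of the normal trees, and with it the confluence
  of the orientation, holds because a normal tree in the old generators is the same
  tree in the new ones plus trees with smaller labels.\<close>

section \<open>Linear extension\<close>

text \<open>The relations only see the minimum of two comparable labels, as multiplication does in
  the algebra of a meet semilattice; the \<open>y a\<close> are the analogue of the orthogonal
  idempotents that Moebius inversion produces there. The forest condition enters twice. The elements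
  strictly below \<open>a\<close> form a chain, so there is at most one lower cover and Moebius
  inversion is a single difference. Elements below two comparable labels are again comparable, so
  all mixed terms of a product are relators. A Schroeder tree is encoded as a binary tree in which
  no left child has the label of its parent (\<open>is_rnf\<close>): a vertex with several children
  is a right comb of equal labels. Operad and cooperad are thus both indexed by binary trees, and a
  chain of the Koszul complex becomes one binary tree with a cut. The complex itself is given by
  representatives modulo null chains, so the contraction lives on combinations of cut trees, and
  \<open>rot_chain\<close> and \<open>coord\<close> translate between these and chains.\<close>

abbreviation "coef \<equiv> Poly_Mapping.lookup"
abbreviation "supp \<equiv> Poly_Mapping.keys"
abbreviation "lext \<equiv> linear_extend"
abbreviation bas :: "'b \<Rightarrow> ('b \<Rightarrow>\<^sub>0 'k::field)" where "bas b \<equiv> Poly_Mapping.single b 1"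

lemma finsupp_eqI: "(\<And>b. coef x b = coef y b) \<Longrightarrow> x = y"
  by (simp add: poly_mapping_eq_iff fun_eq_iff)

lemma lext_superset:
  assumes "finite A" "supp x \<subseteq> A"
  shows "lext f x = (\<Sum>b\<in>A. scale (coef x b) (f b))"
  unfolding linear_extend_def
  by (rule sum.mono_neutral_left) (use assms in \<open>auto simp: in_keys_iff\<close>)

lemma lext_add: "lext f (x + y) = lext f x + lext f y"
proof -
  let ?A = "supp x \<union> supp y"
  have A: "finite ?A" "supp (x + y) \<subseteq> ?A" "supp x \<subseteq> ?A" "supp y \<subseteq> ?A"
    using keys_add[of x y] by auto
  show ?thesis
    unfolding lext_superset[OF A(1,2)] lext_superset[OF A(1,3)]
      lext_superset[OF A(1,4)]
    by (simp add: lookup_add pm.scale_left_distrib sum.distrib)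
qed

lemma lext_scale: "lext f (scale c x) = scale c (lext f x)"
proof -
  have A: "finite (supp x)" "supp (scale c x) \<subseteq> supp x" "supp x \<subseteq> supp x"
    by (auto simp: in_keys_iff)
  show ?thesis
    unfolding lext_superset[OF A(1,2)] lext_superset[OF A(1,3)]
    by (simp add: pm.scale_sum_right)
qed

lemma lext_zero [simp]: "lext f 0 = 0"
  by (simp add: linear_extend_def)

lemma lext_single: "lext f (Poly_Mapping.single b c) = scale c (f b)"
  by (cases "c = 0") (simp_all add: linear_extend_def)

lemma lext_bas [simp]: "lext f (bas b) = f b"
  by (simp add: lext_single)

lemma lext_neg: "lext f (- x) = - lext f x"
  using lext_scale[of f "-1" x] by simp

lemma lext_diff: "lext f (x - y) = lext f x - lext f y"
  using lext_add[of f x "- y"] by (simp add: lext_neg)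

lemma lext_sum: "lext f (sum g A) = (\<Sum>a\<in>A. lext f (g a))"
  by (induction A rule: infinite_finite_induct) (simp_all add: lext_add)

lemmas lext_lin = lext_add lext_scale lext_neg
  lext_diff lext_sum

lemma lext_cong:
  "x = y \<Longrightarrow> (\<And>b. b \<in> supp y \<Longrightarrow> f b = g b) \<Longrightarrow> lext f x = lext g y"
  by (simp add: linear_extend_def)

lemma lext_fun_add:
  "lext (\<lambda>b. f b + g b) x = lext f x + lext g x"
  by (simp add: linear_extend_def pm.scale_right_distrib sum.distrib)

lemma lext_fun_diff:
  "lext (\<lambda>b. f b - g b) x = lext f x - lext g x"
  by (simp add: linear_extend_def pm.scale_right_diff_distrib sum_subtractf)

lemma lext_fun_neg: "lext (\<lambda>b. - f b) x = - lext f x"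
  by (simp add: linear_extend_def sum_negf)

lemma lext_fun_scale:
  "lext (\<lambda>b. scale c (f b)) x = scale c (lext f x)"
  by (simp add: linear_extend_def pm.scale_sum_right mult.commute)

lemma lext_fun_zero [simp]: "lext (\<lambda>b. 0) x = 0"
  by (simp add: linear_extend_def)

lemma lext_fun_sum:
  "lext (\<lambda>b. \<Sum>a\<in>A. f a b) x = (\<Sum>a\<in>A. lext (f a) x)"
  by (induction A rule: infinite_finite_induct) (simp_all add: lext_fun_add)

lemmas lext_fun_lin = lext_fun_add lext_fun_diff
  lext_fun_neg lext_fun_scale lext_fun_sum

lemma lext_lext:
  "lext f (lext g x) = lext (\<lambda>b. lext f (g b)) x"
  by (simp add: linear_extend_def[of g] linear_extend_def[of "\<lambda>b. lext f (g b)"]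
      lext_sum lext_scale)

lemma lext_id [simp]: "lext bas x = x"
proof (rule finsupp_eqI)
  fix b
  have "coef (lext bas x) b = (\<Sum>c\<in>supp x. coef x c * (if c = b then 1 else 0))"
    by (simp add: linear_extend_def lookup_sum lookup_single when_def)
  also have "\<dots> = coef x b"
    by (simp add: if_distrib sum.delta in_keys_iff cong: if_cong)
  finally show "coef (lext bas x) b = coef x b" .
qed

lemma coef_lext: "coef (lext f x) c = (\<Sum>b\<in>supp x. coef x b * coef (f b) c)"
  by (simp add: linear_extend_def lookup_sum)

lemma coef_lext_superset:
  assumes "finite A" "supp x \<subseteq> A"
  shows "coef (lext f x) c = (\<Sum>b\<in>A. coef x b * coef (f b) c)"
  by (simp add: lext_superset[OF assms] lookup_sum)

lemma lext_swap:
  "lext (\<lambda>b. lext (\<lambda>c. f b c) y) x = lext (\<lambda>c. lext (\<lambda>b. f b c) x) y"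
  by (simp add: linear_extend_def pm.scale_sum_right mult.commute
      sum.swap[of _ "supp x" "supp y"])

lemma supp_lext: "supp (lext f x) \<subseteq> (\<Union>b\<in>supp x. supp (f b))"
proof
  fix c assume "c \<in> supp (lext f x)"
  then have "(\<Sum>b\<in>supp x. coef x b * coef (f b) c) \<noteq> 0"
    by (simp add: in_keys_iff coef_lext)
  then obtain b where "b \<in> supp x" "coef x b * coef (f b) c \<noteq> 0"
    by (meson sum.neutral)
  then show "c \<in> (\<Union>b\<in>supp x. supp (f b))" by (auto simp: in_keys_iff)
qed

lemma in_supp_lext:
  assumes "c \<in> supp (lext f x)"
  obtains b where "b \<in> supp x" "c \<in> supp (f b)"
  using assms supp_lext by fastforce

lemma supp_add_cases: "c \<in> supp (x + y) \<Longrightarrow> c \<in> supp x \<or> c \<in> supp y"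
  using keys_add[of x y] by auto

lemma supp_diff_cases: "c \<in> supp (x - y) \<Longrightarrow> c \<in> supp x \<or> c \<in> supp y"
  by (auto simp: in_keys_iff lookup_minus)

lemma supp_scale: "supp (scale c x) \<subseteq> supp x"
  by (auto simp: in_keys_iff)

lemma bilinear_extend_lext:
  "bilinear_extend f x y = lext (\<lambda>b. lext (\<lambda>c. bas (f b c)) y) x"
  unfolding bilinear_extend_def linear_extend_def pm.scale_sum_right
  by (intro sum.cong refl finsupp_eqI) (simp add: lookup_single when_def)

lemma lext_in_span:
  "(\<And>b. b \<in> supp x \<Longrightarrow> f b \<in> pm.span S) \<Longrightarrow> lext f x \<in> pm.span S"
  unfolding linear_extend_def by (intro pm.span_sum pm.span_scale)

lemma lext_in_subspace:
  "pm.subspace S \<Longrightarrow> (\<And>b. b \<in> supp x \<Longrightarrow> f b \<in> S) \<Longrightarrow> lext f x \<in> S"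
  unfolding linear_extend_def by (intro pm.subspace_sum pm.subspace_scale)

lemma lext_maps_span:
  assumes "x \<in> pm.span B" "\<And>b. b \<in> B \<Longrightarrow> lext f b \<in> pm.span C"
  shows "lext f x \<in> pm.span C"
  using assms(1)
proof (induction rule: pm.span_induct_alt)
  case (step c b y)
  then show ?case
    by (simp add: lext_lin assms(2) pm.span_add pm.span_scale)
qed (simp add: pm.span_zero)

lemma lext_eq_on_span:
  assumes "x \<in> pm.span B" "\<And>b. b \<in> B \<Longrightarrow> lext f b = lext g b"
  shows "lext f x = lext g x"
  using assms(1)
proof (induction rule: pm.span_induct_alt)
  case (step c b y)
  then show ?case by (simp add: lext_lin assms(2))
qed simp

section \<open>Tensors of linear combinations\<close>

abbreviation push :: "('b \<Rightarrow> 'c) \<Rightarrow> ('b \<Rightarrow>\<^sub>0 'k::field) \<Rightarrow> ('c \<Rightarrow>\<^sub>0 'k)" where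
  "push f \<equiv> lext (\<lambda>b. bas (f b))"

lemma tensor_list_Cons:
  "tensor_list (f # fs) = lext (\<lambda>b. push ((#) b) (tensor_list fs)) f"
  by (simp add: bilinear_extend_lext)

lemma tensor_eq:
  "tensor q fs = lext (\<lambda>b. push (Pair b) (tensor_list fs)) q"
  by (simp add: tensor_def bilinear_extend_lext)

lemma tensor_list_bas [simp]: "tensor_list (map bas ss) = bas ss"
  by (induction ss) (simp_all add: tensor_list_Cons del: tensor_list.simps(2))

lemma supp_tensor_list: "ss \<in> supp (tensor_list fs) \<Longrightarrow> list_all2 (\<lambda>s f. s \<in> supp f) ss fs"
proof (induction fs arbitrary: ss)
  case (Cons f fs)
  from Cons.prems obtain b where "b \<in> supp f" "ss \<in> supp (push ((#) b) (tensor_list fs))"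
    unfolding tensor_list_Cons by (rule in_supp_lext)
  moreover then obtain bs where "bs \<in> supp (tensor_list fs)" "ss = b # bs"
    by (elim in_supp_lext) simp
  ultimately show ?case using Cons.IH by simp
qed simp

lemma tensor_list_zero: "0 \<in> set fs \<Longrightarrow> tensor_list fs = 0"
proof (induction fs)
  case (Cons f fs)
  then show ?case by (cases "f = 0") (simp_all add: tensor_list_Cons del: tensor_list.simps(2))
qed simp

lemma lext_tensor_list:
  "lext (\<lambda>ss. tensor_list (map B ss)) (tensor_list fs) = tensor_list (map (lext B) fs)"
proof (induction fs)
  case (Cons f fs)
  have "lext (\<lambda>ss. tensor_list (map B ss)) (tensor_list (f # fs))
     = lext (\<lambda>b. lext (\<lambda>bs. lext (\<lambda>c. push ((#) c) (tensor_list (map B bs))) (B b))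
          (tensor_list fs)) f"
    by (simp add: tensor_list_Cons lext_lext del: tensor_list.simps(2))
  also have "\<dots> = lext (\<lambda>b. lext (\<lambda>c. push ((#) c)
      (lext (\<lambda>bs. tensor_list (map B bs)) (tensor_list fs))) (B b)) f"
    by (simp add: lext_lext lext_swap[of _ "tensor_list fs"])
  also have "\<dots> = tensor_list (map (lext B) (f # fs))"
    unfolding Cons.IH by (simp add: tensor_list_Cons lext_lext del: tensor_list.simps(2))
  finally show ?case .
qed simp

text \<open>A linear map given on basis pairs can thus be evaluated on any tensor. This serves the
  change of generators, the coordinates of chains and the expansion over rotation classes.\<close>

lemma lext_tensor:
  "lext (\<lambda>(t, ss). tensor (A t) (map B ss)) (tensor q fs)
     = tensor (lext A q) (map (lext B) fs)"
proof -
  have "lext (\<lambda>(t, ss). tensor (A t) (map B ss)) (tensor q fs)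
     = lext (\<lambda>b. lext (\<lambda>ss. lext (\<lambda>c. push (Pair c) (tensor_list (map B ss))) (A b))
          (tensor_list fs)) q"
    by (simp add: tensor_eq lext_lext)
  also have "\<dots> = lext (\<lambda>b. lext (\<lambda>c. push (Pair c)
      (lext (\<lambda>ss. tensor_list (map B ss)) (tensor_list fs))) (A b)) q"
    by (simp add: lext_lext lext_swap[of _ "tensor_list fs"])
  also have "\<dots> = tensor (lext A q) (map (lext B) fs)"
    unfolding lext_tensor_list by (simp add: tensor_eq lext_lext)
  finally show ?thesis .
qed

section \<open>Grafting, free operads and ideals\<close>

text \<open>Lets an induction on the grafted tree, with arbitrary context, descend into the left
  subtree: the root and the right subtree are absorbed by the context.
  \<open>graft_graft_right\<close> is the mirror image, its index shifted by the leaves of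
  \<open>l\<close>.\<close>

lemma graft_graft_left:
  "1 \<le> i \<Longrightarrow> i \<le> size1 U \<Longrightarrow> graft (graft U i \<langle>Leaf, a, r\<rangle>) i l = graft U i \<langle>l, a, r\<rangle>"
proof (induction U arbitrary: i)
  case (Node A b B)
  show ?case
  proof (cases "i \<le> size1 A")
    case True
    moreover have "i \<le> size1 (graft A i \<langle>Leaf, a, r\<rangle>)"
      using size1_graft[of i A "\<langle>Leaf, a, r\<rangle>"] True Node.prems by simp
    ultimately show ?thesis using Node by simp
  next
    case False
    then show ?thesis using Node by simp
  qed
qed simp

lemma graft_graft_right:
  "1 \<le> i \<Longrightarrow> i \<le> size1 U \<Longrightarrow>
   graft (graft U i \<langle>l, a, Leaf\<rangle>) (i + size1 l) r = graft U i \<langle>l, a, r\<rangle>"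
proof (induction U arbitrary: i)
  case (Node A b B)
  show ?case
  proof (cases "i \<le> size1 A")
    case True
    moreover have "i + size1 l \<le> size1 (graft A i \<langle>l, a, Leaf\<rangle>)"
      using size1_graft[of i A "\<langle>l, a, Leaf\<rangle>"] True Node.prems by simp
    ultimately show ?thesis using Node by simp
  next
    case False
    moreover from this have "i + size1 l - size1 A = i - size1 A + size1 l" by simp
    moreover have "Suc 0 \<le> i - size1 A" "i - size1 A \<le> size1 B" using False Node.prems by auto
    ultimately show ?thesis using Node.IH(2)[of "i - size1 A"] by simp
  qed
qed simp

lemma operad_comp_eq:
  "operad_comp x i y = lext (\<lambda>t. push (\<lambda>s. graft t i s) y) x"
  by (simp add: operad_comp_def bilinear_extend_lext)

lemma operad_comp_bas [simp]: "operad_comp (bas t) i (bas s) = bas (graft t i s)"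
  by (simp add: operad_comp_eq)

lemma subspace_free_operad: "pm.subspace (free_operad G n)"
  unfolding pm.subspace_def free_operad_def
  using keys_add supp_scale by (fastforce simp: subset_iff)

lemma free_operad_iff: "x \<in> free_operad G n \<longleftrightarrow> (\<forall>t\<in>supp x. set_tree t \<subseteq> G \<and> size1 t = n)"
  by (auto simp: free_operad_def syntax_trees_def)

lemma bas_in_free_operad [simp]:
  "bas t \<in> free_operad G n \<longleftrightarrow> set_tree t \<subseteq> G \<and> size1 t = n"
  by (simp add: free_operad_iff)

lemma operad_comp_in_free_operad:
  assumes "x \<in> free_operad G m" "y \<in> free_operad G n" "1 \<le> i" "i \<le> m"
  shows "operad_comp x i y \<in> free_operad G (m + n - 1)"
  unfolding operad_comp_eq
proof (intro lext_in_subspace subspace_free_operad)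
  fix t s assume "t \<in> supp x" "s \<in> supp y"
  then show "bas (graft t i s) \<in> free_operad G (m + n - 1)"
    using assms size1_graft[of i t s] set_tree_graft[of i t s] by (fastforce simp: free_operad_iff)
qed

lemma subspace_operad_ideal: "pm.subspace (operad_ideal P n)"
  by (auto simp: pm.subspace_def operad_ideal_def intro: operad_ideal_graded.intros)

lemma span_rels_subset_ideal: "pm.span (rels P) \<subseteq> operad_ideal P 3"
  by (intro pm.span_minimal subspace_operad_ideal)
    (auto simp: operad_ideal_def intro: operad_ideal_graded.rel)

lemma operad_ideal_subset_free:
  assumes "rels P \<subseteq> free_operad (gens P) 3"
  shows "operad_ideal P n \<subseteq> free_operad (gens P) n"
proof
  fix x assume "x \<in> operad_ideal P n"
  then have "(n, x) \<in> operad_ideal_graded P" by (simp add: operad_ideal_def)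
  then show "x \<in> free_operad (gens P) n"
  proof induction
    case (rel x)
    then show ?case using assms by auto
  next
    case (comp_left m x y n i)
    then show ?case by (intro operad_comp_in_free_operad)
  next
    case (comp_right x m n y i)
    then show ?case by (intro operad_comp_in_free_operad)
  qed (auto intro: pm.subspace_add pm.subspace_scale subspace_free_operad
      simp: pm.subspace_0[OF subspace_free_operad])
qed

lemma operad_ideal_comp_left:
  "x \<in> operad_ideal P m \<Longrightarrow> y \<in> free_operad (gens P) n \<Longrightarrow> 1 \<le> i \<Longrightarrow> i \<le> m
    \<Longrightarrow> operad_comp x i y \<in> operad_ideal P (m + n - 1)"
  unfolding operad_ideal_def mem_Collect_eq by (rule operad_ideal_graded.comp_left)

lemma operad_ideal_comp_right:
  "x \<in> free_operad (gens P) m \<Longrightarrow> y \<in> operad_ideal P n \<Longrightarrow> 1 \<le> i \<Longrightarrow> i \<le> m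
    \<Longrightarrow> operad_comp x i y \<in> operad_ideal P (m + n - 1)"
  unfolding operad_ideal_def mem_Collect_eq by (rule operad_ideal_graded.comp_right)

section \<open>Trees with two nodes\<close>

abbreviation lcomb :: "'a \<Rightarrow> 'a \<Rightarrow> 'a tree" where "lcomb a b \<equiv> \<langle>\<langle>Leaf, b, Leaf\<rangle>, a, Leaf\<rangle>"
abbreviation rcomb :: "'a \<Rightarrow> 'a \<Rightarrow> 'a tree" where "rcomb a b \<equiv> \<langle>Leaf, a, \<langle>Leaf, b, Leaf\<rangle>\<rangle>"

lemma size1_eq_1: "size1 t = Suc 0 \<longleftrightarrow> t = Leaf"
  by (simp add: size1_size)

lemma size1_eq_2: "size1 t = 2 \<longleftrightarrow> (\<exists>a. t = \<langle>Leaf, a, Leaf\<rangle>)"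
  by (cases t) (auto simp: size1_size)

lemma size1_eq_3: "size1 t = 3 \<longleftrightarrow> (\<exists>a b. t = lcomb a b) \<or> (\<exists>a b. t = rcomb a b)"
proof
  assume t: "size1 t = 3"
  then obtain l a r where n: "t = \<langle>l, a, r\<rangle>" by (cases t) auto
  then have "size1 l = 1 \<and> size1 r = 2 \<or> size1 l = 2 \<and> size1 r = 1"
    using t size1_ge0[of l] size1_ge0[of r] by (auto simp del: size1_ge0)
  then show "(\<exists>a b. t = lcomb a b) \<or> (\<exists>a b. t = rcomb a b)"
    using n by (auto simp: size1_eq_1 size1_eq_2)
qed auto

lemma operad_comp_generator [simp]:
  "operad_comp (generator a) (Suc 0) (generator b) = bas (lcomb a b)"
  "operad_comp (generator a) 2 (generator b) = bas (rcomb a b)"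
  by (simp_all add: generator_def corolla_def)

lemma length_3_conv: "length xs = 3 \<longleftrightarrow> (\<exists>x y z. xs = [x, y, z])"
  by (auto simp: length_Suc_conv numeral_3_eq_3)

section \<open>Change of generators\<close>

text \<open>The value on a tree of the morphism of free operads that extends
  \<open>f\<close>.\<close>

fun tree_subst :: "('a \<Rightarrow> ('b \<Rightarrow>\<^sub>0 'k::field)) \<Rightarrow> 'a tree \<Rightarrow> ('b tree \<Rightarrow>\<^sub>0 'k)" where
  "tree_subst f Leaf = bas Leaf"
| "tree_subst f \<langle>l, a, r\<rangle> = lext (\<lambda>l'. lext (\<lambda>b.
     push (\<lambda>r'. \<langle>l', b, r'\<rangle>) (tree_subst f r)) (f a)) (tree_subst f l)"

abbreviation lin_subst :: "('a \<Rightarrow> ('b \<Rightarrow>\<^sub>0 'k::field)) \<Rightarrow> ('a tree \<Rightarrow>\<^sub>0 'k) \<Rightarrow> ('b tree \<Rightarrow>\<^sub>0 'k)" where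
  "lin_subst f \<equiv> lext (tree_subst f)"

abbreviation shape :: "'a tree \<Rightarrow> unit tree" where
  "shape \<equiv> map_tree (\<lambda>_. ())"

lemma shape_size1: "shape s = shape t \<Longrightarrow> size1 s = size1 t"
  by (metis size1_map_tree)

lemma shape_Node_iff:
  "shape t = \<langle>l, u, r\<rangle> \<longleftrightarrow> (\<exists>l' a r'. t = \<langle>l', a, r'\<rangle> \<and> shape l' = l \<and> shape r' = r)"
  by (cases t) auto

lemma shape_Leaf_iff: "shape t = Leaf \<longleftrightarrow> t = Leaf"
  by (cases t) auto

lemma coef_lext_unique:
  assumes "\<And>b'. b' \<noteq> b \<Longrightarrow> coef (f b') c = 0"
  shows "coef (lext f x) c = coef x b * coef (f b) c"
proof -
  have "coef (lext f x) c = (\<Sum>b'\<in>insert b (supp x). coef x b' * coef (f b') c)"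
    by (rule coef_lext_superset) auto
  also have "\<dots> = (\<Sum>b'\<in>{b}. coef x b' * coef (f b') c)"
    by (rule sum.mono_neutral_right) (auto simp: assms)
  finally show ?thesis by simp
qed

text \<open>Each target tree arises from one choice of left part, label and right part, so
  coefficients are products over the nodes.\<close>

lemma coef_tree_subst_Node [simp]:
  "coef (tree_subst f \<langle>l, a, r\<rangle>) \<langle>l', b, r'\<rangle> = coef (tree_subst f l) l' * (coef (f a) b * coef (tree_subst f r) r')"
proof -
  have z1: "coef (push (\<lambda>r'. \<langle>m, c, r'\<rangle>) x) \<langle>l', b, r'\<rangle> = 0" if "m \<noteq> l' \<or> c \<noteq> b" for m c x
    using that by (auto simp: coef_lext lookup_single when_def intro!: sum.neutral)
  have z2: "coef (lext (\<lambda>c. push (\<lambda>r'. \<langle>m, c, r'\<rangle>) x) y) \<langle>l', b, r'\<rangle> = 0" if "m \<noteq> l'" for m x y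
    using that by (simp add: coef_lext[of _ y] z1)
  show ?thesis
    by (simp add: coef_lext_unique[of l'] z2 coef_lext_unique[of b] z1
        coef_lext_unique[of r'] lookup_single when_def)
qed

lemma supp_tree_subst: "t' \<in> supp (tree_subst f t) \<Longrightarrow> shape t' = shape t \<and>
  ((\<forall>a\<in>G. supp (f a) \<subseteq> H) \<longrightarrow> set_tree t \<subseteq> G \<longrightarrow> set_tree t' \<subseteq> H)"
proof (induction t arbitrary: t')
  case (Node l a r)
  from Node.prems obtain l' b r' where "l' \<in> supp (tree_subst f l)" "b \<in> supp (f a)"
    "r' \<in> supp (tree_subst f r)" "t' = \<langle>l', b, r'\<rangle>"
    by (auto elim!: in_supp_lext)
  then show ?case using Node.IH by fastforce
qed simp

lemma shape_supp_tree_subst: "t' \<in> supp (tree_subst f t) \<Longrightarrow> shape t' = shape t"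
  by (simp add: supp_tree_subst)

lemma size1_supp_tree_subst: "t' \<in> supp (tree_subst f t) \<Longrightarrow> size1 t' = size1 t"
  by (metis shape_size1 shape_supp_tree_subst)

lemma coef_tree_subst_shape: "shape t' \<noteq> shape t \<Longrightarrow> coef (tree_subst f t) t' = 0"
  using shape_supp_tree_subst[of t' f t] by (auto simp: in_keys_iff)

lemma lin_subst_in_free_operad:
  assumes "x \<in> free_operad G n" "\<forall>a\<in>G. supp (f a) \<subseteq> H"
  shows "lin_subst f x \<in> free_operad H n"
proof (intro lext_in_subspace subspace_free_operad)
  fix t assume "t \<in> supp x"
  then have "set_tree t \<subseteq> G" "size1 t = n" using assms(1) by (auto simp: free_operad_iff)
  then show "tree_subst f t \<in> free_operad H n"
    using assms(2) supp_tree_subst[of _ f t G H] by (simp add: free_operad_iff size1_supp_tree_subst)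
qed

lemma tree_subst_graft:
  "1 \<le> i \<Longrightarrow> i \<le> size1 t \<Longrightarrow> tree_subst f (graft t i s) = operad_comp (tree_subst f t) i (tree_subst f s)"
proof (induction t arbitrary: i)
  case Leaf
  then show ?case by (simp add: operad_comp_eq)
next
  case (Node l a r)
  show ?case
  proof (cases "i \<le> size1 l")
    case True
    have "tree_subst f (graft \<langle>l, a, r\<rangle> i s) = lext (\<lambda>l'. lext (\<lambda>s'. lext (\<lambda>b.
        push (\<lambda>r'. \<langle>graft l' i s', b, r'\<rangle>) (tree_subst f r)) (f a)) (tree_subst f s)) (tree_subst f l)"
      using True Node.prems
      by (simp add: Node.IH operad_comp_eq lext_lext)
    also have "\<dots> = lext (\<lambda>l'. lext (\<lambda>b. lext (\<lambda>r'.
        lext (\<lambda>s'. bas \<langle>graft l' i s', b, r'\<rangle>) (tree_subst f s)) (tree_subst f r)) (f a)) (tree_subst f l)"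
      by (simp add: lext_swap[of _ _ "tree_subst f s"])
    \<comment> \<open>Substitution preserves sizes, so the test whether leaf \<open>i\<close> lies
      on the left has the same outcome for every \<open>l'\<close> in the support.\<close>
    also have "\<dots> = operad_comp (tree_subst f \<langle>l, a, r\<rangle>) i (tree_subst f s)"
      using True by (simp add: operad_comp_eq lext_lext size1_supp_tree_subst
          cong: lext_cong)
    finally show ?thesis .
  next
    case False
    have "tree_subst f (graft \<langle>l, a, r\<rangle> i s) = lext (\<lambda>l'. lext (\<lambda>b. lext (\<lambda>r'.
        lext (\<lambda>s'. bas \<langle>l', b, graft r' (i - size1 l) s'\<rangle>) (tree_subst f s)) (tree_subst f r)) (f a)) (tree_subst f l)"
      using False Node.prems
      by (simp add: Node.IH operad_comp_eq lext_lext)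
    also have "\<dots> = operad_comp (tree_subst f \<langle>l, a, r\<rangle>) i (tree_subst f s)"
      using False by (simp add: operad_comp_eq lext_lext size1_supp_tree_subst
          cong: lext_cong)
    finally show ?thesis .
  qed
qed

lemma lin_subst_operad_comp:
  assumes "x \<in> free_operad G n" "1 \<le> i" "i \<le> n"
  shows "lin_subst f (operad_comp x i y) = operad_comp (lin_subst f x) i (lin_subst f y)"
proof -
  have "lin_subst f (operad_comp x i y) = lext (\<lambda>t. lext (\<lambda>s. operad_comp (tree_subst f t) i (tree_subst f s)) y) x"
    using assms by (simp add: operad_comp_eq[of x] lext_lext tree_subst_graft free_operad_iff
        cong: lext_cong)
  also have "\<dots> = operad_comp (lin_subst f x) i (lin_subst f y)"
    by (simp add: operad_comp_eq lext_lext lext_swap[of _ _ y])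
  finally show ?thesis .
qed

lemma lin_subst_operad_ideal:
  assumes R: "rels P \<subseteq> free_operad (gens P) 3"
    and f: "\<forall>a\<in>gens P. supp (f a) \<subseteq> gens P'"
    and r: "\<forall>x\<in>rels P. lin_subst f x \<in> pm.span (rels P')"
    and x: "x \<in> operad_ideal P n"
  shows "lin_subst f x \<in> operad_ideal P' n"
proof -
  have "(n, x) \<in> operad_ideal_graded P" using x by (simp add: operad_ideal_def)
  then show ?thesis
  proof induction
    case (rel x)
    then show ?case using r span_rels_subset_ideal by blast
  next
    case (comp_left m x y n i)
    \<comment> \<open>Compatibility with composition needs the arity of \<open>x\<close>, which
      membership in the inductive set does not record.\<close>
    then have "x \<in> free_operad (gens P) m"
      using operad_ideal_subset_free[OF R] by (auto simp: operad_ideal_def)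
    with comp_left lin_subst_in_free_operad[OF comp_left(2) f] show ?case
      by (auto simp: lin_subst_operad_comp intro!: operad_ideal_comp_left[simplified One_nat_def])
  next
    case (comp_right x m n y i)
    with lin_subst_in_free_operad[OF comp_right(1) f] show ?case
      by (auto simp: lin_subst_operad_comp intro!: operad_ideal_comp_right[simplified One_nat_def])
  qed (auto simp: lext_lin pm.subspace_0[OF subspace_operad_ideal]
      intro: pm.subspace_add pm.subspace_scale subspace_operad_ideal)
qed

lemma tree_subst_tree_subst:
  assumes "\<And>a. a \<in> set_tree t \<Longrightarrow> lext g (f a) = bas a"
  shows "lin_subst g (tree_subst f t) = bas t"
  using assms
proof (induction t)
  case (Node l a r)
  let ?G = "\<lambda>l'' b r'. lext (\<lambda>c. lext (\<lambda>r''. bas \<langle>l'', c, r''\<rangle>) (tree_subst g r')) (g b)"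
  have swap1: "lext (\<lambda>b. lext (\<lambda>r'. lext (\<lambda>l''. ?G l'' b r') (tree_subst g l')) (tree_subst f r)) (f a)
      = lext (\<lambda>l''. lext (\<lambda>b. lext (?G l'' b) (tree_subst f r)) (f a)) (tree_subst g l')" for l'
    by (simp add: lext_swap[of _ "tree_subst g l'"])
  have swap2: "lext (?G l'' b) (tree_subst f r) = lext (\<lambda>c. lext (\<lambda>r'.
      lext (\<lambda>r''. bas \<langle>l'', c, r''\<rangle>) (tree_subst g r')) (tree_subst f r)) (g b)" for l'' b
    by (rule lext_swap)
  have "lin_subst g (tree_subst f \<langle>l, a, r\<rangle>) = lext (\<lambda>l'. lext (\<lambda>b. lext (\<lambda>r'.
      lext (\<lambda>l''. ?G l'' b r') (tree_subst g l')) (tree_subst f r)) (f a)) (tree_subst f l)"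
    by (simp add: lext_lext)
  also have "\<dots> = lext (\<lambda>l''. lext (\<lambda>c. lext (\<lambda>r''. bas \<langle>l'', c, r''\<rangle>)
        (lin_subst g (tree_subst f r))) (lext g (f a))) (lin_subst g (tree_subst f l))"
    unfolding swap1 swap2 by (simp add: lext_lext)
  also have "\<dots> = bas \<langle>l, a, r\<rangle>" using Node by simp
  finally show ?case .
qed simp

lemma lin_subst_lin_subst:
  assumes "x \<in> free_operad G n" "\<And>a. a \<in> G \<Longrightarrow> lext g (f a) = bas a"
  shows "lin_subst g (lin_subst f x) = x"
proof -
  have "lext (\<lambda>t. lin_subst g (tree_subst f t)) x = lext bas x"
    using assms by (intro lext_cong refl tree_subst_tree_subst) (auto simp: free_operad_iff)
  then show ?thesis by (simp add: lext_lext)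
qed

section \<open>Trees of a given shape and the coefficients of substituted trees\<close>

lemma map_tree_graft: "map_tree h (graft t i s) = graft (map_tree h t) i (map_tree h s)"
  by (induction t arbitrary: i) auto

text \<open>With the uniqueness in \<open>graft_inj\<close>, this parametrizes the trees that
  contribute to a coefficient at a grafted tree.\<close>

lemma shape_graft_iff:
  assumes "1 \<le> i" "i \<le> size1 U"
  shows "shape T = shape (graft U i V) \<longleftrightarrow>
    (\<exists>U' V'. T = graft U' i V' \<and> shape U' = shape U \<and> shape V' = shape V)"
proof
  show "\<exists>U' V'. T = graft U' i V' \<and> shape U' = shape U \<and> shape V' = shape V"
    if "shape T = shape (graft U i V)"
    using that assms
  proof (induction U arbitrary: i T)
    case Leaf
    then show ?case by (intro exI[of _ "Leaf"] exI[of _ T]) simp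
  next
    case (Node l a r)
    obtain L b R where T: "T = \<langle>L, b, R\<rangle>" using Node.prems(1) by (cases T) (auto split: if_splits)
    show ?case
    proof (cases "i \<le> size1 l")
      case True
      then obtain L' V' where "L = graft L' i V'" "shape L' = shape l" "shape V' = shape V"
        using Node.IH(1)[of L i] Node.prems T by auto
      moreover from this have "size1 L' = size1 l" by (metis shape_size1)
      ultimately show ?thesis using T True Node.prems
        by (intro exI[of _ "\<langle>L', b, R\<rangle>"] exI[of _ V']) simp
    next
      case False
      then have "Suc 0 \<le> i - size1 l" "i - size1 l \<le> size1 r" using Node.prems by auto
      then obtain R' V' where "R = graft R' (i - size1 l) V'" "shape R' = shape r" "shape V' = shape V"
        using Node.IH(2)[of R "i - size1 l"] Node.prems T False by auto
      moreover have "size1 L = size1 l" using T False Node.prems(1) by (auto intro: shape_size1)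
      ultimately show ?thesis using T False Node.prems
        by (intro exI[of _ "\<langle>L, b, R'\<rangle>"] exI[of _ V']) simp
    qed
  qed
qed (auto simp: map_tree_graft)

lemma graft_inj:
  assumes "graft U i V = graft U' i V'" "shape U = shape U'" "1 \<le> i" "i \<le> size1 U"
  shows "U = U' \<and> V = V'"
  using assms
proof (induction U arbitrary: i U')
  case Leaf
  then show ?case using shape_Leaf_iff[of U'] by simp
next
  case (Node l a r)
  obtain l' a' r' where U': "U' = \<langle>l', a', r'\<rangle>" using Node.prems(2) by (cases U') auto
  moreover from this have "size1 l = size1 l'" using Node.prems(2) by (auto intro: shape_size1)
  ultimately show ?case using Node.IH(1)[of i l'] Node.IH(2)[of "i - size1 l" r'] Node.prems
    by (auto split: if_splits)
qed

lemma coef_tree_subst_graft: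
  assumes "shape U' = shape U" "1 \<le> i" "i \<le> size1 U"
  shows "coef (tree_subst f (graft U' i V')) (graft U i V) = coef (tree_subst f U') U * coef (tree_subst f V') V"
  using assms
proof (induction U arbitrary: i U')
  case Leaf
  then show ?case using shape_Leaf_iff[of U'] by simp
next
  case (Node l a r)
  obtain l' a' r' where U': "U' = \<langle>l', a', r'\<rangle>" using Node.prems(1) by (cases U') auto
  moreover from this have "size1 l' = size1 l" using Node.prems(1) by (auto intro: shape_size1)
  ultimately show ?case using Node.IH(1)[of l' i] Node.IH(2)[of r' "i - size1 l"] Node.prems
    by (auto simp del: tree_subst.simps)
qed

lemma shape_comb:
  "shape t = lcomb () () \<Longrightarrow> \<exists>a b. t = lcomb a b"
  "shape t = rcomb () () \<Longrightarrow> \<exists>a b. t = rcomb a b"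
  by (auto simp: shape_Node_iff shape_Leaf_iff)

lemma shape_graft_all_iff:
  assumes "size1 t = 3"
  shows "shape V = shape (graft_all t [x, y, z]) \<longleftrightarrow> (\<exists>t' x' y' z'. V = graft_all t' [x', y', z'] \<and>
    shape t' = shape t \<and> shape x' = shape x \<and> shape y' = shape y \<and> shape z' = shape z)"
  using assms unfolding size1_eq_3
proof (elim disjE exE)
  fix a b assume t: "t = lcomb a b"
  show ?thesis
  proof
    assume "shape V = shape (graft_all t [x, y, z])"
    then obtain x' b' y' a' z' where "V = \<langle>\<langle>x', b', y'\<rangle>, a', z'\<rangle>"
      "shape x' = shape x" "shape y' = shape y" "shape z' = shape z"
      unfolding t by (auto simp: shape_Node_iff)
    then show "\<exists>t' x' y' z'. V = graft_all t' [x', y', z'] \<and>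
        shape t' = shape t \<and> shape x' = shape x \<and> shape y' = shape y \<and> shape z' = shape z"
      unfolding t by (intro exI[of _ "lcomb a' b'"] exI[of _ x'] exI[of _ y'] exI[of _ z']) simp
  qed (auto simp: t dest!: shape_comb)
next
  fix a b assume t: "t = rcomb a b"
  show ?thesis
  proof
    assume "shape V = shape (graft_all t [x, y, z])"
    then obtain x' b' y' a' z' where "V = \<langle>x', a', \<langle>y', b', z'\<rangle>\<rangle>"
      "shape x' = shape x" "shape y' = shape y" "shape z' = shape z"
      unfolding t by (auto simp: shape_Node_iff)
    then show "\<exists>t' x' y' z'. V = graft_all t' [x', y', z'] \<and>
        shape t' = shape t \<and> shape x' = shape x \<and> shape y' = shape y \<and> shape z' = shape z"
      unfolding t by (intro exI[of _ "rcomb a' b'"] exI[of _ x'] exI[of _ y'] exI[of _ z']) simp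
  qed (auto simp: t dest!: shape_comb)
qed

lemma graft_all_inj:
  assumes "size1 t = 3" "shape t' = shape t"
    "graft_all t [x, y, z] = graft_all t' [x', y', z']"
  shows "t = t' \<and> x = x' \<and> y = y' \<and> z = z'"
  using assms unfolding size1_eq_3 by (auto dest!: shape_comb)

lemma coef_tree_subst_graft_all:
  assumes "size1 t = 3" "shape t' = shape t"
  shows "coef (tree_subst f (graft_all t' [x', y', z'])) (graft_all t [x, y, z]) =
    coef (tree_subst f t') t * (coef (tree_subst f x') x * coef (tree_subst f y') y * coef (tree_subst f z') z)"
  using assms unfolding size1_eq_3 by (auto dest!: shape_comb simp del: tree_subst.simps simp: tree_subst.simps(1))

lemma set_tree_graft_all:
  "size1 t = 3 \<Longrightarrow> set_tree (graft_all t [x, y, z]) = set_tree t \<union> set_tree x \<union> set_tree y \<union> set_tree z"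
  unfolding size1_eq_3 by auto

lemma suspension_sign_shape: "shape s = shape t \<Longrightarrow> suspension_sign s = suspension_sign t"
  by (cases s; cases t) (auto simp: suspension_sign_def shape_Leaf_iff)

lemma suspension_sign_sq: "suspension_sign t * (suspension_sign t * x) = (x::'k::field)"
  by (simp add: suspension_sign_def)

lemma finite_shape: "finite G \<Longrightarrow> finite {t'. shape t' = shape t \<and> set_tree t' \<subseteq> G}"
  by (rule finite_subset[OF _ finite_bounded_trees[of G "size1 t"]]) (auto dest: shape_size1)

text \<open>The coefficient of the image at a tree is a sum over the trees of the same shape,
  weighted by a product over the nodes. Cutting this product at the distinguished pair of nodes
  writes the local component of the image at \<open>U\<close>, \<open>ts\<close> as a weighted sum
  of images of local components of \<open>x\<close>, which are combinations of relators.\<close>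

theorem lin_subst_koszul_dual_cooperad:
  fixes P P' :: "('a, 'k::field) presentation"
  assumes fin: "finite (gens P)"
    and R: "rels P \<subseteq> free_operad (gens P) 3"
    and f: "\<forall>a\<in>gens P. supp (f a) \<subseteq> gens P'"
    and r: "\<forall>x\<in>rels P. lin_subst f x \<in> pm.span (rels P')"
    and x: "x \<in> koszul_dual_cooperad P n"
  shows "lin_subst f x \<in> koszul_dual_cooperad P' n"
proof -
  let ?G = "gens P"
  have xf: "x \<in> free_operad ?G n" using x by (simp add: koszul_dual_cooperad_def)
  have spanR: "pm.span (rels P) \<subseteq> free_operad ?G 3"
    using R by (intro pm.span_minimal subspace_free_operad)
  have "\<exists>r'\<in>pm.span (rels P'). \<forall>t. size1 t = 3 \<longrightarrow>
      coef (lin_subst f x) (graft U i (graft_all t ts)) = suspension_sign t * coef r' t"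
    if i: "1 \<le> i" "i \<le> size1 U" and "length ts = 3" for U i and ts :: "'a tree list"
  proof -
    obtain u v w where ts: "ts = [u, v, w]" using \<open>length ts = 3\<close> by (auto simp: length_3_conv)
    define C where "C t = {t'. shape t' = shape t \<and> set_tree t' \<subseteq> ?G}" for t :: "'a tree"
    have finC: "finite (C t)" for t unfolding C_def using fin by (rule finite_shape)
    \<comment> \<open>The surroundings of the pair of nodes in a contributing tree: a context and
      three grafted trees. Finiteness of the generators makes this a finite set.\<close>
    define X where "X = C U \<times> C u \<times> C v \<times> C w"
    have "\<forall>p\<in>X. \<exists>r. r \<in> pm.span (rels P) \<and> (\<forall>t. size1 t = 3 \<longrightarrow>
        coef x (graft (fst p) i (graft_all t [fst (snd p), fst (snd (snd p)), snd (snd (snd p))])) =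
          suspension_sign t * coef r t)"
    proof
      fix p assume "p \<in> X"
      then have "i \<le> size1 (fst p)" using i shape_size1[of "fst p" U] by (auto simp: X_def C_def)
      then show "\<exists>r. r \<in> pm.span (rels P) \<and> (\<forall>t. size1 t = 3 \<longrightarrow>
        coef x (graft (fst p) i (graft_all t [fst (snd p), fst (snd (snd p)), snd (snd (snd p))])) =
          suspension_sign t * coef r t)"
        using conjunct2[OF x[unfolded koszul_dual_cooperad_def mem_Collect_eq], rule_format, of i "fst p"
          "[fst (snd p), fst (snd (snd p)), snd (snd (snd p))]"] i
        by (auto simp del: graft_all.simps)
    qed
    then obtain r where r0: "\<forall>p\<in>X. r p \<in> pm.span (rels P) \<and> (\<forall>t. size1 t = 3 \<longrightarrow>
        coef x (graft (fst p) i (graft_all t [fst (snd p), fst (snd (snd p)), snd (snd (snd p))])) =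
          suspension_sign t * coef (r p) t)"
      by (elim bchoice[THEN exE])
    have rs: "r p \<in> pm.span (rels P)" if "p \<in> X" for p using r0[THEN bspec, OF that] by (rule conjunct1)
    have rx: "coef x (graft (fst p) i (graft_all t [fst (snd p), fst (snd (snd p)), snd (snd (snd p))])) =
        suspension_sign t * coef (r p) t" if "p \<in> X" "size1 t = 3" for p t
      using r0[THEN bspec, OF that(1), THEN conjunct2, rule_format, OF that(2)] .
    \<comment> \<open>The share of the coefficient due to the nodes outside the distinguished
      pair.\<close>
    define W where "W p = coef (tree_subst f (fst p)) U * (coef (tree_subst f (fst (snd p))) u *
       coef (tree_subst f (fst (snd (snd p)))) v * coef (tree_subst f (snd (snd (snd p)))) w)" for p
    define r' where "r' = (\<Sum>p\<in>X. scale (W p) (lin_subst f (r p)))"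
    have "r' \<in> pm.span (rels P')"
      unfolding r'_def
    proof (intro pm.span_sum pm.span_scale)
      fix p assume "p \<in> X"
      then show "lin_subst f (r p) \<in> pm.span (rels P')"
        by (intro lext_maps_span[OF rs] bspec[OF r])
    qed
    moreover have "coef (lin_subst f x) (graft U i (graft_all t ts)) = suspension_sign t * coef r' t"
      if t: "size1 t = 3" for t
    proof -
      let ?T = "graft U i (graft_all t ts)"
      let ?g = "\<lambda>(p, t'). graft (fst p) i (graft_all t' [fst (snd p), fst (snd (snd p)), snd (snd (snd p))])"
      \<comment> \<open>\<open>inj\<close> and \<open>img\<close> together: each tree of the shape
        of \<open>?T\<close> comes from exactly one surrounding in \<open>X\<close> and one two-node
        tree in \<open>C t\<close>.\<close>
      have inj: "inj_on ?g (X \<times> C t)"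
      proof (rule inj_onI)
        fix p q assume pq: "p \<in> X \<times> C t" "q \<in> X \<times> C t" "?g p = ?g q"
        obtain U1 u1 v1 w1 t1 where p: "p = ((U1, u1, v1, w1), t1)" by (metis surj_pair)
        obtain U2 u2 v2 w2 t2 where q: "q = ((U2, u2, v2, w2), t2)" by (metis surj_pair)
        have sh: "shape U1 = shape U" "shape U2 = shape U" "shape t1 = shape t" "shape t2 = shape t"
          using pq by (auto simp: p q X_def C_def)
        have "size1 U1 = size1 U" "size1 t1 = 3" using sh t by (metis shape_size1)+
        then show "p = q"
          using pq(3) sh i graft_inj[of U1 i "graft_all t1 [u1, v1, w1]" U2 "graft_all t2 [u2, v2, w2]"]
            graft_all_inj[of t1 t2 u1 v1 w1 u2 v2 w2] by (simp add: p q)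
      qed
      have img: "?g ` (X \<times> C t) = C ?T"
      proof safe
        fix U1 u1 v1 w1 t1 assume "(U1, u1, v1, w1) \<in> X" "t1 \<in> C t"
        then have h: "U1 \<in> C U" "u1 \<in> C u" "v1 \<in> C v" "w1 \<in> C w" "t1 \<in> C t" by (auto simp: X_def)
        then have "size1 U1 = size1 U" "size1 t1 = 3" using t by (auto simp: C_def dest: shape_size1)
        moreover have "shape (graft_all t1 [u1, v1, w1]) = shape (graft_all t [u, v, w])"
          using h t by (subst shape_graft_all_iff) (auto simp: C_def)
        ultimately show "graft (fst (U1, u1, v1, w1)) i (graft_all t1 [fst (snd (U1, u1, v1, w1)),
            fst (snd (snd (U1, u1, v1, w1))), snd (snd (snd (U1, u1, v1, w1)))]) \<in> C ?T"
          using h i by (auto simp: C_def ts set_tree_graft set_tree_graft_all map_tree_graft simp del: graft_all.simps)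
      next
        fix T assume "T \<in> C ?T"
        then obtain U1 V1 where 1: "T = graft U1 i V1" "shape U1 = shape U"
          "shape V1 = shape (graft_all t [u, v, w])" "set_tree T \<subseteq> ?G"
          unfolding C_def ts mem_Collect_eq shape_graft_iff[OF i] by blast
        then obtain t1 u1 v1 w1 where 2: "V1 = graft_all t1 [u1, v1, w1]" "shape t1 = shape t"
          "shape u1 = shape u" "shape v1 = shape v" "shape w1 = shape w"
          unfolding shape_graft_all_iff[OF t] by blast
        have s: "size1 U1 = size1 U" "size1 t1 = 3" using 1 2 t by (metis shape_size1)+
        then have "set_tree T = set_tree U1 \<union> (set_tree t1 \<union> set_tree u1 \<union> set_tree v1 \<union> set_tree w1)"
          using i by (simp add: 1 2 set_tree_graft set_tree_graft_all del: graft_all.simps)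
        then have "((U1, u1, v1, w1), t1) \<in> X \<times> C t"
          using 1 2 by (auto simp: X_def C_def)
        then show "T \<in> ?g ` (X \<times> C t)"
          by (rule rev_image_eqI) (simp add: 1 2)
      qed
      have "coef (lin_subst f x) ?T = (\<Sum>T\<in>supp x \<union> C ?T. coef x T * coef (tree_subst f T) ?T)"
        using finC by (intro coef_lext_superset) auto
      also have "\<dots> = (\<Sum>T\<in>C ?T. coef x T * coef (tree_subst f T) ?T)"
      proof (rule sum.mono_neutral_right)
        show "\<forall>T\<in>supp x \<union> C ?T - C ?T. coef x T * coef (tree_subst f T) ?T = 0"
        proof
          fix T assume "T \<in> supp x \<union> C ?T - C ?T"
          then have "shape T \<noteq> shape ?T" using xf by (auto simp: free_operad_iff C_def)
          then show "coef x T * coef (tree_subst f T) ?T = 0"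
            using coef_tree_subst_shape[of ?T T f] by simp
        qed
      qed (use finC in auto)
      also have "\<dots> = (\<Sum>p\<in>X \<times> C t. coef x (?g p) * coef (tree_subst f (?g p)) ?T)"
        unfolding img[symmetric] by (simp add: sum.reindex[OF inj] del: graft_all.simps)
      also have "\<dots> = (\<Sum>p\<in>X. \<Sum>t'\<in>C t. coef x (?g (p, t')) * coef (tree_subst f (?g (p, t'))) ?T)"
        by (simp add: sum.cartesian_product split_def del: graft_all.simps)
      also have "\<dots> = (\<Sum>p\<in>X. \<Sum>t'\<in>C t. suspension_sign t * (W p * (coef (r p) t' * coef (tree_subst f t') t)))"
      proof (intro sum.cong refl)
        fix p t' assume p: "p \<in> X" and t': "t' \<in> C t"
        then have t'3: "size1 t' = 3" "shape t' = shape t" using t by (auto simp: C_def dest: shape_size1)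
        \<comment> \<open>The suspension sign depends only on the shape, hence is a common factor of
          the sum.\<close>
        have sgn: "(suspension_sign t' :: 'k) = suspension_sign t"
          using t'3(2) by (rule suspension_sign_shape)
        have U: "shape (fst p) = shape U" using p by (auto simp: X_def C_def)
        show "coef x (?g (p, t')) * coef (tree_subst f (?g (p, t'))) ?T =
            suspension_sign t * (W p * (coef (r p) t' * coef (tree_subst f t') t))"
          using rx[OF p t'3(1)] sgn
          by (simp add: ts coef_tree_subst_graft[OF U i] coef_tree_subst_graft_all[OF t t'3(2)] W_def
              del: graft_all.simps)
      qed
      also have "\<dots> = suspension_sign t * (\<Sum>p\<in>X. W p * (\<Sum>t'\<in>C t. coef (r p) t' * coef (tree_subst f t') t))"
        by (simp add: sum_distrib_left)
      also have "(\<Sum>p\<in>X. W p * (\<Sum>t'\<in>C t. coef (r p) t' * coef (tree_subst f t') t)) = coef r' t"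
        unfolding r'_def lookup_sum lookup_scale
      proof (intro sum.cong refl arg_cong2[where f = "(*)"])
        fix p assume "p \<in> X"
        then have rf: "r p \<in> free_operad ?G 3" by (rule subsetD[OF spanR rs])
        have "coef (lin_subst f (r p)) t = (\<Sum>t'\<in>supp (r p) \<union> C t. coef (r p) t' * coef (tree_subst f t') t)"
          using finC by (intro coef_lext_superset) auto
        also have "\<dots> = (\<Sum>t'\<in>C t. coef (r p) t' * coef (tree_subst f t') t)"
        proof (rule sum.mono_neutral_right)
          show "\<forall>t'\<in>supp (r p) \<union> C t - C t. coef (r p) t' * coef (tree_subst f t') t = 0"
          proof
            fix t' assume "t' \<in> supp (r p) \<union> C t - C t"
            then have "shape t' \<noteq> shape t" using rf by (auto simp: free_operad_iff C_def)
            then show "coef (r p) t' * coef (tree_subst f t') t = 0"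
              using coef_tree_subst_shape[of t t' f] by simp
          qed
        qed (use finC in auto)
        finally show "(\<Sum>t'\<in>C t. coef (r p) t' * coef (tree_subst f t') t) = coef (lin_subst f (r p)) t" by simp
      qed
      finally show ?thesis .
    qed
    ultimately show ?thesis by blast
  qed
  then show ?thesis
    using lin_subst_in_free_operad[OF xf f] by (auto simp: koszul_dual_cooperad_def)
qed

section \<open>Cut trees\<close>

text \<open>A chain \<open>(t, ss)\<close> of the Koszul complex is recorded as the tree \<open>t\<close> with the trees \<open>ss\<close>
  attached to its leaves.\<close>

datatype 'a ctree = L "'a tree" | N "'a ctree" 'a "'a ctree"

fun bottom :: "'a ctree \<Rightarrow> 'a tree" where
  "bottom (L s) = Leaf"
| "bottom (N l a r) = \<langle>bottom l, a, bottom r\<rangle>"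

fun tops :: "'a ctree \<Rightarrow> 'a tree list" where
  "tops (L s) = [s]"
| "tops (N l a r) = tops l @ tops r"

definition cpair :: "'a ctree \<Rightarrow> 'a tree \<times> 'a tree list" where
  "cpair c = (bottom c, tops c)"

fun build :: "'a tree \<Rightarrow> 'a tree list \<Rightarrow> 'a ctree" where
  "build Leaf ss = L (hd ss)"
| "build \<langle>l, a, r\<rangle> ss = N (build l (take (size1 l) ss)) a (build r (drop (size1 l) ss))"

abbreviation csize :: "'a ctree \<Rightarrow> nat" where "csize c \<equiv> size1 (bottom c)"

lemma length_tops [simp]: "length (tops c) = csize c"
  by (induction c) auto

lemma build_cpair [simp]: "build (bottom c) (tops c) = c"
  by (induction c) auto

lemma cpair_build: "length ss = size1 t \<Longrightarrow> cpair (build t ss) = (t, ss)"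
proof (induction t arbitrary: ss)
  case Leaf
  then show ?case by (cases ss) (auto simp: cpair_def)
next
  case (Node l a r)
  then show ?case
    using Node.IH(1)[of "take (size1 l) ss"] Node.IH(2)[of "drop (size1 l) ss"]
    by (auto simp: cpair_def)
qed

text \<open>Leaves are numbered from 1 and lists from 0: the entries \<open>i - 1\<close> and
  \<open>i\<close> sit over the leaves \<open>i\<close> and \<open>i + 1\<close>.\<close>

definition merge :: "nat \<Rightarrow> 'a \<Rightarrow> 'a tree list \<Rightarrow> 'a tree list" where
  "merge i g ss = take (i - 1) ss @ [\<langle>ss ! (i - 1), g, ss ! i\<rangle>] @ drop (i + 1) ss"

lemma merge_append_left: "1 \<le> i \<Longrightarrow> i < length us \<Longrightarrow> merge i g (us @ vs) = merge i g us @ vs"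
  by (cases i) (simp_all add: merge_def nth_append)

lemma merge_append_right:
  "1 \<le> i \<Longrightarrow> merge (i + length us) g (us @ vs) = us @ merge i g vs"
  by (cases i) (simp_all add: merge_def nth_append Suc_diff_le)

section \<open>The Koszul differential as a recursion on cut trees\<close>

definition contraction_sum ::
    "('a tree \<times> nat \<times> 'a) set \<Rightarrow> 'a tree list \<Rightarrow> ('a tree \<times> 'a tree list \<Rightarrow>\<^sub>0 'k::field)" where
  "contraction_sum W ss = (\<Sum>(t', i, g)\<in>W. Poly_Mapping.single (t', merge i g ss) ((- 1) ^ (i + 1)))"

lemma koszul_differential_bas:
  "koszul_differential (bas (t, ss)) = contraction_sum (top_decompositions t) ss"
  by (simp add: koszul_differential_def contraction_sum_def merge_def)

text \<open>\<open>J\<close> is the part that contracts the root. Leaf \<open>i\<close> of the right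
  subtree is leaf \<open>i + csize l\<close> of the whole tree, whence the factor
  \<open>(- 1) ^ csize l\<close>. The recursion is used with \<open>cherry\<close> for trees,
  \<open>comb_merge\<close> for rotation classes, and \<open>nf_merge\<close> for rotation classes
  with normalized tops.\<close>

fun dif :: "('a ctree \<Rightarrow> 'a \<Rightarrow> 'a ctree \<Rightarrow> ('a ctree \<Rightarrow>\<^sub>0 'k::field)) \<Rightarrow> 'a ctree \<Rightarrow> ('a ctree \<Rightarrow>\<^sub>0 'k)" where
  "dif J (L s) = 0"
| "dif J (N l a r) = push (\<lambda>x. N x a r) (dif J l)
     + scale ((- 1) ^ csize l) (push (\<lambda>x. N l a x) (dif J r)) + J l a r"

text \<open>\<open>W\<close> stands for \<open>top_decompositions\<close> or
  \<open>rnf_decompositions\<close>, and \<open>W0\<close> for the decompositions at the root. The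
  leaf index separates the three families: it is below \<open>size1 l\<close> on the left, equal to
  it at the root and above it on the right, so the sum over the union splits. \<open>P\<close> is
  the class of trees on which the recursion for \<open>W\<close> holds.\<close>

lemma push_cpair_dif:
  fixes J :: "'a ctree \<Rightarrow> 'a \<Rightarrow> 'a ctree \<Rightarrow> ('a ctree \<Rightarrow>\<^sub>0 'k::field)"
  assumes W: "\<And>l a r. P \<langle>l, a, r\<rangle> \<Longrightarrow> W \<langle>l, a, r\<rangle> = (\<lambda>(t, i, g). (\<langle>t, a, r\<rangle>, i, g)) ` W l
      \<union> (\<lambda>(t, i, g). (\<langle>l, a, t\<rangle>, i + size1 l, g)) ` W r \<union> W0 l a r" "W Leaf = {}"
    and W0: "\<And>l a r x. x \<in> W0 l a r \<Longrightarrow> fst (snd x) = size1 l"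
    and fin: "\<And>t. finite (W t)"
    and i: "\<And>t x. x \<in> W t \<Longrightarrow> 1 \<le> fst (snd x) \<and> fst (snd x) < size1 t"
    and P: "\<And>l a r. P \<langle>l, a, r\<rangle> \<Longrightarrow> P l \<and> P r"
    and J: "\<And>l a r. P \<langle>bottom l, a, bottom r\<rangle> \<Longrightarrow>
      push cpair (J l a r) = contraction_sum (W0 (bottom l) a (bottom r)) (tops l @ tops r)"
    and c: "P (bottom c)"
  shows "push cpair (dif J c) = contraction_sum (W (bottom c)) (tops c)"
  using c
proof (induction c)
  case (L s)
  then show ?case by (simp add: W(2) contraction_sum_def)
next
  case (N l a r)
  let ?l = "bottom l" and ?r = "bottom r"
  let ?A = "(\<lambda>(t, i, g). (\<langle>t, a, ?r\<rangle>, i, g)) ` W ?l"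
  let ?B = "(\<lambda>(t, i, g). (\<langle>?l, a, t\<rangle>, i + size1 ?l, g)) ` W ?r"
  let ?ss = "tops l @ tops r"
  let ?cs = "contraction_sum :: _ \<Rightarrow> _ \<Rightarrow> (_ \<Rightarrow>\<^sub>0 'k)"
  have PP: "P ?l" "P ?r" "P \<langle>?l, a, ?r\<rangle>" using P[of ?l a ?r] N.prems by auto
  have 1: "?cs ?A ?ss = push (\<lambda>(t, us). (\<langle>t, a, ?r\<rangle>, us @ tops r)) (contraction_sum (W ?l) (tops l))"
    (is "_ = push ?f _")
  proof -
    have "?cs ?A ?ss = (\<Sum>(t, i, g)\<in>W ?l. Poly_Mapping.single (\<langle>t, a, ?r\<rangle>, merge i g ?ss) ((- 1) ^ (i + 1)))"
      unfolding contraction_sum_def by (subst sum.reindex) (auto simp: inj_on_def intro!: sum.cong)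
    also have "\<dots> = (\<Sum>x\<in>W ?l. push ?f ((\<lambda>(t, i, g). Poly_Mapping.single (t, merge i g (tops l)) ((- 1) ^ (i + 1))) x))"
    proof (intro sum.cong refl, clarify)
      fix t j g assume "(t, j, g) \<in> W ?l"
      then have "1 \<le> j" "j < length (tops l)" using i[of "(t, j, g)" ?l] by auto
      then show "Poly_Mapping.single (\<langle>t, a, ?r\<rangle>, merge j g ?ss) ((- 1) ^ (j + 1))
          = push ?f (Poly_Mapping.single (t, merge j g (tops l)) ((- 1) ^ (j + 1)))"
        by (simp add: merge_append_left lext_single finsupp_eqI lookup_single when_def)
    qed
    also have "\<dots> = push ?f (contraction_sum (W ?l) (tops l))"
      unfolding contraction_sum_def lext_sum ..
    finally show ?thesis .
  qed
  have 2: "?cs ?B ?ss = scale ((- 1) ^ csize l)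
      (push (\<lambda>(t, us). (\<langle>?l, a, t\<rangle>, tops l @ us)) (contraction_sum (W ?r) (tops r)))"
    (is "_ = scale _ (push ?f _)")
  proof -
    have "?cs ?B ?ss = (\<Sum>(t, i, g)\<in>W ?r.
        Poly_Mapping.single (\<langle>?l, a, t\<rangle>, merge (i + size1 ?l) g ?ss) ((- 1) ^ (i + size1 ?l + 1)))"
      unfolding contraction_sum_def by (subst sum.reindex) (auto simp: inj_on_def intro!: sum.cong)
    also have "\<dots> = (\<Sum>x\<in>W ?r. scale ((- 1) ^ csize l)
        (push ?f ((\<lambda>(t, i, g). Poly_Mapping.single (t, merge i g (tops r)) ((- 1) ^ (i + 1))) x)))"
    proof (intro sum.cong refl, clarify)
      fix t j g assume "(t, j, g) \<in> W ?r"
      then have "1 \<le> j" using i[of "(t, j, g)" ?r] by auto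
      then show "Poly_Mapping.single (\<langle>?l, a, t\<rangle>, merge (j + size1 ?l) g ?ss) ((- 1) ^ (j + size1 ?l + 1))
          = scale ((- 1) ^ csize l) (push ?f (Poly_Mapping.single (t, merge j g (tops r)) ((- 1) ^ (j + 1))))"
        using merge_append_right[of j "tops l" g "tops r"]
        by (auto simp: lext_single lookup_single when_def power_add mult.commute
            intro!: finsupp_eqI)
    qed
    also have "\<dots> = scale ((- 1) ^ csize l) (push ?f (contraction_sum (W ?r) (tops r)))"
      unfolding contraction_sum_def lext_sum pm.scale_sum_right ..
    finally show ?thesis .
  qed
  have sep: "x \<in> ?A \<Longrightarrow> fst (snd x) < size1 ?l" "x \<in> ?B \<Longrightarrow> fst (snd x) > size1 ?l" for x
    using i[of _ ?l] i[of _ ?r] by fastforce+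
  have fins: "finite ?A" "finite ?B" "finite (W0 ?l a ?r)"
    using fin fin[of "\<langle>?l, a, ?r\<rangle>"] by (auto simp: W(1)[OF PP(3)])
  have "?cs (W \<langle>?l, a, ?r\<rangle>) ?ss
      = ?cs ?A ?ss + ?cs ?B ?ss + contraction_sum (W0 ?l a ?r) ?ss"
  proof -
    have "?A \<inter> ?B = {}"
    proof (rule equals0I)
      fix x assume "x \<in> ?A \<inter> ?B"
      from sep(1)[OF IntD1[OF this]] sep(2)[OF IntD2[OF this]] show False by simp
    qed
    moreover have "(?A \<union> ?B) \<inter> W0 ?l a ?r = {}"
    proof (rule equals0I)
      fix x assume x: "x \<in> (?A \<union> ?B) \<inter> W0 ?l a ?r"
      from IntD1[OF x] have "fst (snd x) \<noteq> size1 ?l" 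
        by (elim UnE) (rule less_imp_neq[OF sep(1)], assumption, rule less_imp_neq[OF sep(2), symmetric])
      then show False using W0[OF IntD2[OF x]] by simp
    qed
    ultimately show ?thesis
      unfolding W(1)[OF PP(3)] contraction_sum_def using fins by (simp only: sum.union_disjoint finite_Un)
  qed
  note this[unfolded 1 2]
  moreover have "push cpair (push (\<lambda>x. N x a r) y) = push (\<lambda>(t, us). (\<langle>t, a, ?r\<rangle>, us @ tops r)) (push cpair y)"
    for y :: "'a ctree \<Rightarrow>\<^sub>0 'k"
    by (simp add: lext_lext cpair_def)
  moreover have "push cpair (push (\<lambda>x. N l a x) y) = push (\<lambda>(t, us). (\<langle>?l, a, t\<rangle>, tops l @ us)) (push cpair y)"
    for y :: "'a ctree \<Rightarrow>\<^sub>0 'k"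
    by (simp add: lext_lext cpair_def)
  ultimately show ?case
    using N.IH PP by (simp add: lext_lin J)
qed

lemma top_decompositions_Leaf: "top_decompositions Leaf = {}"
proof -
  have False if "1 \<le> i" "i \<le> size1 t'" "Leaf = graft t' i (corolla g)" for t' :: "'a tree" and i g
    using size1_graft[OF that(1,2), of "corolla g"] that by (simp add: corolla_def flip: that(3))
  then show ?thesis by (auto simp: top_decompositions_def)
qed

lemma top_decompositions_Node:
  "top_decompositions \<langle>l, a, r\<rangle> = (\<lambda>(t, i, g). (\<langle>t, a, r\<rangle>, i, g)) ` top_decompositions l
      \<union> (\<lambda>(t, i, g). (\<langle>l, a, t\<rangle>, i + size1 l, g)) ` top_decompositions r
      \<union> (if l = Leaf \<and> r = Leaf then {(Leaf, 1, a)} else {})" (is "?X = ?A \<union> ?B \<union> ?C")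
proof
  show "?X \<subseteq> ?A \<union> ?B \<union> ?C"
  proof
    fix x assume "x \<in> ?X"
    then obtain t' i g where x: "x = (t', i, g)" "1 \<le> i" "i \<le> size1 t'"
      and t: "\<langle>l, a, r\<rangle> = graft t' i (corolla g)"
      by (auto simp: top_decompositions_def)
    show "x \<in> ?A \<union> ?B \<union> ?C"
    proof (cases t')
      case Leaf
      then show ?thesis using x t by (auto simp: corolla_def)
    next
      case (Node l' b r')
      show ?thesis
      proof (cases "i \<le> size1 l'")
        case True
        then have "x = (\<lambda>(t, i, g). (\<langle>t, a, r\<rangle>, i, g)) (l', i, g)" "(l', i, g) \<in> top_decompositions l"
          using x t Node by (auto simp: top_decompositions_def)
        then show ?thesis by blast
      next
        case False
        then have "x = (\<lambda>(t, i, g). (\<langle>l, a, t\<rangle>, i + size1 l, g)) (r', i - size1 l, g)"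
          "(r', i - size1 l, g) \<in> top_decompositions r"
          using x t Node by (auto simp: top_decompositions_def)
        then show ?thesis by blast
      qed
    qed
  qed
  have "?B \<subseteq> ?X" by (auto simp: top_decompositions_def)
  moreover have "?A \<subseteq> ?X" by (auto simp: top_decompositions_def)
  moreover have "?C \<subseteq> ?X" by (auto simp: top_decompositions_def corolla_def)
  ultimately show "?A \<union> ?B \<union> ?C \<subseteq> ?X" by blast
qed

lemma top_decompositions_index:
  assumes "x \<in> top_decompositions t"
  shows "1 \<le> fst (snd x) \<and> fst (snd x) < size1 t"
  using assms size1_graft[of "fst (snd x)" "fst x" "corolla (snd (snd x))"]
  by (auto simp: top_decompositions_def corolla_def)

fun cherry :: "'a ctree \<Rightarrow> 'a \<Rightarrow> 'a ctree \<Rightarrow> ('a ctree \<Rightarrow>\<^sub>0 'k::field)" where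
  "cherry (L s1) a (L s2) = bas (L \<langle>s1, a, s2\<rangle>)"
| "cherry l a r = 0"

lemma bottom_eq_Leaf: "bottom c = Leaf \<longleftrightarrow> (\<exists>s. c = L s)"
  by (cases c) auto

lemma koszul_differential_cpair:
  "koszul_differential (bas (cpair c)) = push cpair (dif cherry c :: _ \<Rightarrow>\<^sub>0 'k::field)"
proof -
  have "push cpair (dif cherry c :: _ \<Rightarrow>\<^sub>0 'k) = contraction_sum (top_decompositions (bottom c)) (tops c)"
  proof (rule push_cpair_dif[where P = "\<lambda>_. True", OF top_decompositions_Node top_decompositions_Leaf _ finite_top_decompositions top_decompositions_index])
    fix l a r
    show "push cpair (cherry l a r :: _ \<Rightarrow>\<^sub>0 'k) = contraction_sum
        (if bottom l = Leaf \<and> bottom r = Leaf then {(Leaf, 1, a)} else {}) (tops l @ tops r)"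
      by (cases "(l, a, r)" rule: cherry.cases) (auto simp: contraction_sum_def merge_def cpair_def)
  qed (auto split: if_splits)
  then show ?thesis by (simp add: cpair_def[of c] koszul_differential_bas)
qed

lemma koszul_differential_push_cpair:
  "koszul_differential (push cpair x) = push cpair (lext (dif cherry) x)"
  unfolding koszul_differential_def lext_lext
  unfolding koszul_differential_cpair[unfolded koszul_differential_def] ..

section \<open>Invariance of the Koszul property under a change of generators\<close>

text \<open>Labels below the cut and trees above it are treated by separate maps, so that the same
  construction covers both a change of generators and the normalization of the tops alone.\<close>

fun ctree_subst :: "('a \<Rightarrow> ('b \<Rightarrow>\<^sub>0 'k::field)) \<Rightarrow> ('a tree \<Rightarrow> ('b tree \<Rightarrow>\<^sub>0 'k))
    \<Rightarrow> 'a ctree \<Rightarrow> ('b ctree \<Rightarrow>\<^sub>0 'k)" where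
  "ctree_subst f B (L s) = push L (B s)"
| "ctree_subst f B (N l a r) = lext (\<lambda>l'. lext (\<lambda>b.
     push (\<lambda>r'. N l' b r') (ctree_subst f B r)) (f a)) (ctree_subst f B l)"

definition pair_subst :: "('a \<Rightarrow> ('b \<Rightarrow>\<^sub>0 'k::field)) \<Rightarrow> ('a tree \<times> 'a tree list \<Rightarrow>\<^sub>0 'k)
    \<Rightarrow> ('b tree \<times> 'b tree list \<Rightarrow>\<^sub>0 'k)" where
  "pair_subst f = lext (\<lambda>(t, ss). tensor (tree_subst f t) (map (tree_subst f) ss))"

lemma pair_subst_tensor: "pair_subst f (tensor q fs) = tensor (lin_subst f q) (map (lin_subst f) fs)"
  by (simp add: pair_subst_def lext_tensor)

lemma tensor_list_append:
  "tensor_list (fs @ gs) = lext (\<lambda>us. push (\<lambda>vs. us @ vs) (tensor_list gs)) (tensor_list fs)"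
  by (induction fs) (simp_all add: tensor_list_Cons lext_lext del: tensor_list.simps(2))

lemma push_cpair_ctree_subst:
  "push cpair (ctree_subst f B c) = tensor (tree_subst f (bottom c)) (map B (tops c))"
proof (induction c)
  case (L s)
  then show ?case
    by (simp add: tensor_eq tensor_list_Cons lext_lext cpair_def del: tensor_list.simps(2))
next
  case (N l a r)
  let ?F = "\<lambda>p b q. bas (\<langle>fst p, b, fst q\<rangle>, snd p @ snd q)"
  have "push cpair (ctree_subst f B (N l a r)) = lext (\<lambda>p. lext (\<lambda>b.
      lext (\<lambda>q. ?F p b q) (push cpair (ctree_subst f B r))) (f a)) (push cpair (ctree_subst f B l))"
    by (simp add: lext_lext cpair_def)
  also have "\<dots> = lext (\<lambda>l'. lext (\<lambda>us. lext (\<lambda>b. lext (\<lambda>r'.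
      lext (\<lambda>vs. bas (\<langle>l', b, r'\<rangle>, us @ vs)) (tensor_list (map B (tops r))))
      (tree_subst f (bottom r))) (f a)) (tensor_list (map B (tops l)))) (tree_subst f (bottom l))"
    unfolding N.IH by (simp add: tensor_eq lext_lext)
  also have "\<dots> = lext (\<lambda>l'. lext (\<lambda>b. lext (\<lambda>r'. lext (\<lambda>us.
      lext (\<lambda>vs. bas (\<langle>l', b, r'\<rangle>, us @ vs)) (tensor_list (map B (tops r))))
       (tensor_list (map B (tops l)))) (tree_subst f (bottom r))) (f a)) (tree_subst f (bottom l))"
    by (simp add: lext_swap[of _ _ "tensor_list (map B (tops l))"] del: lext_fun_zero)
  also have "\<dots> = tensor (tree_subst f (bottom (N l a r))) (map B (tops (N l a r)))"
    by (simp add: tensor_eq lext_lext tensor_list_append)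
  finally show ?case .
qed

lemma csize_supp_ctree_subst: "c' \<in> supp (ctree_subst f B c) \<Longrightarrow> csize c' = csize c"
proof (induction c arbitrary: c')
  case (N l a r)
  then show ?case by (fastforce elim!: in_supp_lext)
qed (auto elim!: in_supp_lext)

lemma ctree_subst_L_or_N:
  "c' \<in> supp (ctree_subst f B (N l a r)) \<Longrightarrow> \<exists>l' b r'. c' = N l' b r'"
  by (auto elim!: in_supp_lext)

text \<open>Substitution never turns a leaf of the bottom into a node or conversely, so both sides
  vanish in the same cases.\<close>

lemma ctree_subst_cherry:
  "lext (ctree_subst f (tree_subst f)) (cherry l a r) =
   lext (\<lambda>l'. lext (\<lambda>b. lext (\<lambda>r'. cherry l' b r') (ctree_subst f (tree_subst f) r)) (f a)) (ctree_subst f (tree_subst f) l)"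
proof (cases "(l, a, r)" rule: cherry.cases)
  case (1 s1 a s2)
  then show ?thesis by (simp add: lext_lext)
next
  case ("2_1" l1 b l2 a r)
  then have "lext (\<lambda>l'. lext (\<lambda>b. lext (\<lambda>r'. cherry l' b r') (ctree_subst f (tree_subst f) r)) (f a)) (ctree_subst f (tree_subst f) l)
      = lext (\<lambda>l'. 0 :: _ \<Rightarrow>\<^sub>0 'b) (ctree_subst f (tree_subst f) l)"
    by (intro lext_cong) (auto dest!: ctree_subst_L_or_N simp del: ctree_subst.simps)
  then show ?thesis using "2_1" by simp
next
  case ("2_2" l a r1 b r2)
  have "lext (\<lambda>r'. cherry l' b' r') (ctree_subst f (tree_subst f) (N r1 b r2)) = 0" for l' b'
  proof -
    have "lext (\<lambda>r'. cherry l' b' r') (ctree_subst f (tree_subst f) (N r1 b r2))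
        = lext (\<lambda>r'. 0 :: _ \<Rightarrow>\<^sub>0 'b) (ctree_subst f (tree_subst f) (N r1 b r2))"
      by (intro lext_cong) (auto dest!: ctree_subst_L_or_N simp del: ctree_subst.simps)
    then show ?thesis by simp
  qed
  then show ?thesis using "2_2" by simp
qed

text \<open>Both sides obey the same recursion, whose signs depend only on sizes and are preserved
  by substitution. Hence only the contributions of the root have to be compared.\<close>

lemma dif_ctree_subst:
  assumes J: "\<And>l a r. lext (ctree_subst f B) (J l a r) = lext (\<lambda>l'. lext (\<lambda>b.
    lext (\<lambda>r'. J' l' b r') (ctree_subst f B r)) (f a)) (ctree_subst f B l)"
  shows "lext (dif J') (ctree_subst f B c) = lext (ctree_subst f B) (dif J c)"
proof (induction c)
  case (L s)
  then show ?case by (simp add: lext_lext)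
next
  case (N l a r)
  have "lext (dif J') (ctree_subst f B (N l a r)) =
      lext (\<lambda>l'. lext (\<lambda>b. lext (\<lambda>r'. dif J' (N l' b r')) (ctree_subst f B r)) (f a)) (ctree_subst f B l)"
    by (simp add: lext_lext)
  also have "\<dots> = lext (\<lambda>l'. lext (\<lambda>b. lext (\<lambda>r'. push (\<lambda>x. N x b r') (dif J' l')
        + scale ((- 1) ^ csize l) (push (\<lambda>x. N l' b x) (dif J' r')) + J' l' b r') (ctree_subst f B r)) (f a)) (ctree_subst f B l)"
    by (intro lext_cong refl) (simp add: csize_supp_ctree_subst)
  also have "\<dots> = lext (\<lambda>l'. lext (\<lambda>b. lext (\<lambda>r'. push (\<lambda>x. N x b r') (dif J' l')) (ctree_subst f B r)) (f a)) (ctree_subst f B l)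
     + scale ((- 1) ^ csize l) (lext (\<lambda>l'. lext (\<lambda>b. lext (\<lambda>r'. push (\<lambda>x. N l' b x) (dif J' r')) (ctree_subst f B r)) (f a)) (ctree_subst f B l))
     + lext (\<lambda>l'. lext (\<lambda>b. lext (\<lambda>r'. J' l' b r') (ctree_subst f B r)) (f a)) (ctree_subst f B l)"
    by (simp add: lext_fun_lin)
  also have "lext (\<lambda>l'. lext (\<lambda>b. lext (\<lambda>r'. push (\<lambda>x. N l' b x) (dif J' r')) (ctree_subst f B r)) (f a)) (ctree_subst f B l)
      = lext (\<lambda>l'. lext (\<lambda>b. push (\<lambda>x. N l' b x) (lext (dif J') (ctree_subst f B r))) (f a)) (ctree_subst f B l)"
    by (simp add: lext_lext)
  also have "\<dots> = lext (ctree_subst f B) (push (\<lambda>x. N l a x) (dif J r))"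
    unfolding N.IH
    by (simp add: lext_lext lext_swap[of _ "dif J r"])
  also have "lext (\<lambda>l'. lext (\<lambda>b. lext (\<lambda>r'. push (\<lambda>x. N x b r') (dif J' l')) (ctree_subst f B r)) (f a)) (ctree_subst f B l)
      = lext (\<lambda>x. lext (\<lambda>b. lext (\<lambda>r'. bas (N x b r')) (ctree_subst f B r)) (f a)) (lext (dif J') (ctree_subst f B l))"
  proof -
    have "lext (\<lambda>b. lext (\<lambda>r'. push (\<lambda>x. N x b r') (dif J' l')) (ctree_subst f B r)) (f a)
       = lext (\<lambda>x. lext (\<lambda>b. lext (\<lambda>r'. bas (N x b r')) (ctree_subst f B r)) (f a)) (dif J' l')" for l'
      by (simp add: lext_swap[of _ "dif J' l'"])
    then show ?thesis by (simp add: lext_lext)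
  qed
  also have "\<dots> = lext (ctree_subst f B) (push (\<lambda>x. N x a r) (dif J l))"
    unfolding N.IH by (simp add: lext_lext)
  finally show ?case by (simp add: J lext_lin)
qed

lemma pair_subst_bas_cpair: "pair_subst f (bas (cpair c)) = push cpair (ctree_subst f (tree_subst f) c)"
  by (simp add: pair_subst_def push_cpair_ctree_subst cpair_def[of c])

lemma pair_subst_koszul_differential_bas:
  assumes "length ss = size1 t"
  shows "pair_subst f (koszul_differential (bas (t, ss))) = koszul_differential (pair_subst f (bas (t, ss)))"
proof -
  define c where "c = build t ss"
  then have c: "(t, ss) = cpair c" using cpair_build[OF assms] by simp
  have "pair_subst f (push cpair x) = push cpair (lext (ctree_subst f (tree_subst f)) x)" for x
    using pair_subst_bas_cpair[of f] by (simp add: pair_subst_def lext_lext)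
  then show ?thesis
    unfolding c koszul_differential_cpair pair_subst_bas_cpair koszul_differential_push_cpair dif_ctree_subst[where J = cherry and J' = cherry, OF ctree_subst_cherry] .
qed

text \<open>Only pairs with one tree per leaf come from cut trees. This carries statements proved on
  cut trees over to chains.\<close>

lemma supp_koszul_chains:
  fixes P :: "('a, 'k::field) presentation"
  assumes "(t, ss) \<in> supp z" "z \<in> koszul_chains P n k"
  shows "length ss = size1 t"
proof -
  let ?S = "{z :: 'a tree \<times> 'a tree list \<Rightarrow>\<^sub>0 'k. \<forall>p\<in>supp z. length (snd p) = size1 (fst p)}"
  have "pm.subspace ?S"
    unfolding pm.subspace_def by (auto dest!: supp_add_cases subsetD[OF supp_scale])
  moreover have "tensor q fs \<in> ?S" if "q \<in> koszul_dual_cooperad P k" "length ns = k"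
      "list_all2 (\<lambda>i f. f \<in> free_operad (gens P) i) ns fs" for q fs ns
  proof -
    have "length fs = k" using that(2,3) by (auto dest: list_all2_lengthD)
    moreover have "\<forall>t\<in>supp q. size1 t = k" using that(1) by (auto simp: koszul_dual_cooperad_def free_operad_iff)
    ultimately show ?thesis
      by (fastforce simp: tensor_eq elim!: in_supp_lext dest!: supp_tensor_list dest: list_all2_lengthD)
  qed
  ultimately have "koszul_chains P n k \<subseteq> ?S"
    unfolding koszul_chains_def by (intro pm.span_minimal) auto
  from subsetD[OF this assms(2)] show ?thesis using assms(1) by fastforce
qed

lemma pair_subst_koszul_differential:
  assumes "z \<in> koszul_chains P n k"
  shows "pair_subst f (koszul_differential z) = koszul_differential (pair_subst f z)"
proof -
  have "lext (\<lambda>p. pair_subst f (koszul_differential (bas p))) z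
      = lext (\<lambda>p. koszul_differential (pair_subst f (bas p))) z"
  proof (rule lext_cong[OF refl], clarify)
    fix t ss assume "(t, ss) \<in> supp z"
    then show "pair_subst f (koszul_differential (bas (t, ss))) = koszul_differential (pair_subst f (bas (t, ss)))"
      by (intro pair_subst_koszul_differential_bas supp_koszul_chains[OF _ assms])
  qed
  then show ?thesis
    by (simp add: pair_subst_def koszul_differential_def lext_lext)
qed

locale generator_change =
  fixes P P' :: "('a, 'k::field) presentation" and f :: "'a \<Rightarrow> ('a \<Rightarrow>\<^sub>0 'k)"
  assumes fin: "finite (gens P)"
    and rels_free: "rels P \<subseteq> free_operad (gens P) 3"
    and f_gens: "\<forall>a\<in>gens P. supp (f a) \<subseteq> gens P'"
    and f_rels: "\<forall>x\<in>rels P. lin_subst f x \<in> pm.span (rels P')"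
begin

lemma list_all2_lin_subst:
  "list_all2 (\<lambda>i x. x \<in> free_operad (gens P) i) ns fs \<Longrightarrow>
   list_all2 (\<lambda>i x. x \<in> free_operad (gens P') i) ns (map (lin_subst f) fs)"
  by (auto simp: list_all2_conv_all_nth intro: lin_subst_in_free_operad[OF _ f_gens])

lemma pair_subst_koszul_chains:
  assumes "z \<in> koszul_chains P n k"
  shows "pair_subst f z \<in> koszul_chains P' n k"
  unfolding pair_subst_def koszul_chains_def
proof (rule lext_maps_span[OF assms[unfolded koszul_chains_def]], safe)
  fix q :: "'a tree \<Rightarrow>\<^sub>0 'k" and fs :: "('a tree \<Rightarrow>\<^sub>0 'k) list" and ns assume h: "q \<in> koszul_dual_cooperad P (length ns)" "k = length ns" "n = sum_list ns"
    "list_all2 (\<lambda>i x. x \<in> free_operad (gens P) i) ns fs"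
  have "lin_subst f q \<in> koszul_dual_cooperad P' (length ns)"
    using h(1) by (rule lin_subst_koszul_dual_cooperad[OF fin rels_free f_gens f_rels])
  then show "lext (\<lambda>(t, ss). tensor (tree_subst f t) (map (tree_subst f) ss)) (tensor q fs) \<in> pm.span
     {tensor q fs | q fs nsa. q \<in> koszul_dual_cooperad P' (length ns) \<and> length nsa = length ns \<and>
       sum_list nsa = sum_list ns \<and> list_all2 (\<lambda>i f. f \<in> free_operad (gens P') i) nsa fs}"
    unfolding lext_tensor using list_all2_lin_subst[OF h(4)] by (intro pm.span_base) blast
qed

lemma pair_subst_koszul_null_chains:
  assumes "z \<in> koszul_null_chains P n k"
  shows "pair_subst f z \<in> koszul_null_chains P' n k"
  unfolding pair_subst_def koszul_null_chains_def
proof (rule lext_maps_span[OF assms[unfolded koszul_null_chains_def]], safe)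
  fix q :: "'a tree \<Rightarrow>\<^sub>0 'k" and fs :: "('a tree \<Rightarrow>\<^sub>0 'k) list" and ns j assume h: "q \<in> koszul_dual_cooperad P (length ns)" "k = length ns" "n = sum_list ns"
    "list_all2 (\<lambda>i x. x \<in> free_operad (gens P) i) ns fs" "j < length ns" "fs ! j \<in> operad_ideal P (ns ! j)"
  have "lin_subst f q \<in> koszul_dual_cooperad P' (length ns)"
    using h(1) by (rule lin_subst_koszul_dual_cooperad[OF fin rels_free f_gens f_rels])
  moreover have "length fs = length ns" using h(4) by (auto dest: list_all2_lengthD)
  moreover have "lin_subst f (fs ! j) \<in> operad_ideal P' (ns ! j)"
    using h(6) by (rule lin_subst_operad_ideal[OF rels_free f_gens f_rels])
  ultimately show "lext (\<lambda>(t, ss). tensor (tree_subst f t) (map (tree_subst f) ss)) (tensor q fs) \<in> pm.span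
     {tensor q fs | q fs nsa. q \<in> koszul_dual_cooperad P' (length ns) \<and> length nsa = length ns \<and>
       sum_list nsa = sum_list ns \<and> list_all2 (\<lambda>i f. f \<in> free_operad (gens P') i) nsa fs \<and>
       (\<exists>j<length ns. fs ! j \<in> operad_ideal P' (nsa ! j))}"
    unfolding lext_tensor using list_all2_lin_subst[OF h(4)] h(5)
    by (intro pm.span_base CollectI exI[of _ "lin_subst f q"] exI[of _ "map (lin_subst f) fs"] exI[of _ ns]) auto
qed

end

lemma pair_subst_pair_subst:
  fixes P :: "('a, 'k::field) presentation" and g :: "'b \<Rightarrow> ('a \<Rightarrow>\<^sub>0 'k)"
  assumes "z \<in> koszul_chains P n k" "\<And>a. a \<in> gens P \<Longrightarrow> lext g (f a) = bas a"
  shows "pair_subst g (pair_subst f z) = z"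
proof -
  have "lext (\<lambda>p. pair_subst g (pair_subst f (bas p))) z = lext bas z"
  proof (rule lext_eq_on_span[OF assms(1)[unfolded koszul_chains_def]], safe)
    fix q :: "'a tree \<Rightarrow>\<^sub>0 'k" and fs :: "('a tree \<Rightarrow>\<^sub>0 'k) list" and ns assume h: "q \<in> koszul_dual_cooperad P (length ns)"
      "list_all2 (\<lambda>i x. x \<in> free_operad (gens P) i) ns fs"
    have "lin_subst g (lin_subst f q) = q"
      using h(1) assms(2) by (auto simp: koszul_dual_cooperad_def intro: lin_subst_lin_subst)
    moreover have "map (lin_subst g) (map (lin_subst f) fs) = fs"
      using h(2) assms(2) by (auto simp: list_all2_conv_all_nth intro!: nth_equalityI lin_subst_lin_subst)
    ultimately have "pair_subst g (pair_subst f (tensor q fs)) = tensor q fs" by (simp only: pair_subst_tensor)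
    then show "lext (\<lambda>p. pair_subst g (pair_subst f (bas p))) (tensor q fs) = lext bas (tensor q fs)"
      by (simp add: pair_subst_def lext_lext)
  qed
  then show ?thesis by (simp add: pair_subst_def lext_lext)
qed

text \<open>A cycle is carried to the complex of \<open>P'\<close>, bounded there up to null chains,
  and the bounding chain is carried back. As \<open>g\<close> undoes \<open>f\<close>, the complex
  of \<open>P\<close> is a retract of that of \<open>P'\<close>.\<close>

theorem koszul_generator_change:
  assumes "generator_change P P' f" "generator_change P' P g"
    and "\<And>a. a \<in> gens P \<Longrightarrow> lext g (f a) = bas a"
    and "koszul P'"
  shows "koszul P"
  unfolding koszul_def
proof (intro allI impI ballI)
  fix n k z assume n: "2 \<le> n" and z: "z \<in> koszul_chains P n k"
    and dz: "koszul_differential z \<in> koszul_null_chains P n (k - 1)"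
  interpret f: generator_change P P' f by fact
  interpret g: generator_change P' P g by fact
  have "koszul_differential (pair_subst f z) \<in> koszul_null_chains P' n (k - 1)"
    using f.pair_subst_koszul_null_chains[OF dz] pair_subst_koszul_differential[OF z, of f] by simp
  then obtain w where w: "w \<in> koszul_chains P' n (k + 1)"
    and wz: "pair_subst f z - koszul_differential w \<in> koszul_null_chains P' n k"
    using \<open>koszul P'\<close> n f.pair_subst_koszul_chains[OF z] unfolding koszul_def by blast
  have "pair_subst g (pair_subst f z - koszul_differential w) = z - koszul_differential (pair_subst g w)"
    using pair_subst_pair_subst[OF z assms(3)] pair_subst_koszul_differential[OF w, of g]
    by (simp add: pair_subst_def lext_diff)
  then show "\<exists>w\<in>koszul_chains P n (k + 1). z - koszul_differential w \<in> koszul_null_chains P n k"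
    using g.pair_subst_koszul_null_chains[OF wz] g.pair_subst_koszul_chains[OF w] by metis
qed

section \<open>Ideals and contexts\<close>

lemma ideal_graft:
  assumes "set_tree U \<subseteq> gens P" "1 \<le> i" "i \<le> size1 U" "x \<in> operad_ideal P n"
  shows "push (\<lambda>t. graft U i t) x \<in> operad_ideal P (size1 U + n - 1)"
proof -
  have "operad_comp (bas U) i x \<in> operad_ideal P (size1 U + n - 1)"
    using assms by (intro operad_ideal_comp_right) auto
  then show ?thesis by (simp add: operad_comp_eq)
qed

lemma ideal_node_left:
  assumes "x \<in> operad_ideal P n" "a \<in> gens P" "set_tree r \<subseteq> gens P"
  shows "push (\<lambda>t. \<langle>t, a, r\<rangle>) x \<in> operad_ideal P (n + size1 r)"
  using ideal_graft[of "\<langle>Leaf, a, r\<rangle>" P 1 x n] assms by (simp add: add.commute)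

lemma ideal_node_right:
  assumes "x \<in> operad_ideal P n" "a \<in> gens P" "set_tree l \<subseteq> gens P"
  shows "push (\<lambda>t. \<langle>l, a, t\<rangle>) x \<in> operad_ideal P (size1 l + n)"
  using ideal_graft[of "\<langle>l, a, Leaf\<rangle>" P "size1 l + 1" x n] assms by simp

lemma ideal_graft_all:
  assumes R: "rels P \<subseteq> free_operad (gens P) 3" and x: "x \<in> operad_ideal P 3"
    and "set_tree u \<subseteq> gens P" "set_tree v \<subseteq> gens P" "set_tree w \<subseteq> gens P"
  shows "push (\<lambda>t. graft_all t [u, v, w]) x \<in> operad_ideal P (size1 u + size1 v + size1 w)"
proof -
  \<comment> \<open>The leaves are filled from right to left, so that the numbers of the remaining
    ones do not change.\<close>
  let ?y = "operad_comp (operad_comp (operad_comp x 3 (bas w)) 2 (bas v)) 1 (bas u)"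
  have "operad_comp x 3 (bas w) \<in> operad_ideal P (3 + size1 w - 1)"
    using assms by (intro operad_ideal_comp_left) auto
  then have "operad_comp (operad_comp x 3 (bas w)) 2 (bas v) \<in> operad_ideal P (3 + size1 w - 1 + size1 v - 1)"
    using assms by (intro operad_ideal_comp_left) auto
  then have "?y \<in> operad_ideal P (3 + size1 w - 1 + size1 v - 1 + size1 u - 1)"
    using assms by (intro operad_ideal_comp_left) auto
  moreover have "?y = push (\<lambda>t. graft_all t [u, v, w]) x"
    unfolding operad_comp_eq lext_lext lext_bas
  proof (rule lext_cong[OF refl])
    fix t assume "t \<in> supp x"
    then have "size1 t = 3" using subsetD[OF operad_ideal_subset_free[OF R] x] by (auto simp: free_operad_iff)
    then show "bas (graft (graft (graft t 3 w) 2 v) 1 u) = bas (graft_all t [u, v, w])"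
      unfolding size1_eq_3 by auto
  qed
  moreover have "3 + size1 w - 1 + size1 v - 1 + size1 u - 1 = size1 u + size1 v + size1 w"
    using size1_ge0[of u] size1_ge0[of v] size1_ge0[of w] by (simp del: size1_ge0)
  ultimately show ?thesis by (simp only:)
qed

section \<open>Right rotations\<close>

fun root_sat :: "('a \<Rightarrow> bool) \<Rightarrow> 'a tree \<Rightarrow> bool" where
  "root_sat p Leaf = True"
| "root_sat p \<langle>l, a, r\<rangle> = p a"

fun edges :: "('a \<Rightarrow> 'a \<Rightarrow> bool) \<Rightarrow> 'a tree \<Rightarrow> bool" where
  "edges E Leaf = True"
| "edges E \<langle>l, a, r\<rangle> \<longleftrightarrow> edges E l \<and> edges E r \<and> root_sat (E a) l \<and> root_sat (E a) r"

text \<open>Puts \<open>a\<close> on top of \<open>l\<close> and \<open>s\<close> and rotates equal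
  labels to the right. For Schroeder trees: if \<open>l\<close> has root label \<open>a\<close>, its
  root vertex is merged with the new one and their lists of children are concatenated.\<close>

fun rjoin :: "'a tree \<Rightarrow> 'a \<Rightarrow> 'a tree \<Rightarrow> 'a tree" where
  "rjoin Leaf a s = \<langle>Leaf, a, s\<rangle>"
| "rjoin \<langle>l, b, r\<rangle> a s = (if b = a then \<langle>l, a, rjoin r a s\<rangle> else \<langle>\<langle>l, b, r\<rangle>, a, s\<rangle>)"

text \<open>The canonical representative of a class of trees modulo rotation of equal labels, that
  is, of a Schroeder tree.\<close>

fun rnf :: "'a tree \<Rightarrow> 'a tree" where
  "rnf Leaf = Leaf"
| "rnf \<langle>l, a, r\<rangle> = rjoin (rnf l) a (rnf r)"

fun is_rnf :: "'a tree \<Rightarrow> bool" where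
  "is_rnf Leaf = True"
| "is_rnf \<langle>l, a, r\<rangle> \<longleftrightarrow> is_rnf l \<and> is_rnf r \<and> root_sat (\<lambda>b. b \<noteq> a) l"

lemma size1_rjoin [simp]: "size1 (rjoin l a r) = size1 l + size1 r"
  by (induction l) auto

lemma set_tree_rjoin [simp]: "set_tree (rjoin l a r) = insert a (set_tree l \<union> set_tree r)"
  by (induction l) auto

lemma root_sat_rjoin [simp]: "root_sat p (rjoin l a r) = p a"
  by (cases l) auto

lemma rjoin_not_Leaf [simp]: "rjoin l a r \<noteq> Leaf"
  by (cases l) auto

text \<open>A subtree that gets a new parent in a rotation of equal labels keeps the label of its
  parent.\<close>

lemma edges_rjoin: "(\<And>a. E a a) \<Longrightarrow> edges E (rjoin l a r) = edges E \<langle>l, a, r\<rangle>"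
  by (induction l) auto

lemma size1_rnf [simp]: "size1 (rnf t) = size1 t"
  by (induction t) auto

lemma set_tree_rnf [simp]: "set_tree (rnf t) = set_tree t"
  by (induction t) auto

lemma root_sat_rnf [simp]: "root_sat p (rnf t) = root_sat p t"
  by (induction t) auto

lemma edges_rnf: "(\<And>a. E a a) \<Longrightarrow> edges E (rnf t) = edges E t"
  by (induction t) (auto simp: edges_rjoin)

lemma rjoin_eq_Node: "root_sat (\<lambda>b. b \<noteq> a) l \<Longrightarrow> rjoin l a r = \<langle>l, a, r\<rangle>"
  by (cases l) auto

lemma is_rnf_rjoin: "is_rnf l \<Longrightarrow> is_rnf r \<Longrightarrow> is_rnf (rjoin l a r)"
  by (induction l) auto

lemma is_rnf_rnf [simp]: "is_rnf (rnf t)"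
  by (induction t) (auto simp: is_rnf_rjoin)

lemma rnf_is_rnf: "is_rnf t \<Longrightarrow> rnf t = t"
  by (induction t) (auto simp: rjoin_eq_Node)

lemma rnf_rnf [simp]: "rnf (rnf t) = rnf t"
  by (simp add: rnf_is_rnf)

lemma rjoin_assoc: "rjoin (rjoin l a r) a s = rjoin l a (rjoin r a s)"
  by (induction l) auto

lemma rnf_rjoin: "rnf (rjoin l a r) = rjoin (rnf l) a (rnf r)"
  by (induction l) (auto simp: rjoin_assoc)

lemma rnf_graft_rjoin:
  "1 \<le> i \<Longrightarrow> i \<le> size1 l + size1 r \<Longrightarrow> rnf (graft (rjoin l a r) i s) = rnf (graft \<langle>l, a, r\<rangle> i s)"
proof (induction l arbitrary: i)
  case (Node l1 b l2)
  show ?case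
  proof (cases "i \<le> size1 l1")
    case False
    then have "rnf (graft (rjoin l2 a r) (i - size1 l1) s) = rnf (graft \<langle>l2, a, r\<rangle> (i - size1 l1) s)"
      using Node by (intro Node.IH) auto
    then show ?thesis using False by (auto simp: rjoin_assoc)
  qed (auto simp: rnf_rjoin rjoin_assoc)
qed simp

text \<open>With \<open>rnf_graft_rnf_right\<close>: grafting descends to rotation classes.\<close>

lemma rnf_graft_rnf:
  "1 \<le> i \<Longrightarrow> i \<le> size1 t \<Longrightarrow> rnf (graft (rnf t) i s) = rnf (graft t i s)"
proof (induction t arbitrary: i)
  case (Node l a r)
  then show ?case
    using Node.IH(1)[of i] Node.IH(2)[of "i - size1 l"] by (auto simp: rnf_graft_rjoin)
qed simp

lemma rnf_graft_rnf_right: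
  "1 \<le> i \<Longrightarrow> i \<le> size1 t \<Longrightarrow> rnf (graft t i (rnf s)) = rnf (graft t i s)"
  by (induction t arbitrary: i) auto

lemma root_sat_graft: "t \<noteq> Leaf \<Longrightarrow> root_sat p (graft t i s) = root_sat p t"
  by (cases t) auto

lemma edges_graft: "edges E (graft t i s) \<Longrightarrow> edges E t \<and> edges E s"
proof (induction t arbitrary: i)
  case (Node l a r)
  have "root_sat p l" if "root_sat p (graft l j s)" for p j
    using that root_sat_graft[of l p j s] by (cases "l = Leaf") auto
  moreover have "root_sat p r" if "root_sat p (graft r j s)" for p j
    using that root_sat_graft[of r p j s] by (cases "r = Leaf") auto
  ultimately show ?case
    using Node.IH(1)[of i] Node.IH(2)[of "i - size1 l"] Node.prems by (auto split: if_splits)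
qed simp

section \<open>The associative operad of a graph\<close>

text \<open>The argument \<open>K\<close> only fixes the coefficient field.\<close>

locale graph_operad =
  fixes Q :: "'a set" and sim :: "'a \<Rightarrow> 'a \<Rightarrow> bool" and K :: "'k::field itself"
  assumes finQ: "finite Q" and sim_refl [simp]: "sim a a"
begin

definition Gr :: "('a, 'k) presentation" where
  "Gr = \<lparr>gens = Q, rels = {bas (lcomb a a) - bas (rcomb a a) | a. a \<in> Q}
     \<union> {bas (lcomb a b) | a b. a \<in> Q \<and> b \<in> Q \<and> a \<noteq> b \<and> sim a b}
     \<union> {bas (rcomb a b) | a b. a \<in> Q \<and> b \<in> Q \<and> a \<noteq> b \<and> sim a b}\<rparr>"

lemma gens_Gr [simp]: "gens Gr = Q"
  by (simp add: Gr_def)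

lemma rels_Gr_free: "rels Gr \<subseteq> free_operad Q 3"
  by (auto simp: Gr_def intro!: pm.subspace_diff subspace_free_operad)

lemma rels_Gr:
  "a \<in> Q \<Longrightarrow> bas (lcomb a a) - bas (rcomb a a) \<in> rels Gr"
  "a \<in> Q \<Longrightarrow> b \<in> Q \<Longrightarrow> a \<noteq> b \<Longrightarrow> sim a b \<Longrightarrow> bas (lcomb a b) \<in> rels Gr"
  "a \<in> Q \<Longrightarrow> b \<in> Q \<Longrightarrow> a \<noteq> b \<Longrightarrow> sim a b \<Longrightarrow> bas (rcomb a b) \<in> rels Gr"
  by (auto simp: Gr_def)

section \<open>Normal forms modulo the ideal of the graph operad\<close>

abbreviation loose :: "'a tree \<Rightarrow> bool" where "loose \<equiv> edges (\<lambda>a b. a = b \<or> \<not> sim a b)"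
abbreviation linked :: "'a tree \<Rightarrow> bool" where "linked \<equiv> edges sim"

lemma loose_rnf [simp]: "loose (rnf t) = loose t"
  by (rule edges_rnf) simp

lemma linked_rnf [simp]: "linked (rnf t) = linked t"
  by (rule edges_rnf) simp

text \<open>By \<open>NF_ideal\<close> and \<open>ideal_NF\<close>, this is the projection onto the
  span of the loose trees in rotation normal form, with the ideal as kernel.\<close>

definition NF :: "'a tree \<Rightarrow> ('a tree \<Rightarrow>\<^sub>0 'k)" where
  "NF t = (if loose t then bas (rnf t) else 0)"

lemma NF_graft:
  assumes "1 \<le> i" "i \<le> size1 t"
  shows "NF (graft t i s) = lext (\<lambda>u. lext (\<lambda>v. NF (graft u i v)) (NF s)) (NF t)"
proof (cases "loose t \<and> loose s")
  case True
  have e: "rnf (graft (rnf t) i (rnf s)) = rnf (graft t i s)"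
    using rnf_graft_rnf[OF assms] rnf_graft_rnf_right[of i "rnf t" s] assms by simp
  have "loose (graft (rnf t) i (rnf s)) = loose (graft t i s)"
    using e loose_rnf[of "graft (rnf t) i (rnf s)"] loose_rnf[of "graft t i s"] by simp
  then show ?thesis using True e by (simp add: NF_def)
next
  case False
  then have "\<not> loose (graft t i s)" using edges_graft by blast
  then show ?thesis using False by (auto simp: NF_def)
qed

text \<open>By \<open>NF_graft\<close>, the normal form of a composition depends only on the normal
  forms of the factors, so the kernel is closed under composition on both sides and only the
  relators have to be checked.\<close>

lemma NF_ideal:
  assumes "x \<in> operad_ideal Gr n"
  shows "lext NF x = 0"
proof -
  have comp: "lext NF (operad_comp x i y) =
      lext (\<lambda>u. lext (\<lambda>v. NF (graft u i v)) (lext NF y)) (lext NF x)"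
    if "x \<in> free_operad Q m" "1 \<le> i" "i \<le> m" for x y :: "'a tree \<Rightarrow>\<^sub>0 'k" and i m
  proof -
    have "lext NF (operad_comp x i y) =
      lext (\<lambda>t. lext (\<lambda>s. lext (\<lambda>u. lext (\<lambda>v. NF (graft u i v)) (NF s)) (NF t)) y) x"
      unfolding operad_comp_eq lext_lext lext_bas
      using that by (intro lext_cong refl NF_graft) (auto simp: free_operad_iff)
    also have "\<dots> = lext (\<lambda>u. lext (\<lambda>v. NF (graft u i v)) (lext NF y)) (lext NF x)"
      by (simp add: lext_lext lext_swap[of _ _ y])
    finally show ?thesis .
  qed
  have "(n, x) \<in> operad_ideal_graded Gr" using assms by (simp add: operad_ideal_def)
  then show ?thesis
  proof induction
    case (rel x)
    then show ?case by (auto simp: Gr_def lext_lin NF_def)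
  next
    case (comp_left m x y n i)
    then have "x \<in> free_operad Q m"
      using operad_ideal_subset_free[of Gr m] rels_Gr_free by (auto simp: operad_ideal_def)
    from comp[OF this comp_left(3,4)] comp_left.IH show ?case by simp
  next
    case (comp_right x m n y i)
    then show ?case using comp[of x m i y] by simp
  qed (auto simp: lext_lin)
qed

lemma ideal_lcomb:
  assumes "a \<in> Q" "b \<in> Q" "a \<noteq> b" "sim a b" "set_tree u \<subseteq> Q" "set_tree v \<subseteq> Q" "set_tree w \<subseteq> Q"
  shows "bas \<langle>\<langle>u, b, v\<rangle>, a, w\<rangle> \<in> operad_ideal Gr (size1 u + size1 v + size1 w)"
    "bas \<langle>u, a, \<langle>v, b, w\<rangle>\<rangle> \<in> operad_ideal Gr (size1 u + size1 v + size1 w)"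
proof -
  have "bas (lcomb a b) \<in> operad_ideal Gr 3" "bas (rcomb a b) \<in> operad_ideal Gr 3"
    using span_rels_subset_ideal rels_Gr assms by (meson pm.span_base subsetD)+
  from this[THEN ideal_graft_all[rotated, of _ _ u v w]]
  show "bas \<langle>\<langle>u, b, v\<rangle>, a, w\<rangle> \<in> operad_ideal Gr (size1 u + size1 v + size1 w)"
    "bas \<langle>u, a, \<langle>v, b, w\<rangle>\<rangle> \<in> operad_ideal Gr (size1 u + size1 v + size1 w)"
    using assms rels_Gr_free by simp_all
qed

lemma ideal_rotation:
  assumes "a \<in> Q" "set_tree u \<subseteq> Q" "set_tree v \<subseteq> Q" "set_tree w \<subseteq> Q"
  shows "bas \<langle>\<langle>u, a, v\<rangle>, a, w\<rangle> - bas \<langle>u, a, \<langle>v, a, w\<rangle>\<rangle> \<in> operad_ideal Gr (size1 u + size1 v + size1 w)"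
proof -
  have "bas (lcomb a a) - bas (rcomb a a) \<in> operad_ideal Gr 3"
    using span_rels_subset_ideal rels_Gr assms by (meson pm.span_base subsetD)
  from this[THEN ideal_graft_all[rotated, of _ _ u v w]]
  show ?thesis using assms rels_Gr_free by (simp add: lext_lin)
qed

lemma ideal_rjoin:
  assumes "a \<in> Q" "set_tree l \<subseteq> Q" "set_tree s \<subseteq> Q"
  shows "bas \<langle>l, a, s\<rangle> - bas (rjoin l a s) \<in> operad_ideal Gr (size1 l + size1 s)"
  using assms(2)
proof (induction l)
  case Leaf
  then show ?case by (simp add: pm.subspace_0[OF subspace_operad_ideal])
next
  case (Node l1 b l2)
  show ?case
  proof (cases "b = a")
    case True
    have "bas \<langle>l1, a, \<langle>l2, a, s\<rangle>\<rangle> - bas \<langle>l1, a, rjoin l2 a s\<rangle> \<in> operad_ideal Gr (size1 l1 + (size1 l2 + size1 s))"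
      using ideal_node_right[of "bas \<langle>l2, a, s\<rangle> - bas (rjoin l2 a s)" Gr "size1 l2 + size1 s" a l1]
        Node assms(1) by (simp add: lext_lin)
    moreover have "bas \<langle>\<langle>l1, a, l2\<rangle>, a, s\<rangle> - bas \<langle>l1, a, \<langle>l2, a, s\<rangle>\<rangle> \<in> operad_ideal Gr (size1 l1 + size1 l2 + size1 s)"
      using Node.prems assms by (intro ideal_rotation) auto
    ultimately have "(bas \<langle>\<langle>l1, a, l2\<rangle>, a, s\<rangle> - bas \<langle>l1, a, \<langle>l2, a, s\<rangle>\<rangle>)
       + (bas \<langle>l1, a, \<langle>l2, a, s\<rangle>\<rangle> - bas \<langle>l1, a, rjoin l2 a s\<rangle>) \<in> operad_ideal Gr (size1 l1 + size1 l2 + size1 s)"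
      by (intro pm.subspace_add[OF subspace_operad_ideal]) (auto simp: add.assoc)
    then show ?thesis using True by simp
  qed (simp add: pm.subspace_0[OF subspace_operad_ideal])
qed

lemma ideal_NF: "set_tree t \<subseteq> Q \<Longrightarrow> bas t - NF t \<in> operad_ideal Gr (size1 t)"
proof (induction t)
  case Leaf
  then show ?case by (simp add: NF_def pm.subspace_0[OF subspace_operad_ideal])
next
  case (Node l a r)
  let ?n = "size1 l + size1 r"
  have add: "x + y \<in> operad_ideal Gr ?n" if "x \<in> operad_ideal Gr ?n" "y \<in> operad_ideal Gr ?n" for x y
    using that by (rule pm.subspace_add[OF subspace_operad_ideal])
  have Q: "a \<in> Q" "set_tree l \<subseteq> Q" "set_tree r \<subseteq> Q" using Node.prems by auto
  \<comment> \<open>The two subtrees are normalized one after the other. Then the root is either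
    joined by rotations or has a forbidden edge that puts the tree into the ideal.\<close>
  have 1: "push (\<lambda>t. \<langle>t, a, r\<rangle>) (bas l - NF l) \<in> operad_ideal Gr ?n"
    using Node.IH(1) Q by (intro ideal_node_left) auto
  have 2: "push (\<lambda>t. \<langle>rnf l, a, t\<rangle>) (bas r - NF r) \<in> operad_ideal Gr ?n"
    using ideal_node_right[of "bas r - NF r" Gr "size1 r" a "rnf l"] Node.IH(2) Q by simp
  show ?case
  proof (cases "loose l \<and> loose r")
    case True
    have 3: "bas \<langle>l, a, r\<rangle> - bas \<langle>rnf l, a, rnf r\<rangle> \<in> operad_ideal Gr ?n"
    proof -
      have "bas \<langle>l, a, r\<rangle> - bas \<langle>rnf l, a, rnf r\<rangle> =
          (bas \<langle>l, a, r\<rangle> - bas \<langle>rnf l, a, r\<rangle>) + (bas \<langle>rnf l, a, r\<rangle> - bas \<langle>rnf l, a, rnf r\<rangle>)" by simp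
      then show ?thesis using add[OF 1 2] True by (simp add: NF_def lext_lin)
    qed
    show ?thesis
    proof (cases "loose \<langle>l, a, r\<rangle>")
      case t: True
      have "bas \<langle>rnf l, a, rnf r\<rangle> - bas (rjoin (rnf l) a (rnf r)) \<in> operad_ideal Gr ?n"
        using ideal_rjoin[of a "rnf l" "rnf r"] Q by simp
      from add[OF 3 this] t show ?thesis by (simp add: NF_def)
    next
      case f: False
      then have "\<not> root_sat (\<lambda>b. a = b \<or> \<not> sim a b) (rnf l) \<or> \<not> root_sat (\<lambda>b. a = b \<or> \<not> sim a b) (rnf r)"
        using True by auto
      then have "bas \<langle>rnf l, a, rnf r\<rangle> \<in> operad_ideal Gr ?n"
      proof
        assume h: "\<not> root_sat (\<lambda>b. a = b \<or> \<not> sim a b) (rnf l)"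
        then obtain l1 b l2 where l: "rnf l = \<langle>l1, b, l2\<rangle>" "a \<noteq> b" "sim a b" by (cases "rnf l") auto
        have "set_tree (rnf l) \<subseteq> Q" "size1 (rnf l) = size1 l" using Q by simp_all
        then show ?thesis using ideal_lcomb(1)[of a b l1 l2 "rnf r"] l Q unfolding l(1) by auto
      next
        assume h: "\<not> root_sat (\<lambda>b. a = b \<or> \<not> sim a b) (rnf r)"
        then obtain r1 b r2 where r: "rnf r = \<langle>r1, b, r2\<rangle>" "a \<noteq> b" "sim a b" by (cases "rnf r") auto
        have "set_tree (rnf r) \<subseteq> Q" "size1 (rnf r) = size1 r" using Q by simp_all
        then show ?thesis using ideal_lcomb(2)[of a b "rnf l" r1 r2] r Q unfolding r(1)
          by (auto simp: add.assoc)
      qed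
      moreover have "NF \<langle>l, a, r\<rangle> = 0" unfolding NF_def by (rule if_not_P) fact
      ultimately show ?thesis using add[OF 3, of "bas \<langle>rnf l, a, rnf r\<rangle>"] by simp
    qed
  next
    case False
    then show ?thesis
    proof (cases "loose l")
      case True
      then have r: "NF r = 0" "NF l = bas (rnf l)" "NF \<langle>l, a, r\<rangle> = 0" using False by (auto simp: NF_def)
      show ?thesis using add[OF 1 2] by (simp add: r lext_lin)
    next
      case f: False
      then have l: "NF l = 0" "NF \<langle>l, a, r\<rangle> = 0" by (auto simp: NF_def)
      show ?thesis using 1 by (simp add: l lext_lin)
    qed
  qed
qed


section \<open>The Koszul dual cooperad\<close>

lemma span_rels_Gr:
  assumes "r \<in> pm.span (rels Gr)"
  shows "coef r (lcomb a a) = - coef r (rcomb a a)"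
    and "\<not> sim a b \<Longrightarrow> coef r (lcomb a b) = 0 \<and> coef r (rcomb a b) = 0"
proof -
  let ?S = "{r :: 'a tree \<Rightarrow>\<^sub>0 'k. (\<forall>a. coef r (lcomb a a) = - coef r (rcomb a a)) \<and>
    (\<forall>a b. \<not> sim a b \<longrightarrow> coef r (lcomb a b) = 0 \<and> coef r (rcomb a b) = 0)}"
  have "pm.subspace ?S"
    unfolding pm.subspace_def
  proof (intro conjI ballI allI)
    fix x y :: "'a tree \<Rightarrow>\<^sub>0 'k" and c :: 'k
    assume x: "x \<in> ?S"
    then show "scale c x \<in> ?S" by auto
    assume y: "y \<in> ?S"
    show "x + y \<in> ?S" using x y by (auto simp: lookup_add)
  qed simp
  moreover have "rels Gr \<subseteq> ?S"
    by (auto simp: Gr_def lookup_minus lookup_single when_def)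
  ultimately have "pm.span (rels Gr) \<subseteq> ?S" by (intro pm.span_minimal)
  with assms show "coef r (lcomb a a) = - coef r (rcomb a a)"
    "\<not> sim a b \<Longrightarrow> coef r (lcomb a b) = 0 \<and> coef r (rcomb a b) = 0" by blast+
qed

text \<open>In the first part, the minus sign in the relator cancels against the suspension sign of
  the right comb. Distinct related labels impose no condition, because both their combs are relators
  on their own.\<close>

lemma cooperad_local:
  assumes "x \<in> koszul_dual_cooperad Gr n" "1 \<le> i" "i \<le> size1 U"
  shows "coef x (graft U i \<langle>\<langle>u, a, v\<rangle>, a, w\<rangle>) = coef x (graft U i \<langle>u, a, \<langle>v, a, w\<rangle>\<rangle>)"
    and "\<not> sim a b \<Longrightarrow> coef x (graft U i \<langle>\<langle>u, b, v\<rangle>, a, w\<rangle>) = 0"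
    and "\<not> sim a b \<Longrightarrow> coef x (graft U i \<langle>u, a, \<langle>v, b, w\<rangle>\<rangle>) = 0"
proof -
  from assms obtain r where r: "r \<in> pm.span (rels Gr)"
    and x: "\<And>t. size1 t = 3 \<Longrightarrow> coef x (graft U i (graft_all t [u, v, w])) = suspension_sign t * coef r t"
    unfolding koszul_dual_cooperad_def mem_Collect_eq
    by (elim conjE allE[of _ U] allE[of _ i] allE[of _ "[u, v, w]"]) auto
  show "coef x (graft U i \<langle>\<langle>u, a, v\<rangle>, a, w\<rangle>) = coef x (graft U i \<langle>u, a, \<langle>v, a, w\<rangle>\<rangle>)"
    using x[of "lcomb a a"] x[of "rcomb a a"] span_rels_Gr(1)[OF r, of a]
    by (simp add: suspension_sign_def)
  show "coef x (graft U i \<langle>\<langle>u, b, v\<rangle>, a, w\<rangle>) = 0" "coef x (graft U i \<langle>u, a, \<langle>v, b, w\<rangle>\<rangle>) = 0" if "\<not> sim a b"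
    using x[of "lcomb a b"] x[of "rcomb a b"] span_rels_Gr(2)[OF r that] by simp_all
qed

text \<open>The context \<open>U\<close> is arbitrary since the induction absorbs the root and
  \<open>l1\<close> into it before going on with \<open>l2\<close>.\<close>

lemma cooperad_rjoin:
  assumes "x \<in> koszul_dual_cooperad Gr n"
  shows "1 \<le> i \<Longrightarrow> i \<le> size1 U \<Longrightarrow> coef x (graft U i (rjoin l a s)) = coef x (graft U i \<langle>l, a, s\<rangle>)"
proof (induction l arbitrary: U i)
  case (Node l1 b l2)
  show ?case
  proof (cases "b = a")
    case True
    have g: "size1 (graft U i \<langle>l1, a, Leaf\<rangle>) = size1 U + size1 l1"
      using size1_graft[OF Node.prems, of "\<langle>l1, a, Leaf\<rangle>"] by simp
    have "coef x (graft U i (rjoin \<langle>l1, b, l2\<rangle> a s))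
        = coef x (graft (graft U i \<langle>l1, a, Leaf\<rangle>) (i + size1 l1) (rjoin l2 a s))"
      using True Node.prems by (simp add: graft_graft_right)
    also have "\<dots> = coef x (graft (graft U i \<langle>l1, a, Leaf\<rangle>) (i + size1 l1) \<langle>l2, a, s\<rangle>)"
      using Node.prems g by (intro Node.IH) auto
    also have "\<dots> = coef x (graft U i \<langle>l1, a, \<langle>l2, a, s\<rangle>\<rangle>)"
      using Node.prems by (simp add: graft_graft_right)
    finally show ?thesis using cooperad_local(1)[OF assms Node.prems] True by simp
  qed simp
qed simp

lemma cooperad_rnf_graft:
  assumes "x \<in> koszul_dual_cooperad Gr n"
  shows "1 \<le> i \<Longrightarrow> i \<le> size1 U \<Longrightarrow> coef x (graft U i (rnf t)) = coef x (graft U i t)"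
proof (induction t arbitrary: U i)
  case (Node l a r)
  have g: "size1 (graft U i \<langle>Leaf, a, rnf r\<rangle>) = size1 U + size1 r"
    "size1 (graft U i \<langle>l, a, Leaf\<rangle>) = size1 U + size1 l"
    using size1_graft[OF Node.prems, of "\<langle>Leaf, a, rnf r\<rangle>"] size1_graft[OF Node.prems, of "\<langle>l, a, Leaf\<rangle>"] by simp_all
  have "coef x (graft U i (rnf \<langle>l, a, r\<rangle>)) = coef x (graft (graft U i \<langle>Leaf, a, rnf r\<rangle>) i (rnf l))"
    using Node.prems by (simp add: cooperad_rjoin[OF assms] graft_graft_left)
  also have "\<dots> = coef x (graft (graft U i \<langle>Leaf, a, rnf r\<rangle>) i l)"
    using Node.prems g by (intro Node.IH(1)) auto
  also have "\<dots> = coef x (graft (graft U i \<langle>l, a, Leaf\<rangle>) (i + size1 l) (rnf r))"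
    using Node.prems by (simp add: graft_graft_left graft_graft_right)
  also have "\<dots> = coef x (graft (graft U i \<langle>l, a, Leaf\<rangle>) (i + size1 l) r)"
    using Node.prems g by (intro Node.IH(2)) auto
  also have "\<dots> = coef x (graft U i \<langle>l, a, r\<rangle>)"
    using Node.prems by (simp add: graft_graft_right)
  finally show ?case .
qed simp

lemma cooperad_not_linked_graft:
  assumes "x \<in> koszul_dual_cooperad Gr n"
  shows "1 \<le> i \<Longrightarrow> i \<le> size1 U \<Longrightarrow> \<not> linked t \<Longrightarrow> coef x (graft U i t) = 0"
proof (induction t arbitrary: U i)
  case (Node l a r)
  have g: "size1 (graft U i \<langle>Leaf, a, r\<rangle>) = size1 U + size1 r"
    "size1 (graft U i \<langle>l, a, Leaf\<rangle>) = size1 U + size1 l"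
    using size1_graft[OF Node.prems(1,2), of "\<langle>Leaf, a, r\<rangle>"] size1_graft[OF Node.prems(1,2), of "\<langle>l, a, Leaf\<rangle>"] by simp_all
  consider "\<not> linked l" | "\<not> linked r" | l1 b l2 where "l = \<langle>l1, b, l2\<rangle>" "\<not> sim a b"
    | r1 b r2 where "r = \<langle>r1, b, r2\<rangle>" "\<not> sim a b"
    using Node.prems(3) by (cases l; cases r) auto
  then show ?case
  proof cases
    case 1
    then show ?thesis using Node.IH(1)[of i "graft U i \<langle>Leaf, a, r\<rangle>"] Node.prems g
      by (simp add: graft_graft_left)
  next
    case 2
    then show ?thesis using Node.IH(2)[of "i + size1 l" "graft U i \<langle>l, a, Leaf\<rangle>"] Node.prems g
      by (simp add: graft_graft_right)
  qed (simp_all add: cooperad_local[OF assms Node.prems(1,2)])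
qed simp

lemma cooperad_coef:
  assumes "x \<in> koszul_dual_cooperad Gr n"
  shows "coef x (rnf t) = coef x t" "\<not> linked t \<Longrightarrow> coef x t = 0"
  using cooperad_rnf_graft[OF assms, of 1 "Leaf" t] cooperad_not_linked_graft[OF assms, of 1 "Leaf" t] by auto

text \<open>Converse of \<open>cooperad_coef\<close>: in each arity the cooperad consists of the
  functions on the rotation classes of linked trees.\<close>

lemma cooperadI:
  assumes x: "x \<in> free_operad Q n"
    and rot: "\<And>s t. rnf s = rnf t \<Longrightarrow> coef x s = coef x t"
    and linked: "\<And>t. \<not> linked t \<Longrightarrow> coef x t = 0"
  shows "x \<in> koszul_dual_cooperad Gr n"
proof -
  have "\<exists>r\<in>pm.span (rels Gr). \<forall>t. size1 t = 3 \<longrightarrow>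
      coef x (graft U i (graft_all t ts)) = suspension_sign t * coef r t"
    if i: "1 \<le> i" "i \<le> size1 U" and "length ts = 3" for U i and ts :: "'a tree list"
  proof -
    obtain u v w where ts: "ts = [u, v, w]" using \<open>length ts = 3\<close> by (auto simp: length_3_conv)
    define f where "f t = suspension_sign t * coef x (graft U i (graft_all t ts))" for t
    have fQ: "f t = 0" if "size1 t = 3" "\<not> set_tree t \<subseteq> Q" for t
    proof -
      have "\<not> set_tree (graft U i (graft_all t ts)) \<subseteq> Q"
        using that i by (simp add: ts set_tree_graft set_tree_graft_all del: graft_all.simps)
      then have "graft U i (graft_all t ts) \<notin> supp x" using x by (auto simp: free_operad_iff)
      then show ?thesis by (simp add: f_def in_keys_iff)
    qed
    have frot: "f (rcomb a a) = - f (lcomb a a)" for a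
    proof -
      have "coef x (graft U i (graft_all (lcomb a a) ts)) = coef x (graft U i (graft_all (rcomb a a) ts))"
      proof (rule rot)
        have "rnf (graft_all (lcomb a a) ts) = rnf (graft_all (rcomb a a) ts)" by (simp add: ts rjoin_assoc)
        then show "rnf (graft U i (graft_all (lcomb a a) ts)) = rnf (graft U i (graft_all (rcomb a a) ts))"
          using rnf_graft_rnf_right[OF i] by metis
      qed
      then show ?thesis by (simp add: f_def suspension_sign_def)
    qed
    have falw: "f (lcomb a b) = 0" "f (rcomb a b) = 0" if "\<not> sim a b" for a b
    proof -
      have "\<not> linked (graft U i (graft_all t ts))" if "t = lcomb a b \<or> t = rcomb a b" for t
        using edges_graft[of sim U i "graft_all t ts"] that \<open>\<not> sim a b\<close> by (auto simp: ts)
      then show "f (lcomb a b) = 0" "f (rcomb a b) = 0" by (simp_all add: f_def linked del: graft_all.simps)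
    qed
    \<comment> \<open>The local component of \<open>x\<close> with the suspension sign removed.
      Grouped by pairs of labels, each summand is visibly a combination of relators.\<close>
    define r where "r = (\<Sum>a\<in>Q. \<Sum>b\<in>Q. scale (f (lcomb a b)) (bas (lcomb a b)) + scale (f (rcomb a b)) (bas (rcomb a b)))"
    have "r \<in> pm.span (rels Gr)"
      unfolding r_def
    proof (intro pm.span_sum)
      fix a b assume ab: "a \<in> Q" "b \<in> Q"
      show "scale (f (lcomb a b)) (bas (lcomb a b)) + scale (f (rcomb a b)) (bas (rcomb a b)) \<in> pm.span (rels Gr)"
      proof (cases "a = b")
        case True
        have "scale (f (lcomb a a)) (bas (lcomb a a)) + scale (f (rcomb a a)) (bas (rcomb a a))
            = scale (f (lcomb a a)) (bas (lcomb a a) - bas (rcomb a a))"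
          by (simp add: frot pm.scale_right_diff_distrib)
        moreover have "\<dots> \<in> pm.span (rels Gr)"
          by (intro pm.span_scale pm.span_base rels_Gr ab)
        ultimately show ?thesis using True by simp
      next
        case False
        show ?thesis
        proof (cases "sim a b")
          case True
          then show ?thesis using ab False
            by (intro pm.span_add pm.span_scale pm.span_base[OF rels_Gr(2)] pm.span_base[OF rels_Gr(3)])
        qed (simp add: falw pm.span_zero)
      qed
    qed
    moreover have "coef r t = f t" if t: "size1 t = 3" for t
    proof -
      have "coef r t = (\<Sum>a\<in>Q. \<Sum>b\<in>Q. (if t = lcomb a b then f t else 0) + (if t = rcomb a b then f t else 0))"
        unfolding r_def lookup_sum by (intro sum.cong refl) (auto simp: lookup_add lookup_single when_def)
      also have "\<dots> = f t"
      proof (cases "\<exists>a b. t = lcomb a b")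
        case True
        then obtain c d where t: "t = lcomb c d" by blast
        have "(\<Sum>a\<in>Q. \<Sum>b\<in>Q. (if t = lcomb a b then f t else 0) + (if t = rcomb a b then f t else 0))
            = (\<Sum>a\<in>Q. if c = a then (\<Sum>b\<in>Q. if d = b then f t else 0) else 0)"
          by (intro sum.cong refl) (auto simp: t)
        then show ?thesis using finQ fQ[OF \<open>size1 t = 3\<close>] by (auto simp: t)
      next
        case False
        then obtain c d where t: "t = rcomb c d" using \<open>size1 t = 3\<close> unfolding size1_eq_3 by blast
        have "(\<Sum>a\<in>Q. \<Sum>b\<in>Q. (if t = lcomb a b then f t else 0) + (if t = rcomb a b then f t else 0))
            = (\<Sum>a\<in>Q. if c = a then (\<Sum>b\<in>Q. if d = b then f t else 0) else 0)"
          by (intro sum.cong refl) (auto simp: t)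
        then show ?thesis using finQ fQ[OF \<open>size1 t = 3\<close>] by (auto simp: t)
      qed
      finally show ?thesis .
    qed
    ultimately show ?thesis
      by (intro bexI[of _ r]) (simp_all add: f_def suspension_sign_sq del: graft_all.simps)
  qed
  then show ?thesis using x by (auto simp: koszul_dual_cooperad_def)
qed

text \<open>In the infix sign convention, the elements of the cooperad are constant on the classes of trees
  modulo rotation of equal labels, without signs.\<close>

definition rot_sum :: "'a tree \<Rightarrow> ('a tree \<Rightarrow>\<^sub>0 'k)" where
  "rot_sum t = (\<Sum>T | rnf T = t. bas T)"

lemma finite_rnf: "finite {T. rnf T = t}"
  by (rule finite_subset[OF _ finite_bounded_trees[of "set_tree t" "size1 t"]]) auto

lemma coef_rot_sum: "coef (rot_sum t) T = (if rnf T = t then 1 else 0)"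
  unfolding rot_sum_def lookup_sum using finite_rnf[of t]
  by (simp add: lookup_single when_def sum.delta cong: if_cong)

lemma supp_rot_sum: "T \<in> supp (rot_sum t) \<longleftrightarrow> rnf T = t"
  by (simp add: in_keys_iff coef_rot_sum)

lemma rot_sum_in_cooperad:
  assumes "set_tree t \<subseteq> Q" "linked t"
  shows "rot_sum t \<in> koszul_dual_cooperad Gr (size1 t)"
proof (rule cooperadI)
  show "rot_sum t \<in> free_operad Q (size1 t)"
    using assms(1) set_tree_rnf size1_rnf by (metis free_operad_iff supp_rot_sum)
  show "coef (rot_sum t) s = 0" if "\<not> linked s" for s
    using assms that by (auto simp: coef_rot_sum)
qed (simp add: coef_rot_sum)

text \<open>By constancy on rotation classes, the coefficient of a class can be read off at its
  normal form.\<close>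

lemma cooperad_expansion:
  assumes "x \<in> koszul_dual_cooperad Gr n"
  shows "lext (\<lambda>t. if is_rnf t then rot_sum t else 0) x = x"
proof (rule finsupp_eqI)
  fix T
  have "coef (lext (\<lambda>t. if is_rnf t then rot_sum t else 0) x) T
     = (\<Sum>t\<in>supp x. if t = rnf T then coef x t else 0)"
    unfolding coef_lext by (intro sum.cong refl) (auto simp: coef_rot_sum)
  also have "\<dots> = coef x T" using cooperad_coef(1)[OF assms, of T] by (simp add: in_keys_iff)
  finally show "coef (lext (\<lambda>t. if is_rnf t then rot_sum t else 0) x) T = coef x T" .
qed

section \<open>The differential on the rotation basis\<close>

text \<open>Turns combinations of cut trees into chains. A bottom that is not in normal form is sent
  to 0, since no tree has it as its normal form.\<close>

definition rot_chain :: "('a tree \<times> 'a tree list \<Rightarrow>\<^sub>0 'k) \<Rightarrow> ('a tree \<times> 'a tree list \<Rightarrow>\<^sub>0 'k)" where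
  "rot_chain = lext (\<lambda>(t, ss). tensor (rot_sum t) (map bas ss))"

text \<open>The ways to split a top node off some tree of the rotation class, the remainder being
  taken up to rotation.\<close>

definition rnf_decompositions :: "'a tree \<Rightarrow> ('a tree \<times> nat \<times> 'a) set" where
  "rnf_decompositions t = {(t', i, g). is_rnf t' \<and> 1 \<le> i \<and> i \<le> size1 t' \<and> rnf (graft t' i (corolla g)) = t}"

lemma scale_bas: "scale c (bas b) = Poly_Mapping.single b c"
  by (rule finsupp_eqI) (simp add: lookup_single when_def)

lemma rot_chain_single:
  "rot_chain (Poly_Mapping.single (t, ss) c) = (\<Sum>T | rnf T = t. Poly_Mapping.single (T, ss) c)"
  by (simp add: rot_chain_def lext_single tensor_eq rot_sum_def lext_sum
      pm.scale_sum_right scale_bas)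

lemma finite_rnf_decompositions: "finite (rnf_decompositions t)"
proof (rule finite_subset)
  show "rnf_decompositions t \<subseteq>
      {s. set_tree s \<subseteq> set_tree t \<and> size1 s \<le> size1 t} \<times> {..size1 t} \<times> set_tree t"
  proof
    fix d assume "d \<in> rnf_decompositions t"
    then obtain t' i g where d: "d = (t', i, g)" "1 \<le> i" "i \<le> size1 t'"
      and t: "t = rnf (graft t' i (corolla g))"
      by (auto simp: rnf_decompositions_def)
    have "size1 t + 1 = size1 t' + 2"
      using size1_graft[OF d(2,3), of "corolla g"] t by (simp add: corolla_def)
    moreover have "set_tree t = insert g (set_tree t')"
      using set_tree_graft[OF d(2,3), of "corolla g"] t by (simp add: corolla_def)
    ultimately show "d \<in> {s. set_tree s \<subseteq> set_tree t \<and> size1 s \<le> size1 t} \<times> {..size1 t} \<times> set_tree t"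
      using d by auto
  qed
  show "finite ({s. set_tree s \<subseteq> set_tree t \<and> size1 s \<le> size1 t} \<times> {..size1 t} \<times> set_tree t)"
    by (intro finite_cartesian_product finite_bounded_trees) auto
qed

lemma rnf_decompositions_index:
  assumes "x \<in> rnf_decompositions t"
  shows "1 \<le> fst (snd x) \<and> fst (snd x) < size1 t"
proof -
  obtain t' i g where x: "x = (t', i, g)" "1 \<le> i" "i \<le> size1 t'" "t = rnf (graft t' i (corolla g))"
    using assms by (auto simp: rnf_decompositions_def)
  then show ?thesis using size1_graft[OF x(2,3), of "corolla g"] by (simp add: corolla_def)
qed

text \<open>Splitting a top node off every tree of the class of \<open>t\<close> amounts to choosing
  a decomposition of the class and then a representative of its remainder. Sign and merging depend
  only on the index, which is the same for all these representatives.\<close>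

lemma koszul_differential_rot_chain_bas:
  "koszul_differential (rot_chain (bas (t, ss))) = rot_chain (contraction_sum (rnf_decompositions t) ss)"
proof -
  let ?s = "\<lambda>T i g. Poly_Mapping.single (T, merge i g ss) ((- 1) ^ (i + 1)) :: _ \<Rightarrow>\<^sub>0 'k"
  have "koszul_differential (rot_chain (bas (t, ss))) = (\<Sum>T | rnf T = t. koszul_differential (bas (T, ss)))"
    unfolding rot_chain_single koszul_differential_def lext_sum ..
  also have "\<dots> = (\<Sum>T | rnf T = t. \<Sum>d\<in>top_decompositions T. case d of (T', i, g) \<Rightarrow> ?s T' i g)"
    unfolding koszul_differential_bas contraction_sum_def ..
  also have "\<dots> = (\<Sum>p\<in>(SIGMA T:{T. rnf T = t}. top_decompositions T). case snd p of (T', i, g) \<Rightarrow> ?s T' i g)"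
    using finite_rnf finite_top_decompositions by (subst sum.Sigma) (auto simp: split_def)
  also have "\<dots> = (\<Sum>p\<in>(SIGMA d:rnf_decompositions t. {T. rnf T = fst d}). case p of ((t', i, g), T') \<Rightarrow> ?s T' i g)"
  proof (rule sum.reindex_bij_witness[where i = "\<lambda>((t', i, g), T'). (graft T' i (corolla g), (T', i, g))"
        and j = "\<lambda>(T, (T', i, g)). ((rnf T', i, g), T')"], goal_cases)
    case (1 a)
    then show ?case by (auto simp: top_decompositions_def)
  next
    case (2 a)
    then show ?case by (auto simp: top_decompositions_def rnf_decompositions_def rnf_graft_rnf simp flip: One_nat_def)
  next
    case (3 b)
    then show ?case by auto
  next
    case (4 b)
    then obtain t' i g T' where b: "b = ((t', i, g), T')" "rnf T' = t'" "(t', i, g) \<in> rnf_decompositions t"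
      by auto
    then have i: "1 \<le> i" "i \<le> size1 T'" by (auto simp: rnf_decompositions_def)
    then show ?case using b rnf_graft_rnf[OF i, of "corolla g"]
      by (auto simp: top_decompositions_def rnf_decompositions_def)
  next
    case (5 a)
    then show ?case by auto
  qed
  also have "\<dots> = (\<Sum>d\<in>rnf_decompositions t. \<Sum>T' | rnf T' = fst d. case d of (t', i, g) \<Rightarrow> ?s T' i g)"
    using finite_rnf finite_rnf_decompositions by (subst sum.Sigma) (auto simp: split_def)
  also have "\<dots> = rot_chain (contraction_sum (rnf_decompositions t) ss)"
    unfolding contraction_sum_def rot_chain_def lext_sum
    by (intro sum.cong refl) (auto simp: rot_chain_single[unfolded rot_chain_def])
  finally show ?thesis .
qed

text \<open>The second clause merges the first two children of a Schroeder vertex that has further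
  ones. Later neighbours are merged by the recursion of \<open>dif\<close> in the right subtree, and
  the first clause handles the end of the comb.\<close>

fun comb_merge :: "'a ctree \<Rightarrow> 'a \<Rightarrow> 'a ctree \<Rightarrow> ('a ctree \<Rightarrow>\<^sub>0 'k)" where
  "comb_merge (L s1) a (L s2) = bas (L \<langle>s1, a, s2\<rangle>)"
| "comb_merge (L s1) a (N (L s2) b r) = (if a = b then bas (N (L \<langle>s1, a, s2\<rangle>) a r) else 0)"
| "comb_merge l a r = 0"

text \<open>The triple \<open>(r, 1, a)\<close>: a corolla \<open>a\<close> on the first leaf of a
  right comb \<open>r\<close> with root label \<open>a\<close> becomes, after rotation, a new root
  on top of \<open>r\<close>.\<close>

definition rnf_root_decompositions :: "'a tree \<Rightarrow> 'a \<Rightarrow> 'a tree \<Rightarrow> ('a tree \<times> nat \<times> 'a) set" where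
  "rnf_root_decompositions l a r = (case l of Leaf \<Rightarrow> (case r of Leaf \<Rightarrow> {(Leaf, 1, a)}
     | \<langle>r1, b, r2\<rangle> \<Rightarrow> if r1 = Leaf \<and> b = a then {(r, 1, a)} else {}) | _ \<Rightarrow> {})"

lemma rnf_decompositions_Leaf: "rnf_decompositions Leaf = {}"
proof -
  have False if "x \<in> rnf_decompositions Leaf" for x using rnf_decompositions_index[OF that] by auto
  then show ?thesis by blast
qed

lemma rnf_decompositions_Node:
  assumes is_rnf: "is_rnf \<langle>l, a, r\<rangle>"
  shows "rnf_decompositions \<langle>l, a, r\<rangle> = (\<lambda>(t, i, g). (\<langle>t, a, r\<rangle>, i, g)) ` rnf_decompositions l
      \<union> (\<lambda>(t, i, g). (\<langle>l, a, t\<rangle>, i + size1 l, g)) ` rnf_decompositions r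
      \<union> rnf_root_decompositions l a r" (is "?X = ?A \<union> ?B \<union> ?C")
proof
  show "?X \<subseteq> ?A \<union> ?B \<union> ?C"
  proof
    fix x assume "x \<in> ?X"
    then obtain t' i g where x: "x = (t', i, g)" "1 \<le> i" "i \<le> size1 t'" "is_rnf t'"
      and t: "rnf (graft t' i (corolla g)) = \<langle>l, a, r\<rangle>"
      by (auto simp: rnf_decompositions_def)
    show "x \<in> ?A \<union> ?B \<union> ?C"
    proof (cases t')
      case Leaf
      then show ?thesis using x t by (auto simp: corolla_def rnf_root_decompositions_def)
    next
      case (Node l' b r')
      then have nl': "is_rnf l'" "is_rnf r'" "root_sat (\<lambda>c. c \<noteq> b) l'" using x by auto
      show ?thesis
      proof (cases "i \<le> size1 l'")
        case True
        then have e: "rjoin (rnf (graft l' i (corolla g))) b r' = \<langle>l, a, r\<rangle>"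
          using t Node nl' by (simp add: rnf_is_rnf)
        show ?thesis
        proof (cases "l' = Leaf")
          case l': True
          then have i: "i = 1" using True x by simp
          \<comment> \<open>The corolla becomes the left child of the root. If it has the label of
            the root, it is rotated into the comb; otherwise it stays and is a decomposition of the
            left subtree.\<close>
          show ?thesis
          proof (cases "g = b")
            case True
            then have "x \<in> ?C"
              using e x Node i l' by (auto simp: corolla_def rnf_root_decompositions_def)
            then show ?thesis by blast
          next
            case False
            then have "x = (\<lambda>(t, i, g). (\<langle>t, a, r\<rangle>, i, g)) (Leaf, 1, g)" "(Leaf, 1, g) \<in> rnf_decompositions l"
              using e x Node i l' by (auto simp: corolla_def rnf_decompositions_def)
            then show ?thesis by blast
          qed
        next
          case False
          then have "rjoin (rnf (graft l' i (corolla g))) b r' = \<langle>rnf (graft l' i (corolla g)), b, r'\<rangle>"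
            using nl' by (intro rjoin_eq_Node) (simp add: root_sat_graft)
          then have "x = (\<lambda>(t, i, g). (\<langle>t, a, r\<rangle>, i, g)) (l', i, g)" "(l', i, g) \<in> rnf_decompositions l"
            using e x Node True nl' by (auto simp: rnf_decompositions_def)
          then show ?thesis by blast
        qed
      next
        case False
        then have "rjoin l' b (rnf (graft r' (i - size1 l') (corolla g))) = \<langle>l, a, r\<rangle>"
          using t Node nl' by (simp add: rnf_is_rnf)
        then have e: "l' = l" "b = a" "rnf (graft r' (i - size1 l') (corolla g)) = r"
          using nl' by (auto simp: rjoin_eq_Node)
        have "x = (\<lambda>(t, i, g). (\<langle>l, a, t\<rangle>, i + size1 l, g)) (r', i - size1 l, g)"
          "(r', i - size1 l, g) \<in> rnf_decompositions r"
          using e x Node False nl' by (auto simp: rnf_decompositions_def)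
        then show ?thesis by blast
      qed
    qed
  qed
  have "?A \<subseteq> ?X"
  proof
    fix x assume "x \<in> ?A"
    then obtain t i g where x: "x = (\<langle>t, a, r\<rangle>, i, g)" "1 \<le> i" "i \<le> size1 t" "is_rnf t"
      and l: "rnf (graft t i (corolla g)) = l" by (auto simp: rnf_decompositions_def)
    have "root_sat (\<lambda>b. b \<noteq> a) t"
    proof (cases "t = Leaf")
      case False
      have "root_sat (\<lambda>b. b \<noteq> a) (rnf (graft t i (corolla g)))" unfolding l using is_rnf by simp
      then show ?thesis using False by (simp add: root_sat_graft)
    qed simp
    then show "x \<in> ?X" using x l is_rnf by (auto simp: rnf_decompositions_def rnf_is_rnf rjoin_eq_Node)
  qed
  moreover have "?B \<subseteq> ?X"
    using is_rnf by (auto simp: rnf_decompositions_def rnf_is_rnf rjoin_eq_Node)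
  moreover have "?C \<subseteq> ?X"
    using is_rnf by (auto simp: rnf_root_decompositions_def rnf_decompositions_def corolla_def rnf_is_rnf rjoin_eq_Node
        split: tree.splits if_splits)
  ultimately show "?A \<union> ?B \<union> ?C \<subseteq> ?X" by blast
qed

lemma push_cpair_dif_comb_merge:
  assumes "is_rnf (bottom c)"
  shows "push cpair (dif comb_merge c) = contraction_sum (rnf_decompositions (bottom c)) (tops c)"
proof (rule push_cpair_dif[where P = is_rnf and W = rnf_decompositions and ?W0.0 = rnf_root_decompositions,
      OF rnf_decompositions_Node rnf_decompositions_Leaf _ finite_rnf_decompositions rnf_decompositions_index _ _ assms])
  fix l a r x assume "x \<in> rnf_root_decompositions l a r"
  then show "fst (snd x) = size1 l"
    by (auto simp: rnf_root_decompositions_def split: tree.splits if_splits)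
next
  fix l :: "'a ctree" and a r assume "is_rnf \<langle>bottom l, a, bottom r\<rangle>"
  then show "push cpair (comb_merge l a r) = contraction_sum (rnf_root_decompositions (bottom l) a (bottom r)) (tops l @ tops r)"
    by (cases "(l, a, r)" rule: comb_merge.cases)
      (auto simp: contraction_sum_def merge_def cpair_def rnf_root_decompositions_def bottom_eq_Leaf split: tree.splits)
qed auto

lemma koszul_differential_rot_chain:
  assumes "is_rnf (bottom c)"
  shows "koszul_differential (rot_chain (bas (cpair c))) = rot_chain (push cpair (dif comb_merge c))"
  using koszul_differential_rot_chain_bas[of "bottom c" "tops c"] push_cpair_dif_comb_merge[OF assms]
  by (simp add: cpair_def[of c])


section \<open>The contracting homotopy\<close>

text \<open>\<open>comb_merge\<close> followed by reduction of the newly formed top modulo the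
  ideal.\<close>

fun nf_merge :: "'a ctree \<Rightarrow> 'a \<Rightarrow> 'a ctree \<Rightarrow> ('a ctree \<Rightarrow>\<^sub>0 'k)" where
  "nf_merge (L s1) a (L s2) = push L (NF \<langle>s1, a, s2\<rangle>)"
| "nf_merge (L s1) a (N (L s2) b r) = (if a = b then push (\<lambda>s. N (L s) a r) (NF \<langle>s1, a, s2\<rangle>) else 0)"
| "nf_merge l a r = 0"

abbreviation nbr :: "'a \<Rightarrow> 'a \<Rightarrow> bool" where "nbr b \<equiv> \<lambda>a. sim b a \<and> a \<noteq> b"

text \<open>For a child \<open>x\<close> of a \<open>b\<close>-vertex: the homotopy may act inside
  \<open>x\<close>. If \<open>x\<close> is a leaf of the bottom, the root of its top has to be
  admissible as a left child of \<open>b\<close> in a linked normal form.\<close>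

fun movable :: "'a \<Rightarrow> 'a ctree \<Rightarrow> bool" where
  "movable b (L s) \<longleftrightarrow> \<not> root_sat (\<lambda>a. \<not> nbr b a) s"
| "movable b (N x a y) \<longleftrightarrow> True"

text \<open>The homotopy moves a node from the top to the bottom, next to the leftmost leaf of the
  bottom where this is possible. The argument \<open>S\<close> restricts the labels of a node that may be moved
  to the root position.\<close>

fun homotopy :: "('a \<Rightarrow> bool) \<Rightarrow> 'a ctree \<Rightarrow> ('a ctree \<Rightarrow>\<^sub>0 'k)" where
  "homotopy S (L Leaf) = 0"
| "homotopy S (L \<langle>l, b, r\<rangle>) = (if S b then bas (N (L l) b (L r)) else 0)"
| "homotopy S (N x b y) =
    (if movable b x then push (\<lambda>x'. N x' b y) (homotopy (nbr b) x)
     else case x of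
       L \<langle>l, c, r\<rangle> \<Rightarrow>
         (if c = b then bas (N (L l) b (N (L r) b y))
          else - push (N x b) (case y of N z c w \<Rightarrow> if c = b then push (\<lambda>z'. N z' b w) (homotopy (nbr b) z) else homotopy (nbr b) y
             | L s \<Rightarrow> homotopy (nbr b) y))
     | _ \<Rightarrow> - push (N x b) (case y of N z c w \<Rightarrow> if c = b then push (\<lambda>z'. N z' b w) (homotopy (nbr b) z) else homotopy (nbr b) y
             | L s \<Rightarrow> homotopy (nbr b) y))"

declare homotopy.simps(3) [simp del]

text \<open>For a top: it may stand as left subtree of \<open>b\<close> in a normal form of the
  operad. Reflexivity of \<open>sim\<close> excludes the label \<open>b\<close> itself.\<close>

abbreviation frozen :: "'a \<Rightarrow> 'a tree \<Rightarrow> bool" where "frozen b \<equiv> root_sat (\<lambda>a. \<not> sim b a)"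

lemma not_movable_cases:
  assumes "\<not> movable b x"
  obtains (split) l r where "x = L \<langle>l, b, r\<rangle>" | (frozen) s where "x = L s" "frozen b s"
proof (cases x)
  case (L s)
  then show ?thesis using assms that by (cases s) auto
qed (use assms in auto)

lemma homotopy_movable: "movable b x \<Longrightarrow> homotopy S (N x b y) = push (\<lambda>x'. N x' b y) (homotopy (nbr b) x)"
  by (simp add: homotopy.simps(3))

text \<open>The root \<open>b\<close> of the first top is moved into the \<open>b\<close>-vertex
  below, which gains a child.\<close>

lemma homotopy_split: "homotopy S (N (L \<langle>l, b, r\<rangle>) b y) = bas (N (L l) b (N (L r) b y))"
  by (simp add: homotopy.simps(3))

text \<open>The homotopy turns to the second child of the vertex, and the sign comes from passing
  the leaf \<open>s\<close>. A second top with root label \<open>b\<close> is not split, since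
  \<open>nbr b\<close> excludes \<open>b\<close>.\<close>

lemma homotopy_frozen_same:
  "frozen b s \<Longrightarrow> homotopy S (N (L s) b (N z b w)) = - push (\<lambda>z'. N (L s) b (N z' b w)) (homotopy (nbr b) z)"
  by (cases s) (auto simp: homotopy.simps(3) lext_lext)

lemma homotopy_frozen_other:
  "frozen b s \<Longrightarrow> root_sat (\<lambda>a. a \<noteq> b) (bottom y) \<Longrightarrow> homotopy S (N (L s) b y) = - push (N (L s) b) (homotopy (nbr b) y)"
  by (cases s; cases y) (auto simp: homotopy.simps(3))

lemma in_supp_push:
  assumes "c \<in> supp (push f x)"
  obtains b where "b \<in> supp x" "c = f b"
  using assms by (elim in_supp_lext) auto

text \<open>The clause about \<open>p\<close> guarantees that a subtree on which the homotopy acts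
  remains admissible as a child of its parent.\<close>

lemma supp_homotopy:
  assumes "c' \<in> supp (homotopy S c)"
  shows "(\<exists>x b y. c' = N x b y) \<and> csize c' = csize c + 1 \<and>
    ((\<forall>a. S a \<longrightarrow> p a) \<longrightarrow> root_sat p (bottom c) \<longrightarrow> root_sat p (bottom c'))"
  using assms
proof (induction c arbitrary: S c' p rule: measure_induct_rule[of size])
  case (less c)
  show ?case
  proof (cases c)
    case (L s)
    then show ?thesis using less.prems by (cases s) (auto split: if_splits)
  next
    case c: (N x b y)
    show ?thesis
    proof (cases "movable b x")
      case True
      then obtain x' where "x' \<in> supp (homotopy (nbr b) x)" "c' = N x' b y"
        using less.prems c by (auto simp: homotopy_movable elim: in_supp_push)
      then show ?thesis using less.IH[of x x'] c by auto
    next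
      case False
      then show ?thesis
      proof (cases rule: not_movable_cases)
        case (split l r)
        then show ?thesis using less.prems c by (auto simp: homotopy_split)
      next
        case (frozen s)
        show ?thesis
        proof (cases "root_sat (\<lambda>a. a \<noteq> b) (bottom y)")
          case True
          then obtain y' where "y' \<in> supp (homotopy (nbr b) y)" "c' = N (L s) b y'"
            using less.prems c frozen by (auto simp: homotopy_frozen_other elim: in_supp_push)
          then show ?thesis using less.IH[of y y'] c frozen by auto
        next
          case False
          then obtain z w where y: "y = N z b w" by (cases y) auto
          then obtain z' where "z' \<in> supp (homotopy (nbr b) z)" "c' = N (L s) b (N z' b w)"
            using less.prems c frozen by (auto simp: homotopy_frozen_same elim: in_supp_push)
          then show ?thesis using less.IH[of z z'] c frozen y by auto
        qed
      qed
    qed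
  qed
qed

lemma supp_NF: "s \<in> supp (NF t) \<Longrightarrow> loose t \<and> s = rnf t"
  by (auto simp: NF_def split: if_splits)

lemma rjoin_Node: "\<exists>u v. rjoin l a r = \<langle>u, a, v\<rangle>"
  by (cases l) auto

lemma supp_nf_merge:
  assumes "c \<in> supp (nf_merge l a r)"
  obtains (leaf) s1 s2 u v where "l = L s1" "r = L s2" "c = L \<langle>u, a, v\<rangle>"
  | (node) s1 s2 u v y where "l = L s1" "r = N (L s2) a y" "c = N (L \<langle>u, a, v\<rangle>) a y"
proof -
  have NF: "\<exists>u v. s = \<langle>u, a, v\<rangle>" if "s \<in> supp (NF \<langle>s1, a, s2\<rangle>)" for s s1 s2
    using supp_NF[OF that] rjoin_Node[of "rnf s1" a "rnf s2"] by simp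
  show ?thesis
    using assms leaf node NF
    by (cases "(l, a, r)" rule: nf_merge.cases)
      (fastforce elim!: in_supp_push split: if_splits)+
qed

lemma supp_dif:
  assumes "c \<in> supp (dif J (N l a r))"
  obtains l' where "l' \<in> supp (dif J l)" "c = N l' a r"
    | r' where "r' \<in> supp (dif J r)" "c = N l a r'"
    | "c \<in> supp (J l a r)"
  using assms by (auto dest!: supp_add_cases subsetD[OF supp_scale] elim!: in_supp_push)

text \<open>If the differential contracts \<open>x\<close> to a single top, that top has the root
  label of \<open>x\<close>, a neighbour of \<open>b\<close>. So the homotopy stays in the movable
  case on all terms.\<close>

lemma movable_supp_dif:
  assumes "c \<in> supp (dif nf_merge x)" "root_sat (nbr b) (bottom x)"
  shows "movable b c"
proof (cases x)
  case (N l a r)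
  have "c \<in> supp (dif nf_merge (N l a r))" using assms(1) unfolding N .
  then show ?thesis
  proof (cases rule: supp_dif)
    case 3
    then show ?thesis by (rule supp_nf_merge) (use assms(2) N in auto)
  qed auto
qed (use assms in auto)

lemma root_sat_supp_dif:
  assumes "c \<in> supp (dif nf_merge x)" "root_sat p (bottom x)"
  shows "root_sat p (bottom c)"
proof (cases x)
  case (N l a r)
  have "c \<in> supp (dif nf_merge (N l a r))" using assms(1) unfolding N .
  then show ?thesis
  proof (cases rule: supp_dif)
    case 3
    then show ?thesis by (rule supp_nf_merge) (use assms(2) N in auto)
  qed (use assms N in auto)
qed (use assms in auto)

section \<open>The homotopy identity\<close>

fun nf_valid :: "'a ctree \<Rightarrow> bool" where
  "nf_valid (L s) \<longleftrightarrow> loose s \<and> is_rnf s"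
| "nf_valid (N l a r) \<longleftrightarrow> nf_valid l \<and> nf_valid r \<and> root_sat (nbr a) (bottom l) \<and> root_sat (sim a) (bottom r)"

lemma NF_movable: "movable b (L s1) \<or> movable b (L s2) \<Longrightarrow> NF \<langle>s1, b, s2\<rangle> = 0"
  by (cases s1; cases s2) (auto simp: NF_def)

lemma nf_merge_movable:
  "movable b l \<Longrightarrow> nf_merge l b r = 0"
  by (cases "(l, b, r)" rule: nf_merge.cases) (auto simp: NF_movable simp del: movable.simps)

lemma NF_frozen:
  assumes "frozen b s1" "\<not> movable b (L s2)" "loose s1" "is_rnf s1" "loose s2" "is_rnf s2"
  shows "NF \<langle>s1, b, s2\<rangle> = bas \<langle>s1, b, s2\<rangle>"
proof -
  have "root_sat (\<lambda>a. a \<noteq> b) s1" using assms(1) by (cases s1) auto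
  then show ?thesis using assms by (cases s1; cases s2) (auto simp: NF_def rnf_is_rnf rjoin_eq_Node)
qed

lemma NF_split:
  assumes "loose \<langle>l, b, r\<rangle>" "is_rnf \<langle>l, b, r\<rangle>"
  shows "NF \<langle>\<langle>l, b, r\<rangle>, b, s\<rangle> = push (\<lambda>u. \<langle>l, b, u\<rangle>) (NF \<langle>r, b, s\<rangle>)"
  using assms by (auto simp: NF_def rnf_is_rnf rjoin_eq_Node)

text \<open>The defect of the homotopy: a cut tree without nodes in its bottom whose top has no root
  that \<open>S\<close> allows to be moved.\<close>

definition residue :: "('a \<Rightarrow> bool) \<Rightarrow> 'a ctree \<Rightarrow> ('a ctree \<Rightarrow>\<^sub>0 'k)" where
  "residue S c = (case c of L s \<Rightarrow> if root_sat (\<lambda>a. \<not> S a) s then bas (L s) else 0 | _ \<Rightarrow> 0)"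

lemma residue_movable: "movable b x \<Longrightarrow> residue (nbr b) x = 0"
  by (cases x) (auto simp: residue_def)

lemma residue_not_movable: "\<not> movable b x \<Longrightarrow> residue (nbr b) x = bas x"
  by (cases x) (auto simp: residue_def)

text \<open>A top created by merging at \<open>b\<close> has root label \<open>b\<close>, which
  \<open>nbr b\<close> forbids to move out of the second child.\<close>

lemma homotopy_nf_merge_frozen:
  assumes s: "frozen b s"
  shows "lext (\<lambda>z. homotopy S (N (L s) b z)) (nf_merge (L t) b y) = 0"
proof -
  have "lext (\<lambda>z. homotopy S (N (L s) b z)) (nf_merge (L t) b y) = lext (\<lambda>z. 0 :: _ \<Rightarrow>\<^sub>0 'k) (nf_merge (L t) b y)"
  proof (rule lext_cong[OF refl])
    fix z assume z: "z \<in> supp (nf_merge (L t) b y)"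
    from z show "homotopy S (N (L s) b z) = 0"
      by (rule supp_nf_merge) (simp_all add: s homotopy_frozen_same homotopy_frozen_other)
  qed
  then show ?thesis by simp
qed

abbreviation "nf_dif \<equiv> dif nf_merge"

text \<open>The induction follows the cases of the homotopy. Homotopy and differential at different
  places anticommute and cancel, which leaves the identity for the subtree where the homotopy acts.
  If that subtree contributes a residue, it is compensated by the terms that merge at
  \<open>b\<close> and split again. A split case produces the identity directly.\<close>

theorem contraction_identity:
  assumes "nf_valid c" "root_sat S (bottom c)"
  shows "lext nf_dif (homotopy S c) + lext (homotopy S) (nf_dif c) = bas c - residue S c"
  using assms
proof (induction c arbitrary: S rule: measure_induct_rule[of size])
  case (less c)
  show ?case
  proof (cases c)
    case (L s)
    show ?thesis
    proof (cases s)
      case Leaf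
      then show ?thesis using L by (simp add: residue_def)
    next
      case (Node l b r)
      then have "NF \<langle>l, b, r\<rangle> = bas \<langle>l, b, r\<rangle>"
        using less.prems L by (auto simp: NF_def rnf_is_rnf rjoin_eq_Node)
      then show ?thesis using L Node by (simp add: residue_def)
    qed
  next
    case c: (N x b y)
    have v: "nf_valid x" "nf_valid y" "root_sat (nbr b) (bottom x)" "root_sat (sim b) (bottom y)" "S b"
      using less.prems c by auto
    have res: "residue S c = 0" using c by (simp add: residue_def)
    show ?thesis
    proof (cases "movable b x")
      case True
      let ?h = "homotopy (nbr b) x"
      \<comment> \<open>Homotopy in \<open>x\<close> and differential in \<open>y\<close>. This term
        occurs in \<open>1\<close> and \<open>2\<close> with opposite signs, because the homotopy
        raises \<open>csize x\<close> by one.\<close>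
      let ?X = "lext (\<lambda>x'. push (N x' b) (nf_dif y)) ?h"
      have 1: "lext nf_dif (homotopy S c) = push (\<lambda>z. N z b y) (lext nf_dif ?h) - scale ((- 1) ^ csize x) ?X"
      proof -
        have "lext nf_dif (homotopy S c) = lext (\<lambda>x'. nf_dif (N x' b y)) ?h"
          unfolding c homotopy_movable[OF True] lext_lext lext_bas ..
        also have "\<dots> = lext (\<lambda>x'. push (\<lambda>z. N z b y) (nf_dif x') - scale ((- 1) ^ csize x) (push (N x' b) (nf_dif y))) ?h"
        proof (rule lext_cong[OF refl])
          fix x' assume "x' \<in> supp ?h"
          then have cs: "csize x' = csize x + 1" and "\<exists>u a w. x' = N u a w"
            using supp_homotopy[of x' "nbr b" x] by simp_all
          then have m0: "nf_merge x' b y = 0" by auto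
          show "nf_dif (N x' b y) = push (\<lambda>z. N z b y) (nf_dif x') - scale ((- 1) ^ csize x) (push (N x' b) (nf_dif y))"
            by (subst dif.simps(2)) (simp add: m0 cs)
        qed
        also have "\<dots> = push (\<lambda>z. N z b y) (lext nf_dif ?h) - scale ((- 1) ^ csize x) ?X"
          by (simp add: lext_fun_lin lext_lext)
        finally show ?thesis .
      qed
      have 2: "lext (homotopy S) (nf_dif c) = push (\<lambda>z. N z b y) (lext (homotopy (nbr b)) (nf_dif x)) + scale ((- 1) ^ csize x) ?X"
      proof -
        have a: "lext (\<lambda>z. homotopy S (N z b y)) (nf_dif x) = push (\<lambda>z. N z b y) (lext (homotopy (nbr b)) (nf_dif x))"
          unfolding lext_lext
          by (rule lext_cong[OF refl]) (rule homotopy_movable, erule movable_supp_dif[OF _ v(3)])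
        have "lext (\<lambda>z. homotopy S (N x b z)) (nf_dif y) = ?X"
          unfolding homotopy_movable[OF True] by (rule lext_swap)
        then show ?thesis
          by (simp add: c nf_merge_movable[OF True] lext_lin lext_lext a)
      qed
      have "lext nf_dif ?h + lext (homotopy (nbr b)) (nf_dif x) = bas x"
        using less.IH[of x "nbr b"] c v residue_movable[OF True] by simp
      then have "push (\<lambda>z. N z b y) (lext nf_dif ?h) + push (\<lambda>z. N z b y) (lext (homotopy (nbr b)) (nf_dif x)) = bas c"
        unfolding c by (simp flip: lext_add)
      then show ?thesis unfolding 1 2 res by simp
    next
      case False
      then show ?thesis
      proof (cases rule: not_movable_cases)
        case x: (split l r)
        have s: "loose \<langle>l, b, r\<rangle>" "is_rnf \<langle>l, b, r\<rangle>" using v x by auto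
        then have NFs: "NF \<langle>l, b, r\<rangle> = bas \<langle>l, b, r\<rangle>" by (auto simp: NF_def rnf_is_rnf rjoin_eq_Node)
        \<comment> \<open>After rotation, merging the first child with its right neighbour changes
          only \<open>r\<close>, and the homotopy then splits off the same \<open>l\<close>. The
          \<open>b\<close> at the root may be moved because \<open>S b\<close> holds.\<close>
        have m: "lext (homotopy S) (nf_merge (L \<langle>l, b, r\<rangle>) b y) = push (N (L l) b) (nf_merge (L r) b y)"
        proof -
          consider s2 where "y = L s2" | s2 w where "y = N (L s2) b w" | "\<And>t. nf_merge (L t) b y = 0"
          proof (cases y)
            case (N u a w)
            then show ?thesis using that by (cases u; cases "a = b") auto
          qed (use that in auto)
          then show ?thesis
            using v(5) by cases (simp_all add: NF_split[OF s] lext_lext homotopy_split)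
        qed
        have 1: "lext nf_dif (homotopy S c) = bas c + push (\<lambda>z. N (L l) b (N (L r) b z)) (nf_dif y) - push (N (L l) b) (nf_merge (L r) b y)"
          unfolding c x homotopy_split
          by (simp add: NFs lext_lin lext_lext pm.scale_minus_left)
        have 2: "lext (homotopy S) (nf_dif c) = push (N (L l) b) (nf_merge (L r) b y) - push (\<lambda>z. N (L l) b (N (L r) b z)) (nf_dif y)"
          unfolding c x by (simp add: lext_lin lext_lext homotopy_split m)
        show ?thesis unfolding 1 2 res by simp
      next
        case x: (frozen s)
        have s: "loose s" "is_rnf s" using v x by auto
        show ?thesis
        proof (cases "root_sat (\<lambda>a. a \<noteq> b) (bottom y)")
          case y: True
          then have vy: "root_sat (nbr b) (bottom y)" using v(4) by (cases "bottom y") auto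
          let ?h = "homotopy (nbr b) y"
          have 1: "lext nf_dif (homotopy S c) = push (N (L s) b) (lext nf_dif ?h)"
          proof -
            have "lext nf_dif (homotopy S c) = - lext (\<lambda>y'. nf_dif (N (L s) b y')) ?h"
              unfolding c x homotopy_frozen_other[OF x(2) y] lext_neg lext_lext lext_bas ..
            also have "lext (\<lambda>y'. nf_dif (N (L s) b y')) ?h = lext (\<lambda>y'. - push (N (L s) b) (nf_dif y')) ?h"
            proof (rule lext_cong[OF refl])
              fix y' assume "y' \<in> supp ?h"
              from supp_homotopy[OF this, of "\<lambda>a. a \<noteq> b"] y obtain u a w where "y' = N u a w" "a \<noteq> b" by auto
              then have m0: "nf_merge (L s) b y' = 0" by (cases u) simp_all
              show "nf_dif (N (L s) b y') = - push (N (L s) b) (nf_dif y')"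
                by (subst dif.simps(2)) (simp add: m0)
            qed
            finally show ?thesis by (simp add: lext_fun_lin lext_lext)
          qed
          have a: "lext (\<lambda>z. homotopy S (N (L s) b z)) (nf_dif y) = lext (\<lambda>z. - push (N (L s) b) (homotopy (nbr b) z)) (nf_dif y)"
            by (rule lext_cong[OF refl]) (rule homotopy_frozen_other[OF x(2)], erule root_sat_supp_dif[OF _ y])
          have 2: "lext (homotopy S) (nf_dif c) = push (N (L s) b) (lext (homotopy (nbr b)) (nf_dif y))
              + lext (homotopy S) (nf_merge (L s) b y)"
            unfolding c x by (simp add: lext_lin lext_lext a lext_fun_lin)
          have IH: "lext nf_dif ?h + lext (homotopy (nbr b)) (nf_dif y) = bas y - residue (nbr b) y"
            using less.IH[of y "nbr b"] c v vy by simp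
          have 3: "push (N (L s) b) (lext nf_dif ?h) + push (N (L s) b) (lext (homotopy (nbr b)) (nf_dif y))
              = bas c - push (N (L s) b) (residue (nbr b) y)"
            unfolding lext_add[symmetric] IH c x by (simp add: lext_lin)
          \<comment> \<open>If \<open>y\<close> is movable, the merge vanishes. Otherwise
            \<open>y\<close> is a top, the merged tree is already in normal form, and the homotopy
            splits it again into \<open>s\<close> and \<open>y\<close>.\<close>
          have 4: "lext (homotopy S) (nf_merge (L s) b y) = push (N (L s) b) (residue (nbr b) y)"
          proof (cases "movable b y")
            case True
            have "nf_merge (L s) b y = 0"
            proof (cases y)
              case (L t)
              then show ?thesis using True by (simp add: NF_movable del: movable.simps)
            next
              case (N u a w)
              then show ?thesis using y by (cases u) auto
            qed
            then show ?thesis using residue_movable[OF True] by simp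
          next
            case False
            then obtain t where t: "y = L t" by (cases y) auto
            then have "NF \<langle>s, b, t\<rangle> = bas \<langle>s, b, t\<rangle>"
              using False s x v by (intro NF_frozen) auto
            then show ?thesis using residue_not_movable[OF False] t v(5) by simp
          qed
          show ?thesis unfolding 1 2 res using 3 4 by (simp add: algebra_simps)
        next
          case False
          then obtain z w where y: "y = N z b w" by (cases y) auto
          have vz: "nf_valid z" "nf_valid w" "root_sat (nbr b) (bottom z)" using v y by auto
          let ?h = "homotopy (nbr b) z"
          let ?F = "\<lambda>z. N (L s) b (N z b w)"
          let ?X = "lext (\<lambda>z'. push (\<lambda>u. N (L s) b (N z' b u)) (nf_dif w)) ?h"
          have 1: "lext nf_dif (homotopy S c) = push ?F (lext nf_dif ?h) - scale ((- 1) ^ csize z) ?X"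
          proof -
            have "lext nf_dif (homotopy S c) = - lext (\<lambda>z'. nf_dif (?F z')) ?h"
              unfolding c x y homotopy_frozen_same[OF x(2)] lext_neg lext_lext lext_bas ..
            also have "lext (\<lambda>z'. nf_dif (?F z')) ?h = lext (\<lambda>z'. scale ((- 1) ^ csize z)
                (push (\<lambda>u. N (L s) b (N z' b u)) (nf_dif w)) - push ?F (nf_dif z')) ?h"
            proof (rule lext_cong[OF refl])
              fix z' assume "z' \<in> supp ?h"
              then have cs: "csize z' = csize z + 1" and "\<exists>u a t. z' = N u a t"
                using supp_homotopy[of z' "nbr b" z] by simp_all
              then have m0: "nf_merge z' b w = 0" "nf_merge (L s) b (N z' b w) = 0" by auto
              have "nf_dif (N z' b w) = push (\<lambda>u. N u b w) (nf_dif z') - scale ((- 1) ^ csize z) (push (N z' b) (nf_dif w))"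
                by (subst dif.simps(2)) (simp add: m0 cs)
              moreover have "nf_dif (?F z') = - push (N (L s) b) (nf_dif (N z' b w))"
                by (subst dif.simps(2)) (simp add: m0 del: dif.simps(2))
              ultimately have "nf_dif (?F z') = - push (N (L s) b)
                  (push (\<lambda>u. N u b w) (nf_dif z') - scale ((- 1) ^ csize z) (push (N z' b) (nf_dif w)))"
                by (simp only:)
              then show "nf_dif (?F z') = scale ((- 1) ^ csize z)
                (push (\<lambda>u. N (L s) b (N z' b u)) (nf_dif w)) - push ?F (nf_dif z')"
                unfolding lext_lin lext_lext lext_bas by simp
            qed
            finally show ?thesis by (simp add: lext_fun_lin lext_lext)
          qed
          have 2: "lext (homotopy S) (nf_dif c) = push ?F (lext (homotopy (nbr b)) (nf_dif z)) + scale ((- 1) ^ csize z) ?X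
              - lext (\<lambda>u. homotopy S (N (L s) b u)) (nf_merge z b w) + lext (homotopy S) (nf_merge (L s) b y)"
          proof -
            have "lext (\<lambda>u. homotopy S (N (L s) b (N z b u))) (nf_dif w) = - ?X"
              unfolding homotopy_frozen_same[OF x(2)] lext_fun_neg by (subst lext_swap) simp
            then show ?thesis
              unfolding c x y by (simp add: lext_lin lext_lext
                  homotopy_frozen_same[OF x(2)] lext_fun_lin)
          qed
          have IH: "lext nf_dif ?h + lext (homotopy (nbr b)) (nf_dif z) = bas z - residue (nbr b) z"
            using less.IH[of z "nbr b"] c y v vz by simp
          have 3: "push ?F (lext nf_dif ?h) + push ?F (lext (homotopy (nbr b)) (nf_dif z)) = bas c - push ?F (residue (nbr b) z)"
            unfolding lext_add[symmetric] IH c x y by (simp add: lext_lin)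
          have 4: "lext (\<lambda>u. homotopy S (N (L s) b u)) (nf_merge z b w) = 0"
            using homotopy_nf_merge_frozen[OF x(2)] by (cases z) auto
          have 5: "lext (homotopy S) (nf_merge (L s) b y) = push ?F (residue (nbr b) z)"
          proof (cases "movable b z")
            case True
            have "nf_merge (L s) b y = 0"
              using True y by (cases z) (simp_all add: NF_movable del: movable.simps(1))
            then show ?thesis using residue_movable[OF True] by simp
          next
            case False
            then obtain t where t: "z = L t" by (cases z) auto
            then have "NF \<langle>s, b, t\<rangle> = bas \<langle>s, b, t\<rangle>"
              using False s x vz by (intro NF_frozen) auto
            then show ?thesis using residue_not_movable[OF False] t y by (simp add: homotopy_split)
          qed
          show ?thesis unfolding 1 2 res using 3 4 5 by (simp add: algebra_simps)
        qed
      qed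
    qed
  qed
qed


section \<open>The associative operad of a graph is Koszul\<close>

text \<open>These cut trees index generators of the Koszul chains: the bottoms index a basis of the
  cooperad, while the tops are arbitrary trees not yet reduced modulo the ideal.\<close>

fun cvalid :: "'a ctree \<Rightarrow> bool" where
  "cvalid (L s) \<longleftrightarrow> set_tree s \<subseteq> Q"
| "cvalid (N l a r) \<longleftrightarrow> cvalid l \<and> cvalid r \<and> a \<in> Q \<and> root_sat (nbr a) (bottom l) \<and> root_sat (sim a) (bottom r)"

fun total :: "'a ctree \<Rightarrow> nat" where
  "total (L s) = size1 s"
| "total (N l a r) = total l + total r"

lemma root_sat_conj: "root_sat (\<lambda>a. p a \<and> q a) t \<longleftrightarrow> root_sat p t \<and> root_sat q t"
  by (cases t) auto

lemma cvalid_iff: "cvalid c \<longleftrightarrow> is_rnf (bottom c) \<and> linked (bottom c) \<and> set_tree (bottom c) \<subseteq> Q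
    \<and> (\<forall>s\<in>set (tops c). set_tree s \<subseteq> Q)"
  by (induction c) (auto simp: root_sat_conj)

lemma total_eq: "total c = sum_list (map size1 (tops c))"
  by (induction c) auto

lemma supp_dif_comb_merge:
  assumes "c' \<in> supp (dif comb_merge c)" "cvalid c"
  shows "cvalid c' \<and> csize c' + 1 = csize c \<and> total c' = total c \<and>
    (\<forall>p. root_sat p (bottom c) \<longrightarrow> root_sat p (bottom c'))"
  using assms
proof (induction c arbitrary: c')
  case (N l a r)
  from N.prems(1) show ?case
  proof (cases rule: supp_dif)
    case (1 l')
    then show ?thesis using N.IH(1)[of l'] N.prems(2) by auto
  next
    case (2 r')
    then show ?thesis using N.IH(2)[of r'] N.prems(2) by auto
  next
    case 3
    then show ?thesis using N.prems(2)
      by (cases "(l, a, r)" rule: comb_merge.cases) (auto split: if_splits)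
  qed
qed simp

lemma supp_homotopy_valid:
  assumes "c' \<in> supp (homotopy S c)" "cvalid c" "nf_valid c"
  shows "cvalid c' \<and> nf_valid c' \<and> total c' = total c"
  using assms
proof (induction c arbitrary: S c' rule: measure_induct_rule[of size])
  case (less c)
  show ?case
  proof (cases c)
    case (L s)
    then show ?thesis using less.prems by (cases s) (auto split: if_splits)
  next
    case c: (N x b y)
    show ?thesis
    proof (cases "movable b x")
      case True
      then obtain x' where x': "x' \<in> supp (homotopy (nbr b) x)" "c' = N x' b y"
        using less.prems c by (auto simp: homotopy_movable elim: in_supp_push)
      then have "root_sat (nbr b) (bottom x')"
        using supp_homotopy[OF x'(1), of "nbr b"] less.prems c by simp
      then show ?thesis using less.IH[of x x'] less.prems c x' by simp
    next
      case False
      then show ?thesis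
      proof (cases rule: not_movable_cases)
        case (split l r)
        then show ?thesis using less.prems c by (auto simp: homotopy_split)
      next
        case (frozen s)
        show ?thesis
        proof (cases "root_sat (\<lambda>a. a \<noteq> b) (bottom y)")
          case True
          then obtain y' where y': "y' \<in> supp (homotopy (nbr b) y)" "c' = N (L s) b y'"
            using less.prems c frozen by (auto simp: homotopy_frozen_other elim: in_supp_push)
          then have "root_sat (sim b) (bottom y')"
            using supp_homotopy[OF y'(1), of "sim b"] less.prems c by simp
          then show ?thesis using less.IH[of y y'] less.prems c frozen y' by simp
        next
          case False
          then obtain z w where y: "y = N z b w" by (cases y) auto
          then obtain z' where z': "z' \<in> supp (homotopy (nbr b) z)" "c' = N (L s) b (N z' b w)"
            using less.prems c frozen by (auto simp: homotopy_frozen_same elim: in_supp_push)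
          then have "root_sat (nbr b) (bottom z')"
            using supp_homotopy[OF z'(1), of "nbr b"] less.prems c y by simp
          then show ?thesis using less.IH[of z z'] less.prems c frozen y z' by simp
        qed
      qed
    qed
  qed
qed

section \<open>Normalization of the tops and coordinates of Koszul chains\<close>

abbreviation nfc :: "'a ctree \<Rightarrow> ('a ctree \<Rightarrow>\<^sub>0 'k)" where "nfc \<equiv> ctree_subst bas NF"

lemma supp_nfc:
  assumes "c' \<in> supp (nfc c)"
  shows "bottom c' = bottom c \<and> total c' = total c \<and> (cvalid c \<longrightarrow> cvalid c' \<and> nf_valid c')"
  using assms
proof (induction c arbitrary: c')
  case (L s)
  then show ?case by (auto elim!: in_supp_push dest!: supp_NF)
next
  case (N l a r)
  then obtain l' r' where "l' \<in> supp (nfc l)" "r' \<in> supp (nfc r)" "c' = N l' a r'"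
    by (auto elim!: in_supp_lext)
  then show ?case using N.IH by auto
qed

lemma nfc_nf_valid: "nf_valid c \<Longrightarrow> nfc c = bas c"
  by (induction c) (auto simp: NF_def rnf_is_rnf)

lemma nfc_comb_merge:
  "lext nfc (comb_merge l a r) = lext (\<lambda>l'. lext (\<lambda>b.
    lext (\<lambda>r'. nf_merge l' b r') (nfc r)) (bas a)) (nfc l)"
proof -
  \<comment> \<open>The content of the lemma: the normal form of a node is determined by the normal
    forms of its subtrees. The rest matches the cases in which both merges vanish.\<close>
  have NFN: "lext (\<lambda>u. lext (\<lambda>v. NF \<langle>u, a, v\<rangle>) (NF s2)) (NF s1) = NF \<langle>s1, a, s2\<rangle>" for s1 s2
    by (auto simp: NF_def rnf_is_rnf)
  have NFL: "lext (\<lambda>u. lext (\<lambda>v. lext f (NF \<langle>u, a, v\<rangle>)) (NF s2)) (NF s1)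
      = lext f (NF \<langle>s1, a, s2\<rangle>)" for f :: "'a tree \<Rightarrow> ('a ctree \<Rightarrow>\<^sub>0 'k)" and s1 s2
    using arg_cong[OF NFN[of s2 s1], of "lext f"] by (simp only: lext_lext)
  have z: "lext (\<lambda>l'. lext (\<lambda>r'. nf_merge l' a r') (nfc r)) (nfc l) = 0"
    if "\<And>l' r'. l' \<in> supp (nfc l) \<Longrightarrow> r' \<in> supp (nfc r) \<Longrightarrow> nf_merge l' a r' = 0"
  proof -
    have "lext (\<lambda>l'. lext (\<lambda>r'. nf_merge l' a r') (nfc r)) (nfc l)
       = lext (\<lambda>l'. lext (\<lambda>r'. 0 :: 'a ctree \<Rightarrow>\<^sub>0 'k) (nfc r)) (nfc l)"
      by (intro lext_cong refl that)
    then show ?thesis by simp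
  qed
  consider (1) s1 s2 where "l = L s1" "r = L s2" | (2) s1 s2 b w where "l = L s1" "r = N (L s2) b w"
    | (3) l1 b l2 where "l = N l1 b l2" | (4) r1 c r2 b r3 where "r = N (N r1 c r2) b r3"
    by (cases l; cases r) (metis ctree.exhaust)+
  then show ?thesis
  proof cases
    case (1 s1 s2)
    then show ?thesis by (simp add: lext_lext NFL)
  next
    case (2 s1 s2 b w)
    show ?thesis
    proof (cases "a = b")
      case True
      have "lext (\<lambda>u. lext (\<lambda>v. lext (\<lambda>w'. push (\<lambda>s. N (L s) a w') (NF \<langle>u, a, v\<rangle>)) (nfc w)) (NF s2)) (NF s1)
          = lext (\<lambda>u. lext (\<lambda>v. lext (\<lambda>s. push (N (L s) a) (nfc w)) (NF \<langle>u, a, v\<rangle>)) (NF s2)) (NF s1)"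
        by (subst lext_swap) (rule refl)
      also have "\<dots> = lext (\<lambda>s. push (N (L s) a) (nfc w)) (NF \<langle>s1, a, s2\<rangle>)"
        by (rule NFL)
      finally show ?thesis using 2 True[symmetric] by (simp add: lext_lext)
    next
      case False
      then show ?thesis using 2 by (simp add: lext_lext)
    qed
  next
    case (3 l1 b l2)
    then have "lext (\<lambda>l'. lext (\<lambda>r'. nf_merge l' a r') (nfc r)) (nfc l) = 0"
      by (intro z) (auto elim!: in_supp_lext)
    then show ?thesis using 3 by simp
  next
    case (4 r1 c r2 b r3)
    have "nf_merge l' a (N (N u c v) b w) = 0" for l' u c v b w
      by (cases l') simp_all
    then have "lext (\<lambda>l'. lext (\<lambda>r'. nf_merge l' a r') (nfc r)) (nfc l) = 0"
      using 4 by (intro z) (auto elim!: in_supp_lext)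
    moreover have "comb_merge l a r = 0" using 4 by (cases l) simp_all
    ultimately show ?thesis by simp
  qed
qed

lemma nf_dif_nfc: "lext nf_dif (nfc c) = lext nfc (dif comb_merge c)"
  by (rule dif_ctree_subst) (rule nfc_comb_merge)

text \<open>The coordinates of a chain modulo null chains: a rotation class is detected at its
  unique tree in normal form, and the tops are reduced modulo the ideal.\<close>

definition coord :: "('a tree \<times> 'a tree list \<Rightarrow>\<^sub>0 'k) \<Rightarrow> ('a ctree \<Rightarrow>\<^sub>0 'k)" where
  "coord z = lext (\<lambda>(t, ss). if is_rnf t then bas (build t ss) else 0)
     (lext (\<lambda>(t, ss). tensor (bas t) (map NF ss)) z)"

lemma coord_lext: "coord (lext f x) = lext (\<lambda>p. coord (f p)) x"
  by (simp add: coord_def lext_lext)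

lemma coord_tensor:
  fixes fs :: "('a tree \<Rightarrow>\<^sub>0 'k) list"
  shows "coord (tensor q fs) = lext (\<lambda>(t, ss). if is_rnf t then bas (build t ss) else 0)
     (tensor q (map (lext NF) fs))"
  unfolding coord_def lext_tensor by simp

lemma coord_lin: "coord x = lext (\<lambda>p. coord (bas p)) x"
  by (simp add: coord_def lext_lext)

lemma tree_subst_bas: "tree_subst bas t = bas t"
  by (induction t) auto

lemma tensor_NF_tops: "tensor (bas (bottom c)) (map NF (tops c)) = push cpair (nfc c)"
  by (simp add: push_cpair_ctree_subst tree_subst_bas)

lemma rot_chain_bas: "rot_chain (bas (t, ss)) = tensor (rot_sum t) (map bas ss)"
  by (simp add: rot_chain_def)

text \<open>Of all trees in the rotation class of the bottom, only the bottom itself survives the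
  test \<open>is_rnf\<close>.\<close>

lemma coord_rot_chain:
  assumes "is_rnf (bottom c)"
  shows "coord (rot_chain (bas (cpair c))) = nfc c"
proof -
  let ?t = "bottom c" and ?g = "\<lambda>(t, ss). if is_rnf t then bas (build t ss) else 0 :: _ \<Rightarrow>\<^sub>0 'k"
  let ?T = "tensor_list (map NF (tops c))"
  have "coord (rot_chain (bas (cpair c))) = lext ?g (tensor (rot_sum ?t) (map NF (tops c)))"
    by (simp add: cpair_def[of c] rot_chain_bas coord_tensor comp_def)
  also have "\<dots> = (\<Sum>T | rnf T = ?t. lext ?g (push (Pair T) ?T))"
    by (simp add: tensor_eq rot_sum_def lext_sum)
  also have "\<dots> = (\<Sum>T | rnf T = ?t. if T = ?t then lext ?g (push (Pair ?t) ?T) else 0)"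
  proof (intro sum.cong refl)
    fix T assume "T \<in> {T. rnf T = ?t}"
    then have "is_rnf T \<longleftrightarrow> T = ?t" using assms rnf_is_rnf[of T] by auto
    then show "lext ?g (push (Pair T) ?T) = (if T = ?t then lext ?g (push (Pair ?t) ?T) else 0)"
      by (simp add: lext_lext assms)
  qed
  also have "\<dots> = lext ?g (push (Pair ?t) ?T)"
    using finite_rnf[of ?t] rnf_is_rnf[OF assms] by simp
  also have "push (Pair ?t) ?T = push cpair (nfc c)"
    unfolding tensor_NF_tops[symmetric] by (simp add: tensor_eq)
  also have "lext ?g (push cpair (nfc c)) = lext bas (nfc c)"
    unfolding lext_lext lext_bas
    using assms supp_nfc by (intro lext_cong refl) (fastforce simp: cpair_def)
  finally show ?thesis by simp
qed

definition rot_basis :: "nat \<Rightarrow> nat \<Rightarrow> ('a tree \<times> 'a tree list \<Rightarrow>\<^sub>0 'k) set" where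
  "rot_basis n k = {rot_chain (bas (cpair c)) | c. cvalid c \<and> csize c = k \<and> total c = n}"

lemma rot_chain_in_chains:
  assumes "cvalid c"
  shows "rot_chain (bas (cpair c)) \<in> koszul_chains Gr (total c) (csize c)"
proof -
  have "rot_sum (bottom c) \<in> koszul_dual_cooperad Gr (csize c)"
    using assms by (intro rot_sum_in_cooperad) (auto simp: cvalid_iff)
  moreover have "list_all2 (\<lambda>i f. f \<in> free_operad Q i) (map size1 (tops c)) (map (bas :: _ \<Rightarrow> _ \<Rightarrow>\<^sub>0 'k) (tops c))"
    using assms by (auto simp: cvalid_iff list_all2_conv_all_nth)
  ultimately show ?thesis
    unfolding koszul_chains_def cpair_def rot_chain_bas total_eq
    by (intro pm.span_base CollectI exI[of _ "rot_sum (bottom c)"] exI[of _ "map bas (tops c)"]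
        exI[of _ "map size1 (tops c)"]) simp
qed

lemma span_rot_basis_subset: "pm.span (rot_basis n k) \<subseteq> koszul_chains Gr n k"
proof -
  have "rot_basis n k \<subseteq> koszul_chains Gr n k"
    using rot_chain_in_chains by (auto simp: rot_basis_def)
  then show ?thesis unfolding koszul_chains_def by (intro pm.span_minimal pm.subspace_span)
qed

text \<open>The cooperad factor is expanded over rotation classes, and the operad factors over
  trees.\<close>

lemma koszul_chains_subset: "koszul_chains Gr n k \<subseteq> pm.span (rot_basis n k)"
  unfolding koszul_chains_def
proof (intro pm.span_minimal pm.subspace_span, safe)
  fix q :: "'a tree \<Rightarrow>\<^sub>0 'k" and fs :: "('a tree \<Rightarrow>\<^sub>0 'k) list" and ns
  assume q: "q \<in> koszul_dual_cooperad Gr (length ns)" and k: "k = length ns" and n: "n = sum_list ns"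
    and fs: "list_all2 (\<lambda>i f. f \<in> free_operad (gens Gr) i) ns fs"
  have "tensor q fs = lext (\<lambda>(t, ss). tensor (if is_rnf t then rot_sum t else 0) (map bas ss)) (tensor q fs)"
    unfolding lext_tensor cooperad_expansion[OF q] by (simp add: map_idI)
  also have "\<dots> \<in> pm.span (rot_basis (sum_list ns) (length ns))"
  proof (intro lext_in_span, clarify)
    fix t ss assume "(t, ss) \<in> supp (tensor q fs)"
    then have t: "t \<in> supp q" and ss: "list_all2 (\<lambda>s f. s \<in> supp f) ss fs"
      by (auto simp: tensor_eq elim!: in_supp_lext dest: supp_tensor_list)
    have t': "set_tree t \<subseteq> Q" "size1 t = length ns"
      using t q by (auto simp: koszul_dual_cooperad_def free_operad_iff)
    have linked: "linked t" using t cooperad_coef(2)[OF q, of t] by (auto simp: in_keys_iff)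
    have len: "length ss = length ns" "length fs = length ns"
      using list_all2_lengthD[OF ss] list_all2_lengthD[OF fs] by simp_all
    have nth: "set_tree (ss ! j) \<subseteq> Q \<and> size1 (ss ! j) = ns ! j" if "j < length ns" for j
      using that ss fs len by (auto simp: list_all2_conv_all_nth free_operad_iff)
    then have ss': "map size1 ss = ns" "\<forall>s\<in>set ss. set_tree s \<subseteq> Q"
      using len nth by (auto intro!: nth_equalityI simp: in_set_conv_nth subset_iff)
    define c where "c = build t ss"
    have c: "cpair c = (t, ss)" using cpair_build[of ss t] len t' by (simp add: c_def)
    show "tensor (if is_rnf t then rot_sum t else 0) (map bas ss) \<in> pm.span (rot_basis (sum_list ns) (length ns))"
    proof (cases "is_rnf t")
      case True
      then have "cvalid c" "csize c = length ns" "total c = sum_list ns"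
        using c t' ss' linked by (auto simp: cvalid_iff total_eq cpair_def)
      then have "rot_chain (bas (cpair c)) \<in> rot_basis (sum_list ns) (length ns)"
        unfolding rot_basis_def by blast
      then show ?thesis using True by (simp add: c rot_chain_bas pm.span_base)
    qed (simp add: tensor_eq pm.span_zero)
  qed
  finally show "tensor q fs \<in> pm.span (rot_basis (sum_list ns) (length ns))" .
qed

lemma koszul_differential_lext:
  "koszul_differential (lext f x) = lext (\<lambda>p. koszul_differential (f p)) x"
  by (simp add: koszul_differential_def lext_lext)

lemma rot_chain_lin: "rot_chain x = lext (\<lambda>p. rot_chain (bas p)) x"
  by (simp add: rot_chain_def)

lemma coord_koszul_differential:
  assumes "z \<in> koszul_chains Gr n k"
  shows "coord (koszul_differential z) = lext nf_dif (coord z)"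
proof -
  have "lext (\<lambda>p. coord (koszul_differential (bas p))) z = lext (\<lambda>p. lext nf_dif (coord (bas p))) z"
  proof (rule lext_eq_on_span[OF subsetD[OF koszul_chains_subset assms]])
    fix x assume "x \<in> rot_basis n k"
    then obtain c where c: "x = rot_chain (bas (cpair c))" "cvalid c" by (auto simp: rot_basis_def)
    then have is_rnf: "is_rnf (bottom c)" by (simp add: cvalid_iff)
    have "coord (koszul_differential x) = lext (\<lambda>c'. coord (rot_chain (bas (cpair c')))) (dif comb_merge c)"
      unfolding c koszul_differential_rot_chain[OF is_rnf]
      by (subst rot_chain_lin, subst coord_lin)
        (simp add: lext_lext coord_lin[of "rot_chain _"])
    also have "\<dots> = lext nfc (dif comb_merge c)"
      using supp_dif_comb_merge[OF _ c(2)] by (intro lext_cong refl coord_rot_chain) (auto simp: cvalid_iff)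
    also have "\<dots> = lext nf_dif (coord x)"
      unfolding c coord_rot_chain[OF is_rnf] nf_dif_nfc ..
    finally show "lext (\<lambda>p. coord (koszul_differential (bas p))) x = lext (\<lambda>p. lext nf_dif (coord (bas p))) x"
      by (simp add: coord_def koszul_differential_def lext_lext)
  qed
  then show ?thesis
    by (simp add: coord_def koszul_differential_def lext_lext)
qed

text \<open>One operad factor of every generating null chain is killed by \<open>NF\<close>.\<close>

lemma coord_null:
  assumes "z \<in> koszul_null_chains Gr n k"
  shows "coord z = 0"
proof -
  have "lext (\<lambda>p. coord (bas p)) z = lext (\<lambda>p. 0) z"
  proof (rule lext_eq_on_span[OF assms[unfolded koszul_null_chains_def]], safe)
    fix q :: "'a tree \<Rightarrow>\<^sub>0 'k" and fs :: "('a tree \<Rightarrow>\<^sub>0 'k) list" and ns j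
    assume h: "list_all2 (\<lambda>i f. f \<in> free_operad (gens Gr) i) ns fs" "j < length ns"
      "fs ! j \<in> operad_ideal Gr (ns ! j)"
    have "length fs = length ns" using h(1) by (auto dest: list_all2_lengthD)
    then have "0 \<in> set (map (lext NF) fs)"
      using NF_ideal[OF h(3)] h(2) by (metis length_map nth_map nth_mem)
    then have "coord (tensor q fs) = 0"
      unfolding coord_tensor by (simp add: tensor_eq tensor_list_zero)
    then show "lext (\<lambda>p. coord (bas p)) (tensor q fs) = lext (\<lambda>p. 0) (tensor q fs)"
      by (simp flip: coord_lin)
  qed
  then show ?thesis by (simp flip: coord_lin)
qed

lemma tensor_list_append_Cons_diff:
  "tensor q (us @ f # vs) - tensor q (us @ g # vs) = tensor q (us @ (f - g) # vs)"
  by (simp add: tensor_eq tensor_list_append tensor_list_Cons lext_lext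
      lext_diff lext_fun_diff del: tensor_list.simps(2))

lemma tensor_diff_null:
  assumes q: "q \<in> koszul_dual_cooperad P k" and k: "length ns = k" "sum_list ns = n"
    and fs: "list_all2 (\<lambda>i f. f \<in> free_operad (gens P) i) ns fs"
    and gs: "list_all2 (\<lambda>i f. f \<in> free_operad (gens P) i) ns gs"
    and d: "\<And>j. j < k \<Longrightarrow> fs ! j - gs ! j \<in> operad_ideal P (ns ! j)"
  shows "tensor q fs - tensor q gs \<in> koszul_null_chains P n k"
proof -
  have len: "length fs = k" "length gs = k" using fs gs k by (auto dest: list_all2_lengthD)
  \<comment> \<open>The factors are exchanged one at a time, and the differences telescope.\<close>
  define h where "h j = take j gs @ drop j fs" for j
  have "(\<Sum>j<k. tensor q (h j) - tensor q (h (Suc j))) = tensor q (h 0) - tensor q (h k)"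
    by (rule sum_lessThan_telescope')
  moreover have "h 0 = fs" "h k = gs" by (simp_all add: h_def len)
  ultimately have "tensor q fs - tensor q gs = (\<Sum>j<k. tensor q (h j) - tensor q (h (Suc j)))" by simp
  also have "\<dots> \<in> koszul_null_chains P n k"
    unfolding koszul_null_chains_def
  proof (intro pm.span_sum)
    fix j assume "j \<in> {..<k}"
    then have j: "j < k" by simp
    let ?x = "take j gs @ (fs ! j - gs ! j) # drop (Suc j) fs"
    have "tensor q (h j) - tensor q (h (Suc j)) = tensor q ?x"
      using j len by (simp add: h_def take_Suc_conv_app_nth flip: Cons_nth_drop_Suc tensor_list_append_Cons_diff)
    moreover have "list_all2 (\<lambda>i f. f \<in> free_operad (gens P) i) ns ?x"
      unfolding list_all2_conv_all_nth
    proof (intro conjI allI impI)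
      fix i assume i: "i < length ns"
      have "fs ! i \<in> free_operad (gens P) (ns ! i)" "gs ! i \<in> free_operad (gens P) (ns ! i)"
        using i fs gs by (auto simp: list_all2_conv_all_nth)
      then show "?x ! i \<in> free_operad (gens P) (ns ! i)"
        using i k len j pm.subspace_diff[OF subspace_free_operad]
        by (auto simp: nth_append nth_Cons' Suc_diff_Suc)
    qed (use j k len in auto)
    moreover have "?x ! j \<in> operad_ideal P (ns ! j)"
      using d[OF j] j len by (simp add: nth_append)
    ultimately show "tensor q (h j) - tensor q (h (Suc j)) \<in> pm.span {tensor q fs | q fs ns.
       q \<in> koszul_dual_cooperad P k \<and> length ns = k \<and> sum_list ns = n \<and>
       list_all2 (\<lambda>i f. f \<in> free_operad (gens P) i) ns fs \<and> (\<exists>j<k. fs ! j \<in> operad_ideal P (ns ! j))}"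
      using q k j by (intro pm.span_base CollectI exI[of _ q] exI[of _ ?x] exI[of _ ns]) auto
  qed
  finally show ?thesis .
qed

text \<open>On a rotation basis chain, this round trip only replaces the tops by their normal forms,
  which changes them by elements of the ideal. Hence \<open>coord\<close> determines a chain up to
  null chains.\<close>

lemma rot_chain_coord:
  assumes "z \<in> koszul_chains Gr n k"
  shows "z - rot_chain (push cpair (coord z)) \<in> koszul_null_chains Gr n k"
proof -
  have "lext (\<lambda>p. bas p - rot_chain (push cpair (coord (bas p)))) z \<in> koszul_null_chains Gr n k"
    unfolding koszul_null_chains_def
  proof (rule lext_maps_span[OF subsetD[OF koszul_chains_subset assms]], fold koszul_null_chains_def)
    fix x assume "x \<in> rot_basis n k"
    then obtain c where c: "x = rot_chain (bas (cpair c))" "cvalid c" "csize c = k" "total c = n"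
      by (auto simp: rot_basis_def)
    let ?t = "bottom c" and ?ss = "tops c"
    have "rot_chain (push cpair (coord x)) = rot_chain (tensor (bas ?t) (map NF ?ss))"
      using c by (simp add: coord_rot_chain cvalid_iff tensor_NF_tops)
    also have "\<dots> = tensor (rot_sum ?t) (map NF ?ss)"
      unfolding rot_chain_def lext_tensor by (simp add: comp_def)
    finally have "x - rot_chain (push cpair (coord x)) = tensor (rot_sum ?t) (map bas ?ss) - tensor (rot_sum ?t) (map NF ?ss)"
      by (simp add: c cpair_def rot_chain_bas)
    also have "\<dots> \<in> koszul_null_chains Gr n k"
    proof (rule tensor_diff_null[where ns = "map size1 ?ss"])
      show "rot_sum ?t \<in> koszul_dual_cooperad Gr k"
        using c rot_sum_in_cooperad[of ?t] by (auto simp: cvalid_iff)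
      show "list_all2 (\<lambda>i f. f \<in> free_operad (gens Gr) i) (map size1 ?ss) (map bas ?ss)"
        using c by (auto simp: cvalid_iff list_all2_conv_all_nth)
      have "NF s \<in> free_operad Q (size1 s)" if "set_tree s \<subseteq> Q" for s
        using that by (auto simp: free_operad_iff dest!: supp_NF)
      then show "list_all2 (\<lambda>i f. f \<in> free_operad (gens Gr) i) (map size1 ?ss) (map NF ?ss)"
        using c by (auto simp: cvalid_iff list_all2_conv_all_nth)
      show "map bas ?ss ! j - map NF ?ss ! j \<in> operad_ideal Gr (map size1 ?ss ! j)" if "j < k" for j
        using that c ideal_NF[of "?ss ! j"] by (auto simp: cvalid_iff)
    qed (use c in \<open>auto simp: total_eq\<close>)
    finally show "lext (\<lambda>p. bas p - rot_chain (push cpair (coord (bas p)))) x \<in> koszul_null_chains Gr n k"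
      by (simp add: coord_def rot_chain_def lext_lext lext_fun_diff)
  qed
  then show ?thesis
    by (simp add: coord_def rot_chain_def lext_lext lext_fun_diff)
qed

lemma supp_coord:
  assumes "z \<in> koszul_chains Gr n k" "c \<in> supp (coord z)"
  shows "cvalid c \<and> nf_valid c \<and> csize c = k \<and> total c = n"
proof -
  let ?C = "{c. cvalid c \<and> nf_valid c \<and> csize c = k \<and> total c = n}"
  have "lext (\<lambda>p. coord (bas p)) z \<in> pm.span (bas ` ?C)"
  proof (rule lext_maps_span[OF subsetD[OF koszul_chains_subset assms(1)]])
    fix x assume "x \<in> rot_basis n k"
    then obtain c where c: "x = rot_chain (bas (cpair c))" "cvalid c" "csize c = k" "total c = n"
      by (auto simp: rot_basis_def)
    then have "coord x = lext bas (nfc c)" by (simp add: coord_rot_chain cvalid_iff)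
    also have "\<dots> \<in> pm.span (bas ` ?C)"
      using supp_nfc[of _ c] c by (intro lext_in_span pm.span_base imageI) auto
    finally show "lext (\<lambda>p. coord (bas p)) x \<in> pm.span (bas ` ?C)" by (simp flip: coord_lin)
  qed
  moreover have "pm.span (bas ` ?C) \<subseteq> {x :: 'a ctree \<Rightarrow>\<^sub>0 'k. supp x \<subseteq> ?C}"
  proof (rule pm.span_minimal)
    show "pm.subspace {x :: 'a ctree \<Rightarrow>\<^sub>0 'k. supp x \<subseteq> ?C}"
      unfolding pm.subspace_def by (auto dest!: supp_add_cases subsetD[OF supp_scale])
  qed auto
  ultimately have "supp (coord z) \<subseteq> ?C" by (subst coord_lin) blast
  then show ?thesis using assms(2) by auto
qed

text \<open>The coordinates of \<open>z\<close> form a cycle for \<open>nf_dif\<close>, and the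
  homotopy bounds it. The resulting chain \<open>w\<close> has a differential with the same
  coordinates as \<open>z\<close>, which is enough modulo null chains.\<close>

theorem koszul_Gr: "koszul Gr"
  unfolding koszul_def
proof (intro allI impI ballI)
  fix n k and z :: "'a tree \<times> 'a tree list \<Rightarrow>\<^sub>0 'k"
  assume n: "2 \<le> n" and z: "z \<in> koszul_chains Gr n k"
    and dz: "koszul_differential z \<in> koszul_null_chains Gr n (k - 1)"
  let ?S = "\<lambda>_ :: 'a. True"
  let ?h = "lext (homotopy ?S) (coord z)"
  define w where "w = rot_chain (push cpair ?h)"
  have dc: "lext nf_dif (coord z) = 0"
    using coord_koszul_differential[OF z] coord_null[OF dz] by simp
  have "lext nf_dif ?h + lext (homotopy ?S) (lext nf_dif (coord z)) =
      lext (\<lambda>c. lext nf_dif (homotopy ?S c) + lext (homotopy ?S) (nf_dif c)) (coord z)"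
    by (simp add: lext_lext lext_fun_add)
  also have "\<dots> = lext bas (coord z)"
  proof (rule lext_cong[OF refl])
    fix c assume "c \<in> supp (coord z)"
    from supp_coord[OF z this] have c: "nf_valid c" "total c = n" by auto
    have "root_sat ?S (bottom c)" by (cases "bottom c") auto
    \<comment> \<open>Without restriction on labels, only the cut tree \<open>L Leaf\<close> has a
      residue. It has arity 1 and is excluded by \<open>n\<close>.\<close>
    moreover have "residue ?S c = 0"
    proof (cases c)
      case (L s)
      then show ?thesis using c n by (cases s) (auto simp: residue_def)
    qed (simp add: residue_def)
    ultimately show "lext nf_dif (homotopy ?S c) + lext (homotopy ?S) (nf_dif c) = bas c"
      using contraction_identity[OF c(1), of ?S] by simp
  qed
  finally have h: "lext nf_dif ?h = coord z" by (simp add: dc)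
  have supp_h: "cvalid c \<and> nf_valid c \<and> csize c = k + 1 \<and> total c = n" if c: "c \<in> supp ?h" for c
  proof -
    obtain b where b: "b \<in> supp (coord z)" "c \<in> supp (homotopy ?S b)" using c by (rule in_supp_lext)
    then show ?thesis using supp_coord[OF z b(1)] supp_homotopy_valid[OF b(2)] supp_homotopy[OF b(2)] by simp
  qed
  have w_eq: "w = lext (\<lambda>c. rot_chain (bas (cpair c))) ?h"
    unfolding w_def by (subst rot_chain_lin) (simp add: lext_lext)
  have w: "w \<in> koszul_chains Gr n (k + 1)"
    unfolding w_eq
  proof (rule subsetD[OF span_rot_basis_subset], rule lext_in_span)
    fix c assume "c \<in> supp ?h"
    from supp_h[OF this] show "rot_chain (bas (cpair c)) \<in> pm.span (rot_basis n (k + 1))"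
      by (intro pm.span_base) (auto simp: rot_basis_def)
  qed
  have coord_w: "coord w = ?h"
  proof -
    have "coord w = lext (\<lambda>c. coord (rot_chain (bas (cpair c)))) ?h"
      unfolding w_eq by (rule coord_lext)
    also have "\<dots> = lext bas ?h"
      using supp_h by (intro lext_cong refl) (simp add: coord_rot_chain nfc_nf_valid cvalid_iff)
    finally show ?thesis by simp
  qed
  \<comment> \<open>\<open>rot_chain_coord\<close> applies to chains only, so the differential of
    \<open>w\<close> has to be recognized as one.\<close>
  have dw: "koszul_differential w \<in> koszul_chains Gr n k"
  proof -
    have "koszul_differential w = lext (\<lambda>c. rot_chain (push cpair (dif comb_merge c))) ?h"
      unfolding w_eq koszul_differential_lext
      using supp_h by (intro lext_cong refl koszul_differential_rot_chain) (simp add: cvalid_iff)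
    also have "\<dots> \<in> pm.span (rot_basis n k)"
    proof (rule lext_in_span)
      fix c assume "c \<in> supp ?h"
      note c = supp_h[OF this]
      have "rot_chain (push cpair (dif comb_merge c)) = lext (\<lambda>c. rot_chain (bas (cpair c))) (dif comb_merge c)"
        by (subst rot_chain_lin) (simp add: lext_lext)
      also have "\<dots> \<in> pm.span (rot_basis n k)"
      proof (rule lext_in_span)
        fix c' assume "c' \<in> supp (dif comb_merge c)"
        from supp_dif_comb_merge[OF this] c show "rot_chain (bas (cpair c')) \<in> pm.span (rot_basis n k)"
          by (intro pm.span_base) (auto simp: rot_basis_def)
      qed
      finally show "rot_chain (push cpair (dif comb_merge c)) \<in> pm.span (rot_basis n k)" .
    qed
    finally show ?thesis using span_rot_basis_subset by blast
  qed
  have "coord (koszul_differential w) = coord z"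
    using coord_koszul_differential[OF w] coord_w h by simp
  then have dw': "koszul_differential w - rot_chain (push cpair (coord z)) \<in> koszul_null_chains Gr n k"
    using rot_chain_coord[OF dw] by simp
  have "pm.subspace (koszul_null_chains Gr n k)"
    unfolding koszul_null_chains_def by (rule pm.subspace_span)
  from pm.subspace_diff[OF this rot_chain_coord[OF z] dw']
  have "(z - rot_chain (push cpair (coord z))) - (koszul_differential w - rot_chain (push cpair (coord z)))
      \<in> koszul_null_chains Gr n k" .
  then have "z - koszul_differential w \<in> koszul_null_chains Gr n k" by simp
  with w show "\<exists>w\<in>koszul_chains Gr n (k + 1). z - koszul_differential w \<in> koszul_null_chains Gr n k"
    by blast
qed

end

section \<open>The change of generators for a forest poset\<close>

locale forest =
  fixes Q :: "'a set" and le :: "('a \<times> 'a) set" and K :: "'k::field itself"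
  assumes finite_Q: "finite Q" and forest: "forest_poset Q le"
begin

abbreviation cmp :: "'a \<Rightarrow> 'a \<Rightarrow> bool" where "cmp \<equiv> comparable le"
abbreviation mn :: "'a \<Rightarrow> 'a \<Rightarrow> 'a" where "mn \<equiv> poset_min le"
abbreviation AsQ :: "('a, 'k) presentation" where "AsQ \<equiv> As Q le"

text \<open>Equality is added because comparability is reflexive on \<open>Q\<close> only, whereas
  \<open>sim\<close> has to be reflexive everywhere.\<close>

sublocale graph_operad Q "\<lambda>a b. a = b \<or> cmp a b" K
  by unfold_locales (use finite_Q in auto)

lemma le_Q: "(a, b) \<in> le \<Longrightarrow> a \<in> Q \<and> b \<in> Q"
  and le_refl: "a \<in> Q \<Longrightarrow> (a, a) \<in> le"
  and le_trans: "(a, b) \<in> le \<Longrightarrow> (b, c) \<in> le \<Longrightarrow> (a, c) \<in> le"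
  and le_antisym: "(a, b) \<in> le \<Longrightarrow> (b, a) \<in> le \<Longrightarrow> a = b"
  using forest unfolding forest_poset_def partial_order_on_def preorder_on_def
  by (auto dest: refl_onD transD antisymD)

text \<open>The form in which the forest condition is used: principal down-sets are chains.\<close>

lemma cmp_below: "(a, c) \<in> le \<Longrightarrow> (b, c) \<in> le \<Longrightarrow> cmp a b"
  using forest le_Q unfolding forest_poset_def comparable_def by blast

lemma cmp_refl: "a \<in> Q \<Longrightarrow> cmp a a"
  by (simp add: comparable_def le_refl)

lemma mn_le1: "(a, b) \<in> le \<Longrightarrow> mn a b = a"
  by (simp add: poset_min_def)

lemma mn_le2: "(b, a) \<in> le \<Longrightarrow> mn a b = b"
  by (auto simp: poset_min_def intro: le_antisym)

lemma mn_self: "mn a a = a"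
  by (simp add: poset_min_def)

section \<open>Down-sets, heights and lower covers\<close>

definition down_set :: "'a \<Rightarrow> 'a set" where "down_set a = {b. (b, a) \<in> le}"

text \<open>A strictly increasing rank: it selects lower covers, drives the inductions, and
  decreases under rewriting.\<close>

definition height :: "'a \<Rightarrow> nat" where "height a = card (down_set a)"

lemma finite_down_set [simp]: "finite (down_set a)"
  by (rule finite_subset[OF _ finite_Q]) (auto simp: down_set_def dest: le_Q)

lemma down_set_mono: "(a, b) \<in> le \<Longrightarrow> down_set a \<subseteq> down_set b"
  by (auto simp: down_set_def intro: le_trans)

lemma height_mono: "(a, b) \<in> le \<Longrightarrow> height a \<le> height b"
  unfolding height_def by (intro card_mono down_set_mono) simp

lemma height_eq: "(a, b) \<in> le \<Longrightarrow> height a = height b \<Longrightarrow> a = b"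
proof (rule le_antisym)
  assume ab: "(a, b) \<in> le" "height a = height b"
  then have "down_set a = down_set b"
    unfolding height_def by (intro card_subset_eq down_set_mono) simp_all
  then show "(b, a) \<in> le" using ab le_Q[of a b] le_refl[of b] by (auto simp: down_set_def)
qed

text \<open>Stronger than covering in a general poset: \<open>p\<close> is the greatest element
  strictly below \<open>a\<close>.\<close>

definition is_cover :: "'a \<Rightarrow> 'a \<Rightarrow> bool" where
  "is_cover a p \<longleftrightarrow> down_set a - {a} = down_set p"

text \<open>The elements strictly below \<open>a\<close> form a finite chain, so one of maximal
  height is above all the others.\<close>

lemma cover_exists:
  assumes "down_set a - {a} \<noteq> {}"
  shows "\<exists>p. is_cover a p"
proof -
  let ?D = "down_set a - {a}"
  have "Max (height ` ?D) \<in> height ` ?D" using assms by (intro Max_in) auto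
  then obtain p where p: "p \<in> ?D" "height p = Max (height ` ?D)" by (metis imageE)
  have "(b, p) \<in> le" if b: "b \<in> ?D" for b
  proof -
    have "height b \<le> height p" unfolding p(2) using b by (intro Max_ge) auto
    moreover have "cmp b p" using b p by (auto simp: down_set_def intro: cmp_below)
    ultimately show ?thesis using height_mono[of p b] height_eq[of p b]
      by (auto simp: comparable_def)
  qed
  moreover have "b \<in> ?D" if b: "(b, p) \<in> le" for b
  proof -
    have pa: "(p, a) \<in> le" "p \<noteq> a" using p by (simp_all add: down_set_def)
    then have "b \<noteq> a" using le_antisym[of p a] b by auto
    then show ?thesis using le_trans[OF b pa(1)] by (simp add: down_set_def)
  qed
  ultimately have "?D = {b. (b, p) \<in> le}" by blast
  then have "?D = down_set p" by (simp only: down_set_def[of p])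
  then show ?thesis unfolding is_cover_def by (rule exI)
qed

definition cover :: "'a \<Rightarrow> ('a \<Rightarrow>\<^sub>0 'k)" where
  "cover a = (if down_set a - {a} = {} then 0 else bas (SOME p. is_cover a p))"

lemma cover_cases:
  obtains "down_set a - {a} = {}" "cover a = 0" | p where "is_cover a p" "cover a = bas p" "p \<in> Q" "(p, a) \<in> le" "p \<noteq> a"
proof (cases "down_set a - {a} = {}")
  case True
  then show ?thesis using that(1) by (simp add: cover_def)
next
  case False
  define p where "p = (SOME p. is_cover a p)"
  have p: "is_cover a p" unfolding p_def using cover_exists[OF False] by (rule someI_ex)
  then have "down_set p \<noteq> {}" using False by (simp add: is_cover_def)
  then have "p \<in> Q" by (auto simp: down_set_def dest: le_Q)
  then have "p \<in> down_set a - {a}" using p le_refl by (auto simp: is_cover_def down_set_def)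
  then show ?thesis using that(2)[of p] p False \<open>p \<in> Q\<close> by (auto simp: cover_def p_def down_set_def)
qed

text \<open>\<open>zeta\<close> writes the generators of \<open>AsQ\<close> in terms of those of
  \<open>Gr\<close>, and \<open>mobius\<close> goes back.\<close>

definition zeta :: "'a \<Rightarrow> ('a \<Rightarrow>\<^sub>0 'k)" where
  "zeta a = (\<Sum>b\<in>down_set a. bas b)"

definition mobius :: "'a \<Rightarrow> ('a \<Rightarrow>\<^sub>0 'k)" where
  "mobius a = bas a - cover a"

lemma coef_zeta: "coef (zeta a) b = (if (b, a) \<in> le then 1 else 0)"
  by (simp add: zeta_def lookup_sum lookup_single when_def down_set_def[symmetric] sum.delta)
    (simp add: down_set_def)

lemma supp_zeta: "b \<in> supp (zeta a) \<longleftrightarrow> (b, a) \<in> le"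
  by (simp add: in_keys_iff coef_zeta)

lemma supp_mobius: "b \<in> supp (mobius a) \<Longrightarrow> b = a \<or> ((b, a) \<in> le \<and> b \<noteq> a)"
  by (cases rule: cover_cases[of a]) (auto simp: mobius_def dest!: supp_diff_cases)

text \<open>The differences \<open>mobius c\<close> telescope along the chain below
  \<open>a\<close>.\<close>

lemma mobius_zeta:
  assumes "a \<in> Q"
  shows "lext mobius (zeta a) = bas a"
  using assms
proof (induction "height a" arbitrary: a rule: less_induct)
  case less
  have a: "a \<in> down_set a" using less.prems by (simp add: down_set_def le_refl)
  have sum: "lext mobius (zeta b) = (\<Sum>c\<in>down_set b. mobius c)" for b
    by (simp add: zeta_def lext_sum)
  have "lext mobius (zeta a) = mobius a + (\<Sum>c\<in>down_set a - {a}. mobius c)"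
    unfolding sum using a by (simp add: sum.remove)
  also have "(\<Sum>c\<in>down_set a - {a}. mobius c) = cover a"
  proof (cases rule: cover_cases[of a])
    case (2 p)
    then have "height p < height a" using height_mono height_eq by (meson le_neq_implies_less)
    then have "lext mobius (zeta p) = bas p" using 2 by (intro less.hyps) auto
    then show ?thesis using 2 sum[of p] by (simp add: is_cover_def)
  qed (simp only: sum.empty)
  finally show ?case by (simp add: mobius_def[of a])
qed

section \<open>The two substitutions respect the relations\<close>

lemma gens_As [simp]: "gens AsQ = Q"
  by (simp add: As_def)

lemma rels_As: "x \<in> rels AsQ \<longleftrightarrow> (\<exists>a b. a \<in> Q \<and> b \<in> Q \<and> cmp a b \<and>
    (x = bas (lcomb a b) - bas (rcomb (mn a b) (mn a b)) \<or> x = bas (lcomb (mn a b) (mn a b)) - bas (rcomb a b)))"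
  unfolding As_def by auto

lemma mn_Q: "a \<in> Q \<Longrightarrow> b \<in> Q \<Longrightarrow> mn a b \<in> Q"
  by (simp add: poset_min_def)

lemma rels_As_free: "rels AsQ \<subseteq> free_operad (gens AsQ) 3"
  by (auto simp: rels_As mn_Q intro!: pm.subspace_diff subspace_free_operad)

lemma tree_subst_lcomb:
  "tree_subst f (lcomb a b) = lext (\<lambda>c. push (\<lambda>d. lcomb c d) (f b)) (f a)"
  by (simp add: lext_lext lext_swap[of _ _ "f b"])

lemma tree_subst_rcomb:
  "tree_subst f (rcomb a b) = lext (\<lambda>c. push (\<lambda>d. rcomb c d) (f b)) (f a)"
  by (simp add: lext_lext)

lemma down_set_mn:
  assumes "cmp a b"
  shows "down_set (mn a b) = down_set a \<inter> down_set b"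
  using assms down_set_mono[of a b] down_set_mono[of b a]
  by (auto simp: comparable_def mn_le1 mn_le2)

text \<open>All labels \<open>c\<close> below \<open>a\<close> and \<open>d\<close> below
  \<open>b\<close> are comparable, so the terms with distinct \<open>c\<close> and \<open>d\<close>
  are relators. The diagonal terms run over the common lower bounds of \<open>a\<close> and
  \<open>b\<close>, which are the elements below the minimum.\<close>

lemma zeta_comb:
  assumes ab: "cmp a b"
    and comb: "\<And>c d. c \<in> Q \<Longrightarrow> d \<in> Q \<Longrightarrow> c \<noteq> d \<Longrightarrow> cmp c d \<Longrightarrow> bas (comb c d) \<in> rels Gr"
  shows "lext (\<lambda>c. push (\<lambda>d. comb c d) (zeta b)) (zeta a) - (\<Sum>c\<in>down_set (mn a b). bas (comb c c)) \<in> pm.span (rels Gr)"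
proof -
  have "(\<Sum>c\<in>down_set (mn a b). bas (comb c c)) = (\<Sum>c\<in>down_set a. if c \<in> down_set b then bas (comb c c) else 0)"
    unfolding down_set_mn[OF ab] by (simp add: sum.inter_restrict)
  also have "\<dots> = (\<Sum>c\<in>down_set a. \<Sum>d\<in>down_set b. if c = d then bas (comb c c) else 0)"
    by (intro sum.cong refl) simp
  finally have "lext (\<lambda>c. push (\<lambda>d. comb c d) (zeta b)) (zeta a) - (\<Sum>c\<in>down_set (mn a b). bas (comb c c))
      = (\<Sum>c\<in>down_set a. \<Sum>d\<in>down_set b. bas (comb c d) - (if c = d then bas (comb c c) else 0))"
    by (simp add: zeta_def lext_sum sum_subtractf)
  also have "\<dots> \<in> pm.span (rels Gr)"
  proof (intro pm.span_sum)
    fix c d assume cd: "c \<in> down_set a" "d \<in> down_set b"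
    then have c: "(c, a) \<in> le" and d: "(d, b) \<in> le" by (simp_all add: down_set_def)
    have "cmp c d"
      using ab cmp_below[OF le_trans[OF c] d] cmp_below[OF c le_trans[OF d]]
      by (auto simp: comparable_def[of le a b])
    then show "bas (comb c d) - (if c = d then bas (comb c c) else 0) \<in> pm.span (rels Gr)"
      using cd le_Q by (auto simp: down_set_def pm.span_zero intro!: pm.span_base comb)
  qed
  finally show ?thesis .
qed

text \<open>After substitution every comb depends only on the minimum of its labels, and the left
  and right diagonal sums agree modulo the relators with equal labels.\<close>

lemma zeta_rels:
  assumes "x \<in> rels AsQ"
  shows "lin_subst zeta x \<in> pm.span (rels Gr)"
proof -
  define Lsum where "Lsum a b = lext (\<lambda>c. push (\<lambda>d. lcomb c d) (zeta b)) (zeta a)" for a b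
  define Rsum where "Rsum a b = lext (\<lambda>c. push (\<lambda>d. rcomb c d) (zeta b)) (zeta a)" for a b
  define L0 where "L0 m = (\<Sum>c\<in>down_set m. bas (lcomb c c) :: _ \<Rightarrow>\<^sub>0 'k)" for m
  define R0 where "R0 m = (\<Sum>c\<in>down_set m. bas (rcomb c c) :: _ \<Rightarrow>\<^sub>0 'k)" for m
  have L: "Lsum a b - L0 (mn a b) \<in> pm.span (rels Gr)" if "cmp a b" for a b
    unfolding Lsum_def L0_def using that by (rule zeta_comb) (rule rels_Gr(2), auto)
  have R: "Rsum a b - R0 (mn a b) \<in> pm.span (rels Gr)" if "cmp a b" for a b
    unfolding Rsum_def R0_def using that by (rule zeta_comb) (rule rels_Gr(3), auto)
  have LR: "L0 m - R0 m \<in> pm.span (rels Gr)" for m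
    unfolding L0_def R0_def sum_subtractf[symmetric]
    by (intro pm.span_sum pm.span_base rels_Gr(1)) (auto simp: down_set_def dest: le_Q)
  have LR': "Lsum a b - Rsum c d \<in> pm.span (rels Gr)" if "cmp a b" "cmp c d" "mn a b = mn c d" for a b c d
  proof -
    have "Lsum a b - Rsum c d = (Lsum a b - L0 (mn a b)) + (L0 (mn a b) - R0 (mn a b)) - (Rsum c d - R0 (mn c d))"
      using that by simp
    also have "\<dots> \<in> pm.span (rels Gr)" using that by (intro pm.span_diff pm.span_add L R LR)
    finally show ?thesis .
  qed
  from assms obtain a b where ab: "a \<in> Q" "b \<in> Q" "cmp a b" and
    "x = bas (lcomb a b) - bas (rcomb (mn a b) (mn a b)) \<or> x = bas (lcomb (mn a b) (mn a b)) - bas (rcomb a b)"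
    unfolding rels_As by blast
  then show ?thesis
    using LR'[of a b "mn a b" "mn a b"] LR'[of "mn a b" "mn a b" a b] mn_Q cmp_refl
    by (auto simp: lext_lin tree_subst_lcomb tree_subst_rcomb Lsum_def Rsum_def mn_self simp del: tree_subst.simps)
qed

lemma comb_equiv:
  assumes "a \<in> Q" "b \<in> Q" "cmp a b"
  shows "bas (lcomb a b) - bas (rcomb (mn a b) (mn a b)) \<in> pm.span (rels AsQ)"
    "bas (rcomb a b) - bas (rcomb (mn a b) (mn a b)) \<in> pm.span (rels AsQ)"
proof -
  let ?m = "mn a b"
  have L: "bas (lcomb c d) - bas (rcomb (mn c d) (mn c d)) \<in> pm.span (rels AsQ)"
    if "c \<in> Q" "d \<in> Q" "cmp c d" for c d
    using that by (intro pm.span_base) (auto simp: rels_As)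
  show "bas (lcomb a b) - bas (rcomb ?m ?m) \<in> pm.span (rels AsQ)" using assms by (rule L)
  have R: "bas (lcomb ?m ?m) - bas (rcomb a b) \<in> pm.span (rels AsQ)"
    using assms by (intro pm.span_base) (auto simp: rels_As)
  have "bas (lcomb ?m ?m) - bas (rcomb ?m ?m) \<in> pm.span (rels AsQ)"
    using L[of ?m ?m] assms mn_Q[of a b] cmp_refl[of ?m] by (simp add: mn_self)
  from pm.span_diff[OF this R] show "bas (rcomb a b) - bas (rcomb ?m ?m) \<in> pm.span (rels AsQ)" by simp
qed

definition minsum :: "('a \<Rightarrow>\<^sub>0 'k) \<Rightarrow> ('a \<Rightarrow>\<^sub>0 'k) \<Rightarrow> ('a \<Rightarrow>\<^sub>0 'k)" where
  "minsum x y = lext (\<lambda>a. push (\<lambda>b. mn a b) y) x"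

lemma comb_sum_equiv:
  assumes "\<And>a b. a \<in> supp x \<Longrightarrow> b \<in> supp y \<Longrightarrow> a \<in> Q \<and> b \<in> Q \<and> cmp a b"
  shows "lext (\<lambda>a. push (\<lambda>b. lcomb a b) y) x - push (\<lambda>m. rcomb m m) (minsum x y) \<in> pm.span (rels AsQ)"
    "lext (\<lambda>a. push (\<lambda>b. rcomb a b) y) x - push (\<lambda>m. rcomb m m) (minsum x y) \<in> pm.span (rels AsQ)"
  unfolding minsum_def lext_lext lext_fun_diff[symmetric] lext_bas
  by (intro lext_in_span comb_equiv; use assms in auto)+

lemma mobius_supp_cmp:
  assumes "a \<in> Q" "b \<in> Q" "cmp a b" "c \<in> supp (mobius a)" "d \<in> supp (mobius b)"
  shows "c \<in> Q \<and> d \<in> Q \<and> cmp c d"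
proof -
  have c: "(c, a) \<in> le" and d: "(d, b) \<in> le"
    using supp_mobius[OF assms(4)] supp_mobius[OF assms(5)] le_refl[OF assms(1)] le_refl[OF assms(2)] by auto
  have "cmp c d"
    using assms(3) cmp_below[OF le_trans[OF c] d] cmp_below[OF c le_trans[OF d]]
    by (auto simp: comparable_def[of le a b])
  then show ?thesis using le_Q[OF c] le_Q[OF d] by simp
qed

text \<open>If \<open>a\<close> is strictly below \<open>b\<close>, it is still below the lower
  cover \<open>p\<close> of \<open>b\<close>. For every \<open>c\<close> below \<open>a\<close>, the
  minimum with \<open>b\<close> and the minimum with \<open>p\<close> are both \<open>c\<close>, and
  the difference in \<open>mobius b\<close> cancels.\<close>

lemma minsum_mobius:
  assumes "a \<in> Q" "b \<in> Q" "cmp a b" "a \<noteq> b"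
  shows "minsum (mobius a) (mobius b) = 0"
proof -
  have cov: "\<exists>p. mobius b = bas b - bas p \<and> (a, p) \<in> le" if "(a, b) \<in> le" "a \<noteq> b" for a b
  proof (cases rule: cover_cases[of b])
    case 1
    then show ?thesis using that by (auto simp: down_set_def)
  next
    case (2 p)
    have "a \<in> down_set b - {b}" using that by (auto simp: down_set_def)
    then have "a \<in> down_set p" using 2(1) unfolding is_cover_def by blast
    then show ?thesis using 2 by (auto simp: mobius_def down_set_def)
  qed
  have below: "(c, a) \<in> le" if "c \<in> supp (mobius a)" "a \<in> Q" for c a
    using supp_mobius[OF that(1)] le_refl[OF that(2)] by auto
  show ?thesis
  proof (cases "(a, b) \<in> le")
    case True
    then obtain p where p: "mobius b = bas b - bas p" "(a, p) \<in> le" using cov assms by blast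
    have "push (\<lambda>c. mn c q) (mobius a) = lext bas (mobius a)" if "(a, q) \<in> le" for q
      using that below[of _ a] assms le_trans by (intro lext_cong refl) (metis mn_le1)
    then show ?thesis using True p by (simp add: minsum_def lext_lin lext_fun_diff)
  next
    case False
    then have ba: "(b, a) \<in> le" using assms by (simp add: comparable_def)
    then obtain p where p: "mobius a = bas a - bas p" "(b, p) \<in> le" using cov assms by blast
    have "push (\<lambda>c. mn q c) (mobius b) = lext bas (mobius b)" if "(b, q) \<in> le" for q
      using that below[of _ b] assms le_trans by (intro lext_cong refl) (metis mn_le2)
    then show ?thesis using ba p by (simp add: minsum_def lext_lin)
  qed
qed

lemma mobius_rels:
  assumes "x \<in> rels Gr"
  shows "lin_subst mobius x \<in> pm.span (rels AsQ)"
proof -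
  let ?L = "\<lambda>a b. lext (\<lambda>c. push (\<lambda>d. lcomb c d) (mobius b)) (mobius a)"
  let ?R = "\<lambda>a b. lext (\<lambda>c. push (\<lambda>d. rcomb c d) (mobius b)) (mobius a)"
  let ?M = "\<lambda>a b. push (\<lambda>m. rcomb m m) (minsum (mobius a) (mobius b))"
  have eq: "?L a b - ?M a b \<in> pm.span (rels AsQ)" "?R a b - ?M a b \<in> pm.span (rels AsQ)"
    if "a \<in> Q" "b \<in> Q" "cmp a b" for a b
    by (rule comb_sum_equiv, rule mobius_supp_cmp[OF that], assumption+)+
  have 1: "?L a a - ?R a a \<in> pm.span (rels AsQ)" if "a \<in> Q" for a
  proof -
    have "(?L a a - ?M a a) - (?R a a - ?M a a) \<in> pm.span (rels AsQ)"
      using that cmp_refl by (intro pm.span_diff eq) auto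
    then show ?thesis by simp
  qed
  have 2: "?L a b \<in> pm.span (rels AsQ)" "?R a b \<in> pm.span (rels AsQ)"
    if "a \<in> Q" "b \<in> Q" "cmp a b" "a \<noteq> b" for a b
    using eq[of a b] minsum_mobius[of a b] that by simp_all
  show ?thesis
    using assms 1 2 by (auto simp: Gr_def lext_lin tree_subst_lcomb tree_subst_rcomb simp del: tree_subst.simps)
qed

theorem koszul_As: "koszul AsQ"
proof (rule koszul_generator_change[of AsQ Gr zeta mobius])
  show "generator_change AsQ Gr zeta"
    using finite_Q rels_As_free zeta_rels by unfold_locales (auto simp: supp_zeta dest: le_Q)
  show "generator_change Gr AsQ mobius"
    using finite_Q rels_Gr_free mobius_rels by unfold_locales (auto dest: supp_mobius le_Q)
qed (use mobius_zeta koszul_Gr in auto)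

section \<open>The Poincare-Birkhoff-Witt basis\<close>

text \<open>Both families point to the right comb on the minimum. Equal labels are left out of the
  second one, where the rule would be a loop.\<close>

definition rules :: "('a tree \<times> 'a tree) set" where
  "rules = {(lcomb a b, rcomb (mn a b) (mn a b)) | a b. a \<in> Q \<and> b \<in> Q \<and> cmp a b}
     \<union> {(rcomb a b, rcomb (mn a b) (mn a b)) | a b. a \<in> Q \<and> b \<in> Q \<and> cmp a b \<and> a \<noteq> b}"

abbreviation step :: "'a tree \<Rightarrow> 'a tree \<Rightarrow> bool" where "step \<equiv> rewrite_step Q rules"

lemma orientation_rules: "orientation AsQ rules"
  unfolding orientation_def
proof
  show "rules \<subseteq> syntax_trees (gens AsQ) 3 \<times> syntax_trees (gens AsQ) 3"
    by (auto simp: rules_def syntax_trees_def mn_Q)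
  let ?S = "{bas s - bas t :: _ \<Rightarrow>\<^sub>0 'k | s t. (s, t) \<in> rules}"
  have "?S \<subseteq> pm.span (rels AsQ)" using comb_equiv by (auto simp: rules_def)
  moreover have "rels AsQ \<subseteq> pm.span ?S"
  proof
    fix x assume "x \<in> rels AsQ"
    then obtain a b where ab: "a \<in> Q" "b \<in> Q" "cmp a b" and
      x: "x = bas (lcomb a b) - bas (rcomb (mn a b) (mn a b)) \<or> x = bas (lcomb (mn a b) (mn a b)) - bas (rcomb a b)"
      unfolding rels_As by blast
    have L: "bas (lcomb c d) - bas (rcomb (mn c d) (mn c d)) \<in> pm.span ?S" if "c \<in> Q" "d \<in> Q" "cmp c d" for c d
      using that by (intro pm.span_base) (auto simp: rules_def)
    have R: "bas (rcomb a b) - bas (rcomb (mn a b) (mn a b)) \<in> pm.span ?S"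
    proof (cases "a = b")
      case False
      then have "(rcomb a b, rcomb (mn a b) (mn a b)) \<in> rules" using ab by (auto simp: rules_def)
      then show ?thesis by (intro pm.span_base) blast
    qed (simp add: mn_self pm.span_zero)
    from x show "x \<in> pm.span ?S"
    proof
      let ?m = "mn a b"
      assume "x = bas (lcomb ?m ?m) - bas (rcomb a b)"
      then have "x = (bas (lcomb ?m ?m) - bas (rcomb ?m ?m)) - (bas (rcomb a b) - bas (rcomb ?m ?m))" by simp
      also have "\<dots> \<in> pm.span ?S"
        using L[of ?m ?m] mn_Q[OF ab(1,2)] cmp_refl[of ?m] by (intro pm.span_diff[OF _ R]) (simp add: mn_self)
      finally show ?thesis .
    qed (use L ab in auto)
  qed
  ultimately show "pm.span ?S = pm.span (rels AsQ)"
    unfolding pm.span_eq by simp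
qed

section \<open>Termination of the rewriting\<close>

fun heights :: "'a tree \<Rightarrow> nat" where
  "heights Leaf = 0"
| "heights \<langle>l, a, r\<rangle> = heights l + height a + heights r"

text \<open>A right rotation lowers it by the number of leaves of the leftmost of the three
  subtrees, which is positive.\<close>

fun left_weight :: "'a tree \<Rightarrow> nat" where
  "left_weight Leaf = 0"
| "left_weight \<langle>l, a, r\<rangle> = size1 l + left_weight l + left_weight r"

lemma heights_graft: "1 \<le> i \<Longrightarrow> i \<le> size1 t \<Longrightarrow> heights (graft t i s) = heights t + heights s"
  by (induction t arbitrary: i) auto

lemma left_weight_graft:
  assumes "size1 s' = size1 s" "left_weight s' < left_weight s"
  shows "1 \<le> i \<Longrightarrow> i \<le> size1 t \<Longrightarrow> left_weight (graft t i s') < left_weight (graft t i s)"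
proof (induction t arbitrary: i)
  case (Node l a r)
  show ?case
  proof (cases "i \<le> size1 l")
    case True
    then show ?thesis
      using Node.IH(1)[of i] Node.prems size1_graft[of i l s] size1_graft[of i l s'] assms by simp
  next
    case False
    then show ?thesis using Node.IH(2)[of "i - size1 l"] Node.prems by simp
  qed
qed (use assms in simp)

lemma height_mn: "cmp a b \<Longrightarrow> height (mn a b) + height (mn a b) \<le> height a + height b"
  using height_mono[of a b] height_mono[of b a] by (auto simp: comparable_def mn_le1 mn_le2)

lemma height_mn_less: "cmp a b \<Longrightarrow> a \<noteq> b \<Longrightarrow> height (mn a b) + height (mn a b) < height a + height b"
  using height_mono[of a b] height_mono[of b a] height_eq[of a b] height_eq[of b a]
  by (fastforce simp: comparable_def mn_le1 mn_le2 order_less_le)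

lemma step_cases:
  assumes "step t t'"
  obtains (left) U i x y z a b where "t = graft U i \<langle>\<langle>x, b, y\<rangle>, a, z\<rangle>"
    "t' = graft U i \<langle>x, mn a b, \<langle>y, mn a b, z\<rangle>\<rangle>" "cmp a b" "a \<in> Q" "b \<in> Q" "1 \<le> i" "i \<le> size1 U"
    "set_tree U \<union> set_tree x \<union> set_tree y \<union> set_tree z \<subseteq> Q"
  | (right) U i x y z a b where "t = graft U i \<langle>x, a, \<langle>y, b, z\<rangle>\<rangle>"
    "t' = graft U i \<langle>x, mn a b, \<langle>y, mn a b, z\<rangle>\<rangle>" "cmp a b" "a \<noteq> b" "a \<in> Q" "b \<in> Q" "1 \<le> i" "i \<le> size1 U"
    "set_tree U \<union> set_tree x \<union> set_tree y \<union> set_tree z \<subseteq> Q"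
  using assms
proof (cases rule: rewrite_step.cases)
  case (1 s s' U i ts)
  obtain x y z where ts: "ts = [x, y, z]" using 1 by (auto simp: length_3_conv)
  from 1(3) show ?thesis
    unfolding rules_def
  proof (elim UnE CollectE exE conjE)
    fix a b assume "(s, s') = (lcomb a b, rcomb (mn a b) (mn a b))" "a \<in> Q" "b \<in> Q" "cmp a b"
    then show ?thesis using 1 by (intro left[of U i x b y a z]) (auto simp: ts)
  next
    fix a b assume "(s, s') = (rcomb a b, rcomb (mn a b) (mn a b))" "a \<in> Q" "b \<in> Q" "cmp a b" "a \<noteq> b"
    then show ?thesis using 1 by (intro right[of U i x a y b z]) (auto simp: ts)
  qed
qed

lemma stepI:
  assumes "cmp a b" "a \<in> Q" "b \<in> Q" "1 \<le> i" "i \<le> size1 U"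
    "set_tree U \<union> set_tree x \<union> set_tree y \<union> set_tree z \<subseteq> Q"
  shows "step (graft U i \<langle>\<langle>x, b, y\<rangle>, a, z\<rangle>) (graft U i \<langle>x, mn a b, \<langle>y, mn a b, z\<rangle>\<rangle>)"
    "a \<noteq> b \<Longrightarrow> step (graft U i \<langle>x, a, \<langle>y, b, z\<rangle>\<rangle>) (graft U i \<langle>x, mn a b, \<langle>y, mn a b, z\<rangle>\<rangle>)"
  using rewrite_step.intros[of "lcomb a b" "rcomb (mn a b) (mn a b)" rules U Q i "[x, y, z]"]
    rewrite_step.intros[of "rcomb a b" "rcomb (mn a b) (mn a b)" rules U Q i "[x, y, z]"] assms
  by (auto simp: rules_def)

lemma step_labels:
  assumes "step t t'"
  shows "set_tree t \<subseteq> Q \<and> set_tree t' \<subseteq> Q \<and> size1 t' = size1 t"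
  using assms
proof (cases rule: step_cases)
  case (left U i x y z a b)
  then show ?thesis
    using size1_graft[of i U "\<langle>\<langle>x, b, y\<rangle>, a, z\<rangle>"] size1_graft[of i U "\<langle>x, mn a b, \<langle>y, mn a b, z\<rangle>\<rangle>"] mn_Q
    by (auto simp: set_tree_graft)
next
  case (right U i x y z a b)
  then show ?thesis
    using size1_graft[of i U "\<langle>x, a, \<langle>y, b, z\<rangle>\<rangle>"] size1_graft[of i U "\<langle>x, mn a b, \<langle>y, mn a b, z\<rangle>\<rangle>"] mn_Q
    by (auto simp: set_tree_graft)
qed

text \<open>Lexicographic measure: the rules on right combs strictly lower the sum of heights, while
  those on left combs do not raise it and strictly lower \<open>left_weight\<close>.\<close>

lemma wfp_step: "wfp step\<inverse>\<inverse>"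
proof -
  have "heights t' < heights t \<or> heights t' \<le> heights t \<and> left_weight t' < left_weight t" if "step t t'" for t t'
    using that
  proof (cases rule: step_cases)
    case (left U i x y z a b)
    have "left_weight t' < left_weight t"
      unfolding left(1,2) using left by (intro left_weight_graft) auto
    then show ?thesis using left height_mn[of a b] by (simp add: heights_graft)
  next
    case (right U i x y z a b)
    then show ?thesis using height_mn_less[of a b] by (simp add: heights_graft)
  qed
  then have "{(x, y). step\<inverse>\<inverse> x y} \<subseteq> inv_image (less_than <*lex*> less_than) (\<lambda>t. (heights t, left_weight t))"
    by (fastforce simp: order_le_less)
  moreover have "wf (inv_image (less_than <*lex*> less_than) (\<lambda>t. (heights t, left_weight t)))"
    by (intro wf_inv_image wf_lex_prod wf_less_than)
  ultimately show ?thesis unfolding wfp_def by (rule wf_subset[rotated])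
qed

section \<open>Normal forms and normalization\<close>

lemma subtree_context:
  "s \<in> subtrees t \<Longrightarrow> \<exists>U i. 1 \<le> i \<and> i \<le> size1 U \<and> set_tree U \<subseteq> set_tree t \<and> t = graft U i s"
proof (induction t)
  case Leaf
  then show ?case by (intro exI[of _ "Leaf"] exI[of _ 1]) simp
next
  case (Node l a r)
  consider "s = \<langle>l, a, r\<rangle>" | "s \<in> subtrees l" | "s \<in> subtrees r" using Node.prems by auto
  then show ?case
  proof cases
    case 1
    then show ?thesis by (intro exI[of _ "Leaf"] exI[of _ 1]) simp
  next
    case 2
    then obtain U i where "1 \<le> i" "i \<le> size1 U" "set_tree U \<subseteq> set_tree l" "l = graft U i s"
      using Node.IH by blast
    then show ?thesis by (intro exI[of _ "\<langle>U, a, r\<rangle>"] exI[of _ i]) auto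
  next
    case 3
    then obtain U i where "1 \<le> i" "i \<le> size1 U" "set_tree U \<subseteq> set_tree r" "r = graft U i s"
      using Node.IH by blast
    then show ?thesis by (intro exI[of _ "\<langle>l, a, U\<rangle>"] exI[of _ "i + size1 l"]) auto
  qed
qed

lemma subtrees_refl: "t \<in> subtrees t"
  by (cases t) auto

lemma subtrees_graft: "1 \<le> i \<Longrightarrow> i \<le> size1 U \<Longrightarrow> s \<in> subtrees (graft U i s)"
  by (induction U arbitrary: i) (auto simp: subtrees_refl)

lemma set_subtrees: "s \<in> subtrees t \<Longrightarrow> set_tree s \<subseteq> set_tree t"
  by (induction t) auto

lemma normal_forms: "rewriting_normal_forms Q rules = normal_trees Q le"
proof
  show "rewriting_normal_forms Q rules \<subseteq> normal_trees Q le"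
  proof
    fix t assume t: "t \<in> rewriting_normal_forms Q rules"
    then have Q: "set_tree t \<subseteq> Q" and no: "\<And>t'. \<not> step t t'" by (auto simp: rewriting_normal_forms_def)
    have l: "\<not> cmp a b" if s: "\<langle>\<langle>x, b, y\<rangle>, a, z\<rangle> \<in> subtrees t" for a b x y z
    proof
      assume "cmp a b"
      obtain U i where "1 \<le> i" "i \<le> size1 U" "set_tree U \<subseteq> set_tree t" "t = graft U i \<langle>\<langle>x, b, y\<rangle>, a, z\<rangle>"
        using subtree_context[OF s] by blast
      moreover have "set_tree \<langle>\<langle>x, b, y\<rangle>, a, z\<rangle> \<subseteq> Q" using set_subtrees[OF s] Q by (rule subset_trans)
      ultimately show False using stepI(1)[OF \<open>cmp a b\<close>, of i U x y z] Q no by auto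
    qed
    have r: "a = b \<or> \<not> cmp a b" if s: "\<langle>x, a, \<langle>y, b, z\<rangle>\<rangle> \<in> subtrees t" for a b x y z
    proof (rule ccontr)
      assume "\<not> (a = b \<or> \<not> cmp a b)"
      then have ab: "cmp a b" "a \<noteq> b" by auto
      obtain U i where "1 \<le> i" "i \<le> size1 U" "set_tree U \<subseteq> set_tree t" "t = graft U i \<langle>x, a, \<langle>y, b, z\<rangle>\<rangle>"
        using subtree_context[OF s] by blast
      moreover have "set_tree \<langle>x, a, \<langle>y, b, z\<rangle>\<rangle> \<subseteq> Q" using set_subtrees[OF s] Q by (rule subset_trans)
      ultimately show False using stepI(2)[OF ab(1), of i U x y z] Q no ab by auto
    qed
    show "t \<in> normal_trees Q le" using Q l r unfolding normal_trees_def by blast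
  qed
  show "normal_trees Q le \<subseteq> rewriting_normal_forms Q rules"
  proof
    fix t assume t: "t \<in> normal_trees Q le"
    have False if "step t t'" for t'
      using that
    proof (cases rule: step_cases)
      case (left U i x y z a b)
      then have "\<langle>\<langle>x, b, y\<rangle>, a, z\<rangle> \<in> subtrees t" using subtrees_graft by simp
      then show False using t left unfolding normal_trees_def by blast
    next
      case (right U i x y z a b)
      then have "\<langle>x, a, \<langle>y, b, z\<rangle>\<rangle> \<in> subtrees t" using subtrees_graft by simp
      then show False using t right unfolding normal_trees_def by blast
    qed
    then show "t \<in> rewriting_normal_forms Q rules" using t
      by (auto simp: rewriting_normal_forms_def normal_trees_def)
  qed
qed

lemma step_ideal:
  assumes "step t t'"
  shows "bas t - bas t' \<in> operad_ideal AsQ (size1 t)"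
proof -
  have main: "bas (graft U i (graft_all s [x, y, z])) - bas (graft U i (graft_all s' [x, y, z])) \<in> operad_ideal AsQ (size1 t)"
    if st: "bas s - bas s' \<in> pm.span (rels AsQ)" and t: "t = graft U i (graft_all s [x, y, z])" and s: "size1 s = 3"
      and h: "1 \<le> i" "i \<le> size1 U" "set_tree U \<union> set_tree x \<union> set_tree y \<union> set_tree z \<subseteq> Q" for U i x y z s s'
  proof -
    have "bas s - bas s' \<in> operad_ideal AsQ 3" using st span_rels_subset_ideal by blast
    then have "push (\<lambda>t. graft_all t [x, y, z]) (bas s - bas s') \<in> operad_ideal AsQ (size1 x + size1 y + size1 z)"
      using h rels_As_free by (intro ideal_graft_all) auto
    then have "push (\<lambda>t. graft U i t) (push (\<lambda>t. graft_all t [x, y, z]) (bas s - bas s'))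
        \<in> operad_ideal AsQ (size1 U + (size1 x + size1 y + size1 z) - 1)"
      using h by (intro ideal_graft) auto
    moreover have "size1 U + (size1 x + size1 y + size1 z) - 1 = size1 t"
    proof -
      have "size1 (graft_all s [x, y, z]) = size1 x + size1 y + size1 z"
        using s unfolding size1_eq_3 by auto
      then show ?thesis using size1_graft[OF h(1,2), of "graft_all s [x, y, z]"] t by simp
    qed
    ultimately show ?thesis by (simp add: lext_lin del: graft_all.simps)
  qed
  from assms show ?thesis
  proof (cases rule: step_cases)
    case (left U i x y z a b)
    then show ?thesis
      using main[of "lcomb a b" "rcomb (mn a b) (mn a b)" U i x y z] comb_equiv(1)[of a b] by simp
  next
    case (right U i x y z a b)
    then show ?thesis
      using main[of "rcomb a b" "rcomb (mn a b) (mn a b)" U i x y z] comb_equiv(2)[of a b] by simp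
  qed
qed

lemma normalization:
  assumes "set_tree t \<subseteq> Q"
  shows "\<exists>u. step\<^sup>*\<^sup>* t u \<and> u \<in> normal_trees Q le \<and> size1 u = size1 t \<and> bas t - bas u \<in> operad_ideal AsQ (size1 t)"
  using assms
proof (induction t rule: wfp_induct_rule[OF wfp_step])
  case (1 t)
  show ?case
  proof (cases "\<exists>t'. step t t'")
    case True
    then obtain t' where t': "step t t'" by blast
    then obtain u where u: "step\<^sup>*\<^sup>* t' u" "u \<in> normal_trees Q le" "size1 u = size1 t'"
      "bas t' - bas u \<in> operad_ideal AsQ (size1 t')"
      using 1(1)[of t'] step_labels[OF t'] by auto
    have "(bas t - bas t') + (bas t' - bas u) \<in> operad_ideal AsQ (size1 t)"
      using step_ideal[OF t'] u step_labels[OF t'] by (intro pm.subspace_add[OF subspace_operad_ideal]) auto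
    then show ?thesis
      using u t' step_labels[OF t'] by (intro exI[of _ u]) auto
  next
    case False
    then have "t \<in> normal_trees Q le"
      using 1(2) by (auto simp: rewriting_normal_forms_def simp flip: normal_forms)
    then show ?thesis by (intro exI[of _ t]) (simp add: pm.subspace_0[OF subspace_operad_ideal])
  qed
qed

section \<open>Linear independence of the normal trees, and confluence\<close>

lemma heights_rjoin: "heights (rjoin l a r) = heights l + height a + heights r"
  by (induction l) auto

lemma heights_rnf [simp]: "heights (rnf t) = heights t"
  by (induction t) (auto simp: heights_rjoin)

text \<open>Each label is replaced by itself and elements strictly below it, which have smaller
  height. With \<open>coef_tree_subst_zeta\<close> the substitution is unitriangular.\<close>

lemma supp_tree_subst_zeta:
  "s \<in> supp (tree_subst zeta t) \<Longrightarrow> heights s \<le> heights t \<and> (heights s = heights t \<longrightarrow> s = t)"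
proof (induction t arbitrary: s)
  case (Node l a r)
  obtain l' b r' where s: "l' \<in> supp (tree_subst zeta l)" "b \<in> supp (zeta a)" "r' \<in> supp (tree_subst zeta r)" "s = \<langle>l', b, r'\<rangle>"
    using Node.prems by (auto elim!: in_supp_lext)
  have "height b \<le> height a" "height b = height a \<longrightarrow> b = a" using s(2) height_mono height_eq by (auto simp: supp_zeta)
  then show ?case using Node.IH(1)[OF s(1)] Node.IH(2)[OF s(3)] s(4) by auto
qed simp

lemma coef_tree_subst_zeta: "set_tree t \<subseteq> Q \<Longrightarrow> coef (tree_subst zeta t) t = 1"
  by (induction t) (auto simp: coef_zeta le_refl simp del: tree_subst.simps(2))

text \<open>Hence \<open>NF\<close> fixes every normal tree.\<close>

lemma normal_trees_nf:
  "t \<in> normal_trees Q le \<Longrightarrow> set_tree t \<subseteq> Q \<and> is_rnf t \<and> loose t"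
proof (induction t)
  case (Node l a r)
  have "l \<in> normal_trees Q le" "r \<in> normal_trees Q le"
    using Node.prems by (auto simp: normal_trees_def)
  moreover have "a \<in> Q" using Node.prems by (auto simp: normal_trees_def)
  moreover have "root_sat (\<lambda>b. \<not> cmp a b) l" "root_sat (\<lambda>b. a = b \<or> \<not> cmp a b) r"
    using Node.prems by (cases l; cases r; auto simp: normal_trees_def)+
  ultimately show ?case using Node.IH Node.prems cmp_refl
    by (cases l; cases r) (auto simp: normal_trees_def)
qed simp

text \<open>At a tree of maximal total height in the support, no other tree of the support
  contributes: its expansion reaches its own height only at itself, and rotations preserve total
  height. So the coefficient there survives \<open>zeta\<close> and \<open>NF\<close>, although the
  ideal is mapped to 0.\<close>

lemma normal_trees_independent:
  assumes y: "y \<in> operad_ideal AsQ n" "supp y \<subseteq> normal_trees Q le"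
  shows "y = 0"
proof (rule ccontr)
  assume "y \<noteq> 0"
  then have ne: "supp y \<noteq> {}" by simp
  have "Max (heights ` supp y) \<in> heights ` supp y" using ne by (intro Max_in) auto
  then obtain t where t: "t \<in> supp y" "heights t = Max (heights ` supp y)" by auto
  have max: "heights s \<le> heights t" if "s \<in> supp y" for s
    unfolding t(2) using that by (intro Max_ge) auto
  have "lin_subst zeta y \<in> operad_ideal Gr n"
    using rels_As_free zeta_rels y(1) by (intro lin_subst_operad_ideal[of AsQ]) (auto simp: supp_zeta dest: le_Q)
  then have "lext NF (lin_subst zeta y) = 0" by (rule NF_ideal)
  then have "0 = coef (lext (\<lambda>s. lext NF (tree_subst zeta s)) y) t"
    by (simp add: lext_lext)
  also have "\<dots> = (\<Sum>s\<in>supp y. if s = t then coef y t else 0)"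
    unfolding coef_lext[of _ y]
  proof (intro sum.cong refl)
    fix s assume s: "s \<in> supp y"
    then have sN: "set_tree s \<subseteq> Q" "is_rnf s" "loose s" using normal_trees_nf y(2) by blast+
    have "coef (NF s') t = 0" if "s' \<in> supp (tree_subst zeta s)" "s' \<noteq> s" for s'
    proof -
      have "heights s' < heights s" using supp_tree_subst_zeta[OF that(1)] that(2) by auto
      then have "rnf s' \<noteq> t" using max[OF s] by auto
      then show ?thesis by (simp add: NF_def lookup_single when_def)
    qed
    then have "coef (lext NF (tree_subst zeta s)) t = (\<Sum>s'\<in>supp (tree_subst zeta s). if s' = s then coef (tree_subst zeta s) s * coef (NF s) t else 0)"
      unfolding coef_lext by (intro sum.cong) auto
    also have "\<dots> = coef (NF s) t"
      using coef_tree_subst_zeta[OF sN(1)] by (simp add: in_keys_iff)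
    also have "\<dots> = (if s = t then 1 else 0)"
      using sN by (simp add: NF_def rnf_is_rnf lookup_single when_def)
    finally show "coef y s * coef (lext NF (tree_subst zeta s)) t = (if s = t then coef y t else 0)"
      by simp
  qed
  also have "\<dots> = coef y t" using t(1) by simp
  finally show False using t(1) by (simp add: in_keys_iff)
qed

lemma steps_ideal:
  assumes "step\<^sup>*\<^sup>* t u"
  shows "size1 u = size1 t \<and> bas t - bas u \<in> operad_ideal AsQ (size1 t) \<and> (set_tree t \<subseteq> Q \<longrightarrow> set_tree u \<subseteq> Q)"
  using assms
proof induction
  case base
  then show ?case by (simp add: pm.subspace_0[OF subspace_operad_ideal])
next
  case (step u v)
  have "(bas t - bas u) + (bas u - bas v) \<in> operad_ideal AsQ (size1 t)"
    using step_ideal[OF step(2)] step by (intro pm.subspace_add[OF subspace_operad_ideal]) auto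
  then show ?case using step step_labels[OF step(2)] by simp
qed

text \<open>Critical pairs are avoided: normal forms of \<open>y\<close> and \<open>z\<close> are
  both congruent to \<open>x\<close> modulo the ideal, so their difference vanishes by
  independence.\<close>

lemma confluent_step: "confluentp step"
proof (rule confluentpI)
  fix x y z assume xy: "step\<^sup>*\<^sup>* x y" and xz: "step\<^sup>*\<^sup>* x z"
  show "\<exists>u. step\<^sup>*\<^sup>* y u \<and> step\<^sup>*\<^sup>* z u"
  proof (cases "set_tree x \<subseteq> Q")
    case False
    \<comment> \<open>Rewriting steps exist only between trees labeled in \<open>Q\<close>, so any
      other tree is isolated.\<close>
    then have no: "\<not> step x t" for t using step_labels[of x t] by blast
    have "y = x" using xy by (rule converse_rtranclpE) (use no in auto)
    moreover have "z = x" using xz by (rule converse_rtranclpE) (use no in auto)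
    ultimately have "y = x" "z = x" .
    then show ?thesis by blast
  next
    case True
    obtain u where u: "step\<^sup>*\<^sup>* y u" "u \<in> normal_trees Q le"
      using normalization[of y] steps_ideal[OF xy] True by blast
    obtain v where v: "step\<^sup>*\<^sup>* z v" "v \<in> normal_trees Q le"
      using normalization[of z] steps_ideal[OF xz] True by blast
    have xuv: "bas x - bas u \<in> operad_ideal AsQ (size1 x)" "bas x - bas v \<in> operad_ideal AsQ (size1 x)"
      using steps_ideal[OF rtranclp_trans[OF xy u(1)]] steps_ideal[OF rtranclp_trans[OF xz v(1)]] by auto
    from pm.subspace_diff[OF subspace_operad_ideal xuv(2,1)] have "bas u - bas v \<in> operad_ideal AsQ (size1 x)" by simp
    then have "bas u - (bas v :: _ \<Rightarrow>\<^sub>0 'k) = 0"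
      using u v by (intro normal_trees_independent) (auto dest!: supp_diff_cases)
    then have "u = v" by (metis eq_iff_diff_eq_0 inj_single lookup_single_eq lookup_single_not_eq zero_neq_one)
    then show ?thesis using u v by blast
  qed
qed

lemma induces_basis_normal_trees: "induces_basis AsQ (normal_trees Q le)"
  unfolding induces_basis_def
proof (intro conjI ballI allI)
  show "set_tree t \<subseteq> gens AsQ" if "t \<in> normal_trees Q le" for t
    using that by (simp add: normal_trees_def)
  fix n and x :: "'a tree \<Rightarrow>\<^sub>0 'k" assume x: "x \<in> free_operad (gens AsQ) n"
  obtain nf where nf: "\<And>t. set_tree t \<subseteq> Q \<Longrightarrow> nf t \<in> normal_trees Q le \<and> size1 (nf t) = size1 t \<and>
      bas t - bas (nf t) \<in> operad_ideal AsQ (size1 t)"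
    using normalization by metis
  have xQ: "set_tree t \<subseteq> Q" "size1 t = n" if "t \<in> supp x" for t using x that by (auto simp: free_operad_iff)
  let ?y = "push nf x"
  have supp_y: "\<exists>s. s \<in> supp x \<and> t = nf s" if "t \<in> supp ?y" for t
    using that by (auto elim: in_supp_push)
  have "lext (\<lambda>t. bas t - bas (nf t)) x \<in> operad_ideal AsQ n"
    using nf xQ by (intro lext_in_subspace subspace_operad_ideal) metis
  then have "x - ?y \<in> operad_ideal AsQ n" by (simp add: lext_fun_diff)
  moreover have "supp ?y \<subseteq> normal_trees Q le" using supp_y nf xQ by blast
  moreover have "?y \<in> free_operad (gens AsQ) n"
    using supp_y nf xQ normal_trees_nf by (fastforce simp: free_operad_iff)
  moreover have "y = y'" if "supp y \<subseteq> normal_trees Q le" "x - y \<in> operad_ideal AsQ n"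
      "supp y' \<subseteq> normal_trees Q le" "x - y' \<in> operad_ideal AsQ n" for y y'
  proof -
    have "(x - y') - (x - y) \<in> operad_ideal AsQ n"
      using that by (intro pm.subspace_diff[OF subspace_operad_ideal, of "x - y'" AsQ n "x - y"])
    then have "y - y' \<in> operad_ideal AsQ n" by simp
    then have "y - y' = 0"
      using that by (intro normal_trees_independent[of _ n]) (auto dest!: supp_diff_cases)
    then show ?thesis by simp
  qed
  ultimately show "\<exists>!y. y \<in> free_operad (gens AsQ) n \<and> supp y \<subseteq> normal_trees Q le \<and> x - y \<in> operad_ideal AsQ n"
    by (intro ex1I[of _ ?y]) auto
qed

theorem pbw_basis_As: "pbw_basis AsQ (normal_trees Q le)"
  unfolding pbw_basis_def gens_As
  using orientation_rules wfp_step confluent_step normal_forms induces_basis_normal_trees by blast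

end

theorem theorem3p5:
  fixes Q :: "'a set" and le :: "('a \<times> 'a) set"
  assumes "finite Q" and "forest_poset Q le"
  shows "koszul (As Q le :: ('a, 'k::field_char_0) presentation) \<and>
         pbw_basis (As Q le :: ('a, 'k) presentation) (normal_trees Q le)"
proof -
  interpret forest Q le "TYPE('k)" using assms by unfold_locales
  show ?thesis using koszul_As pbw_basis_As by simp
qed

end
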